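(* Suppose there exists an algorithm making $m(n,\varepsilon,\delta)$ queries which, given {\sf NACOND} access to an unknown distribution $p$ over $[n]$ and an explicit description of a distribution $q$ over $[n]$ with $\|q - \mathcal{U}_n\|_\infty \leq \frac{1}{100n}$, distinguishes between the cases $p = q$ and $d_{\mathrm{TV}}(p,q) \geq \varepsilon$ with probability at least $1 - \delta$. Then there exists an algorithm which, given {\sf NACOND} access to an unknown distribution $p$ on $[n]$ and an explicit description of an arbitrary distribution $q$ on $[n]$, makes $$O\left(\log (n/\varepsilon) \cdot m\left(n, \varepsilon/2, \frac{\log (1 + 1/100)}{6\log (100n/\varepsilon)}\right) + \frac{\sqrt{\log (n/\varepsilon)}}{\varepsilon^2}\right)$$ queries to the oracle on $p$ and distinguishes between the cases $p = q$ and $d_{\mathrm{TV}}(p,q) \geq \varepsilon$ with probability at least $2/3$.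
   Context: Distributions are over the finite domain $[n]=\{1,\dots,n\}$; $\mathcal{U}_n$ is the uniform distribution on $[n]$; $\|x\|_\infty=\max_i|x(i)|$. For $S\subseteq[n]$, $p(S)=\sum_{i\in S}p(i)$. A conditional sampling oracle for $p$ takes as input a query set $S\subseteq[n]$ and returns a symbol $i\in S$ drawn with probability $p(i)/p(S)$; if $p(S)=0$ it returns a uniformly random element of $S$. In the non-adaptive model ({\sf NACOND}), the algorithm must specify all of its query sets (possibly using its own randomness) before seeing the result of any query. Total variation distance: $d_{\mathrm{TV}}(p,q)=\frac12\sum_{i\in[n]}|p(i)-q(i)|$. $\log$ is base 2. *)

theory Defs
  imports "HOL-Probability.Probability"
begin

definition is_dist :: "nat \<Rightarrow> nat pmf \<Rightarrow> bool" where
  "is_dist n p \<longleftrightarrow> set_pmf p \<subseteq> {1..n}"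

definition cond_sample :: "nat pmf \<Rightarrow> nat set \<Rightarrow> nat pmf" where
  "cond_sample p S = (if measure_pmf.prob p S = 0 then pmf_of_set S else cond_pmf p S)"

fun answers :: "nat pmf \<Rightarrow> nat set list \<Rightarrow> nat list pmf" where
  "answers p [] = return_pmf []"
| "answers p (S # Ss) =
     bind_pmf (cond_sample p S) (\<lambda>x. map_pmf (\<lambda>xs. x # xs) (answers p Ss))"

text \<open>A non-adaptive (NACOND) algorithm: using its own randomness it chooses the list of
  all query sets together with a decision rule (True = accept, i.e. "p = q") applied to
  the list of answers. The choice does not depend on p.\<close>
type_synonym nacond_alg = "(nat set list \<times> (nat list \<Rightarrow> bool)) pmf"

definition valid_alg :: "nat \<Rightarrow> real \<Rightarrow> nacond_alg \<Rightarrow> bool" where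
  "valid_alg n m A \<longleftrightarrow>
     (\<forall>(Qs, d) \<in> set_pmf A. real (length Qs) \<le> m \<and> (\<forall>S \<in> set Qs. S \<noteq> {} \<and> S \<subseteq> {1..n}))"

definition run :: "nacond_alg \<Rightarrow> nat pmf \<Rightarrow> bool pmf" where
  "run A p = bind_pmf A (\<lambda>(Qs, d). map_pmf d (answers p Qs))"

definition accept_prob :: "nacond_alg \<Rightarrow> nat pmf \<Rightarrow> real" where
  "accept_prob A p = measure_pmf.prob (run A p) {True}"

definition dTV :: "nat \<Rightarrow> nat pmf \<Rightarrow> nat pmf \<Rightarrow> real" where
  "dTV n p q = (1/2) * (\<Sum>i\<in>{1..n}. \<bar>pmf p i - pmf q i\<bar>)"

definition dist_unif_inf :: "nat \<Rightarrow> nat pmf \<Rightarrow> real" where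
  "dist_unif_inf n q = Max ((\<lambda>i. \<bar>pmf q i - 1 / real n\<bar>) ` {1..n})"

definition correct_tester :: "nat \<Rightarrow> real \<Rightarrow> real \<Rightarrow> nat pmf \<Rightarrow> nacond_alg \<Rightarrow> bool" where
  "correct_tester n eps delta q A \<longleftrightarrow>
     (\<forall>p. is_dist n p \<longrightarrow>
        (p = q \<longrightarrow> accept_prob A p \<ge> 1 - delta) \<and>
        (dTV n p q \<ge> eps \<longrightarrow> 1 - accept_prob A p \<ge> 1 - delta))"

end

(*
  The hypothesis says nothing about how m depends on n, so the given tester cannot be run on the
  smaller domains of the buckets of q. The proof instead combines a lower bound for m with an
  identity tester that does not use the given algorithm at all. Write L = log2 (n / eps).

  Lower bound. Two distributions near uniform whose likelihood ratio is 1 + O(eps) are separated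
  with error delta only if (1 + O(eps^2))^m >= 1 / (2 delta), by the second moment of the likelihood
  ratio. With the given delta of order 1 / L, this yields m >= c (1 + ln L) / eps^2.

  Tester with O(L (1 + ln L) / eps^2) queries. Up to mass eps/16, q is a union of O(L) buckets on
  which it is constant up to a factor 2; each bucket is covered by two groups whose size is a power
  of two. If p and q differ on the partition generated by the groups, a random union of its classes
  sees a difference of order eps / sqrt L, which O(L / eps^2) samples detect. Otherwise p differs
  from q inside the groups. There one merges random pairs of blocks, starting from single elements.
  The total deficit (the sum of the positive parts of q - p over the blocks) falls from its initial
  value to 0, and it falls only when a deficient block meets a non-deficient one. The conditional
  probability of the deficient block in such a pair is then off by its full relative deficit,
  whereas the total deficit falls by at most that much. Because partners are random, deficits of
  order eps or more carry a constant fraction of the decrease as long as the total deficit is of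
  order eps. So querying the union of a random pair at a random level has an expected bias, counting
  only biases of order eps and larger, of order eps / L. Dyadic levels of bias then cost a
  geometric series dominated by L (1 + ln L) / eps^2.
*)
theory Submission
  imports Defs
begin

section \<open>Combining non-adaptive algorithms\<close>

text \<open>The factor 1 + ln L has the same origin on both sides. At the lowest level of bias a
  biased coin may turn up with probability only of order 1 / L, so about L coins are tossed and all
  of them must pass when p = q; the union bound asks each for an error of order 1 / L, which costs
  an extra ln L per coin. The given algorithm is itself required to err with probability of order 1
  / L and therefore pays the same logarithm.

  Merging needs a perfect matching in every round and partners of comparable q-weight, because a
  block much lighter or heavier than its partner hardly changes its conditional probability when it
  has a deficit. Starting from a power of two of nearly equally heavy elements ensures both.
  Overlapping groups achieve this with two groups per bucket, whereas splitting a bucket along the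
  binary expansion of its size could cost a further logarithm in the number of groups.

  The case n = 1 stands apart: L may then be arbitrarily close to 0, so that 1 + ln L is no sensible
  cost.\<close>

abbreviation E :: "'a pmf \<Rightarrow> ('a \<Rightarrow> real) \<Rightarrow> real" where
  "E \<equiv> measure_pmf.expectation"

text \<open>The nonnegative integral obeys the tower rule unconditionally; boundedness and
  nonnegativity of \<open>h\<close> carry it over to real expectations.\<close>

lemma expectation_bind_pmf:
  fixes h :: "'b \<Rightarrow> real"
  assumes "\<And>y. 0 \<le> h y" "\<And>y. h y \<le> B"
  shows "E (bind_pmf M N) h = E M (\<lambda>x. E (N x) h)"
proof -
  have int: "integrable (measure_pmf P) h" for P
    using assms by (intro measure_pmf.integrable_const_bound[where B = B]) auto
  have B: "0 \<le> E (N x) h \<and> E (N x) h \<le> B" for x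
    using assms int measure_pmf.integral_le_const[of "N x" h B] by (auto intro!: integral_nonneg)
  have int': "integrable (measure_pmf M) (\<lambda>x. E (N x) h)"
    using B by (intro measure_pmf.integrable_const_bound[where B = B]) auto
  have "ennreal (E (bind_pmf M N) h) = (\<integral>\<^sup>+x. \<integral>\<^sup>+y. ennreal (h y) \<partial>N x \<partial>M)"
    using nn_integral_eq_integral[OF int, of "bind_pmf M N"] assms by simp
  also have "\<dots> = (\<integral>\<^sup>+x. ennreal (E (N x) h) \<partial>M)"
    using nn_integral_eq_integral[OF int] assms by simp
  also have "\<dots> = ennreal (E M (\<lambda>x. E (N x) h))"
    using nn_integral_eq_integral[OF int'] B by simp
  finally show ?thesis
    using assms B by (subst (asm) ennreal_inj) (auto intro!: integral_nonneg)
qed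

lemma prob_eq_expectation: "measure_pmf.prob M X = E M (indicator X)"
  by simp

lemma prob_bind_pmf:
  "measure_pmf.prob (bind_pmf M N) X = E M (\<lambda>x. measure_pmf.prob (N x) X)"
  unfolding prob_eq_expectation
  by (rule expectation_bind_pmf[where B = 1]) (auto simp: indicator_def)

lemma integrable_bounded_pmf:
  fixes h :: "'b \<Rightarrow> real"
  assumes "\<And>y. y \<in> set_pmf M \<Longrightarrow> \<bar>h y\<bar> \<le> B"
  shows "integrable (measure_pmf M) h"
  using assms by (intro measure_pmf.integrable_const_bound[where B = B]) (auto simp: AE_measure_pmf_iff)

lemma expectation_mono_pmf:
  fixes h k :: "'b \<Rightarrow> real"
  assumes "\<And>y. y \<in> set_pmf M \<Longrightarrow> h y \<le> k y"
    and "\<And>y. y \<in> set_pmf M \<Longrightarrow> \<bar>h y\<bar> \<le> B" "\<And>y. y \<in> set_pmf M \<Longrightarrow> \<bar>k y\<bar> \<le> B"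
  shows "E M h \<le> E M k"
  using assms
  by (intro integral_mono_AE integrable_bounded_pmf[of M _ B]) (auto simp: AE_measure_pmf_iff)

lemma expectation_cong_pmf:
  fixes h k :: "'b \<Rightarrow> real"
  assumes "\<And>y. y \<in> set_pmf M \<Longrightarrow> h y = k y"
  shows "E M h = E M k"
  using assms by (intro integral_cong_AE) (auto simp: AE_measure_pmf_iff)

lemma length_answers: "xs \<in> set_pmf (answers p Qs) \<Longrightarrow> length xs = length Qs"
  by (induction Qs arbitrary: xs) auto

lemma answers_append:
  "answers p (Qs @ Rs) =
     bind_pmf (answers p Qs) (\<lambda>xs. map_pmf (\<lambda>ys. xs @ ys) (answers p Rs))"
proof (induction Qs)
  case Nil
  have "(@) ([] :: nat list) = (\<lambda>ys. ys)" by auto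
  then show ?case by (simp add: bind_return_pmf)
next
  case (Cons S Qs)
  have "(@) (x # xs) = (\<lambda>ys. x # xs @ ys)" for x :: nat and xs by auto
  with Cons show ?case
    by (simp add: map_bind_pmf bind_map_pmf bind_assoc_pmf pmf.map_comp comp_def)
qed

lemma accept_prob_eq:
  "accept_prob A p = E A (\<lambda>(Qs, d). measure_pmf.prob (answers p Qs) {xs. d xs})"
  unfolding accept_prob_def run_def prob_bind_pmf
  by (intro expectation_cong_pmf) (auto simp: vimage_def)

lemma accept_prob_bounds: "0 \<le> accept_prob A p" "accept_prob A p \<le> 1"
  by (auto simp: accept_prob_def)

text \<open>All queries are fixed before any answer is seen, so the combination stays non-adaptive.
  Both the random choices and the answers of the two parts are independent, hence acceptance
  probabilities multiply.\<close>

definition and_alg :: "nacond_alg \<Rightarrow> nacond_alg \<Rightarrow> nacond_alg" where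
  "and_alg A B = bind_pmf A (\<lambda>(Qs, d). map_pmf (\<lambda>(Rs, e).
     (Qs @ Rs, \<lambda>xs. d (take (length Qs) xs) \<and> e (drop (length Qs) xs))) B)"

lemma prob_answers_append:
  "measure_pmf.prob (answers p (Qs @ Rs))
       {xs. d (take (length Qs) xs) \<and> e (drop (length Qs) xs)} =
   measure_pmf.prob (answers p Qs) {xs. d xs} * measure_pmf.prob (answers p Rs) {xs. e xs}"
proof -
  have "measure_pmf.prob (answers p (Qs @ Rs))
       {xs. d (take (length Qs) xs) \<and> e (drop (length Qs) xs)} =
     E (answers p Qs) (\<lambda>xs. indicator {xs. d xs} xs * measure_pmf.prob (answers p Rs) {xs. e xs})"
    unfolding answers_append prob_bind_pmf
    by (intro expectation_cong_pmf) (auto simp: vimage_def length_answers indicator_def)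
  then show ?thesis by simp
qed

lemma accept_prob_and_alg: "accept_prob (and_alg A B) p = accept_prob A p * accept_prob B p"
proof -
  define f where "f = (\<lambda>(Qs, d). measure_pmf.prob (answers p Qs) {xs. d xs})"
  have f: "0 \<le> f x" "f x \<le> 1" for x by (auto simp: f_def split: prod.splits)
  have "accept_prob (and_alg A B) p = E (and_alg A B) f"
    by (simp add: accept_prob_eq f_def)
  also have "\<dots> = E A (\<lambda>(Qs, d). E B (\<lambda>(Rs, e).
      f (Qs @ Rs, \<lambda>xs. d (take (length Qs) xs) \<and> e (drop (length Qs) xs))))"
    unfolding and_alg_def
    by (subst expectation_bind_pmf[where B = 1]) (auto simp: f case_prod_unfold)
  also have "\<dots> = E A (\<lambda>x. E B (\<lambda>y. f x * f y))"
    by (simp add: f_def case_prod_unfold prob_answers_append)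
  finally show ?thesis by (simp add: accept_prob_eq f_def)
qed

lemma valid_and_alg:
  "valid_alg n a A \<Longrightarrow> valid_alg n b B \<Longrightarrow> valid_alg n (a + b) (and_alg A B)"
  unfolding valid_alg_def and_alg_def by (fastforce simp: case_prod_unfold)

definition triv_alg :: nacond_alg where
  "triv_alg = return_pmf ([], \<lambda>_. True)"

lemma accept_prob_triv: "accept_prob triv_alg p = 1"
  by (simp add: triv_alg_def accept_prob_eq)

lemma valid_triv: "valid_alg n 0 triv_alg"
  by (simp add: triv_alg_def valid_alg_def)

definition pow_alg :: "nacond_alg \<Rightarrow> nat \<Rightarrow> nacond_alg" where
  "pow_alg A k = (and_alg A ^^ k) triv_alg"

lemma accept_prob_pow: "accept_prob (pow_alg A k) p = accept_prob A p ^ k"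
  by (induction k) (simp_all add: pow_alg_def accept_prob_and_alg accept_prob_triv)

lemma valid_pow: "valid_alg n m A \<Longrightarrow> valid_alg n (real k * m) (pow_alg A k)"
proof (induction k)
  case (Suc k)
  then show ?case
    using valid_and_alg[of n m A "real k * m" "pow_alg A k"]
    by (simp add: pow_alg_def algebra_simps)
qed (simp add: pow_alg_def valid_triv)

primrec seq_alg :: "(nat \<Rightarrow> nacond_alg) \<Rightarrow> nat \<Rightarrow> nacond_alg" where
  "seq_alg F 0 = triv_alg"
| "seq_alg F (Suc k) = and_alg (seq_alg F k) (F k)"

lemma accept_prob_seq: "accept_prob (seq_alg F k) p = (\<Prod>a<k. accept_prob (F a) p)"
  by (induction k) (simp_all add: accept_prob_and_alg accept_prob_triv)

lemma valid_seq:
  "(\<And>a. a < k \<Longrightarrow> valid_alg n (c a) (F a)) \<Longrightarrow> valid_alg n (\<Sum>a<k. c a) (seq_alg F k)"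
  by (induction k) (auto intro: valid_and_alg valid_triv)

lemma valid_alg_mono: "valid_alg n a A \<Longrightarrow> a \<le> b \<Longrightarrow> valid_alg n b A"
  unfolding valid_alg_def by fastforce

text \<open>A coin is a pair \<open>(U, S)\<close>; its bias is the conditional probability of
  \<open>S\<close> given \<open>U\<close>. The bias under \<open>q\<close> can be computed from the
  explicit description, so only the empirical frequency costs queries.\<close>

definition coin_alg :: "(nat set \<times> nat set) pmf \<Rightarrow> nat \<Rightarrow> real \<Rightarrow> nat pmf \<Rightarrow> nacond_alg" where
  "coin_alg M s t q = map_pmf (\<lambda>(U, S). (replicate s U, \<lambda>xs.
     \<bar>real (length (filter (\<lambda>x. x \<in> S) xs)) / real s - measure_pmf.prob (cond_sample q U) S\<bar> < t)) M"

lemma valid_coin_alg: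
  assumes "\<And>U S. (U, S) \<in> set_pmf M \<Longrightarrow> U \<noteq> {} \<and> U \<subseteq> {1..n}"
  shows "valid_alg n (real s) (coin_alg M s t q)"
  using assms unfolding valid_alg_def coin_alg_def by (fastforce simp: case_prod_unfold)

lemma hits_answers_replicate:
  "map_pmf (\<lambda>xs. length (filter (\<lambda>x. x \<in> S) xs)) (answers p (replicate s U)) =
   binomial_pmf s (measure_pmf.prob (cond_sample p U) S)"
proof (induction s)
  case 0
  show ?case by (simp add: binomial_pmf_0)
next
  case (Suc s)
  let ?r = "measure_pmf.prob (cond_sample p U) S"
  let ?len = "\<lambda>xs. length (filter (\<lambda>x. x \<in> S) xs)"
  have b: "map_pmf (\<lambda>x. x \<in> S) (cond_sample p U) = bernoulli_pmf ?r"
  proof (rule pmf_eqI)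
    fix b show "pmf (map_pmf (\<lambda>x. x \<in> S) (cond_sample p U)) b = pmf (bernoulli_pmf ?r) b"
      using measure_pmf.prob_compl[of S "cond_sample p U"]
      by (cases b) (auto simp: pmf_map vimage_def Compl_eq_Diff_UNIV[symmetric] Compl_eq)
  qed
  have "map_pmf ?len (answers p (replicate (Suc s) U)) =
    bind_pmf (cond_sample p U) (\<lambda>x. map_pmf (\<lambda>k. (if x \<in> S then 1 else 0) + k)
      (map_pmf ?len (answers p (replicate s U))))"
    by (auto simp: map_bind_pmf pmf.map_comp o_def intro!: bind_pmf_cong map_pmf_cong)
  also have "\<dots> = bind_pmf (map_pmf (\<lambda>x. x \<in> S) (cond_sample p U))
      (\<lambda>b. map_pmf (\<lambda>k. (if b then 1 else 0) + k) (binomial_pmf s ?r))"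
    by (simp add: Suc bind_map_pmf)
  also have "\<dots> = binomial_pmf (Suc s) ?r"
    unfolding b by (subst binomial_pmf_Suc) (auto simp: map_pmf_def intro!: bind_pmf_cong)
  finally show ?case .
qed

text \<open>Hoeffding's inequality for the binomially distributed number of hits.\<close>

lemma hits_answers_concentrated:
  assumes "s > 0" "t \<ge> 0"
  shows "measure_pmf.prob (answers p (replicate s U))
     {xs. t \<le> \<bar>real (length (filter (\<lambda>x. x \<in> S) xs)) / real s - measure_pmf.prob (cond_sample p U) S\<bar>}
     \<le> 2 * exp (- 2 * real s * t\<^sup>2)"
proof -
  let ?r = "measure_pmf.prob (cond_sample p U) S"
  interpret binomial_distribution s ?r by unfold_locales auto
  show ?thesis
    using prob_abs_ge'[OF assms]
    unfolding hits_answers_replicate[symmetric] by (simp add: vimage_def)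
qed

lemma accept_prob_coin_alg:
  "accept_prob (coin_alg M s t q) p = E M (\<lambda>(U, S). measure_pmf.prob (answers p (replicate s U))
     {xs. \<bar>real (length (filter (\<lambda>x. x \<in> S) xs)) / real s - measure_pmf.prob (cond_sample q U) S\<bar> < t})"
  unfolding accept_prob_eq coin_alg_def by (simp add: case_prod_unfold)

lemma coin_alg_complete:
  assumes "s > 0" "t \<ge> 0"
  shows "1 - 2 * exp (- 2 * real s * t\<^sup>2) \<le> accept_prob (coin_alg M s t q) q"
proof -
  let ?h = "\<lambda>(U, S). measure_pmf.prob (answers q (replicate s U))
     {xs. \<bar>real (length (filter (\<lambda>x. x \<in> S) xs)) / real s - measure_pmf.prob (cond_sample q U) S\<bar> < t}"
  have "1 - 2 * exp (- 2 * real s * t\<^sup>2) \<le> ?h x" for x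
  proof -
    obtain U S where x: "x = (U, S)" by force
    let ?X = "{xs. t \<le> \<bar>real (length (filter (\<lambda>x. x \<in> S) xs)) / real s - measure_pmf.prob (cond_sample q U) S\<bar>}"
    have "?h x = 1 - measure_pmf.prob (answers q (replicate s U)) ?X"
      by (subst measure_pmf.prob_compl[symmetric])
         (auto simp: x not_le intro!: arg_cong[where f = "measure _"])
    with hits_answers_concentrated[OF assms, of q U S] show ?thesis by linarith
  qed
  then have "E M (\<lambda>_. 1 - 2 * exp (- 2 * real s * t\<^sup>2)) \<le> E M ?h"
    by (intro expectation_mono_pmf[where B = "max 1 \<bar>1 - 2 * exp (- 2 * real s * t\<^sup>2)\<bar>"])
       (auto simp: case_prod_unfold intro: max.coboundedI1)
  then show ?thesis by (simp add: accept_prob_coin_alg)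
qed

definition bias_gap :: "nat pmf \<Rightarrow> nat pmf \<Rightarrow> nat set \<times> nat set \<Rightarrow> real" where
  "bias_gap p q = (\<lambda>(U, S).
     \<bar>measure_pmf.prob (cond_sample p U) S - measure_pmf.prob (cond_sample q U) S\<bar>)"

lemma bias_gap_bounds: "0 \<le> bias_gap p q x" "bias_gap p q x \<le> 1"
proof -
  obtain U S where x: "x = (U, S)" by force
  have "0 \<le> measure_pmf.prob P S" "measure_pmf.prob P S \<le> 1" for P by simp_all
  from this[of "cond_sample p U"] this[of "cond_sample q U"] show "0 \<le> bias_gap p q x" "bias_gap p q x \<le> 1"
    unfolding bias_gap_def x prod.case by linarith+
qed

text \<open>The gap is twice the acceptance threshold: to be accepted, the empirical frequency has
  to be at least \<open>t\<close> away from its own mean, which happens with probability at most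
  1/2. So each coin with a large gap is rejected at least half of the time.\<close>

lemma coin_alg_sound:
  assumes "s > 0" "t \<ge> 0" and s: "2 * exp (- 2 * real s * t\<^sup>2) \<le> 1/2"
  shows "accept_prob (coin_alg M s t q) p \<le> 1 - measure_pmf.prob M {x. 2 * t \<le> bias_gap p q x} / 2"
proof -
  let ?h = "\<lambda>(U, S). measure_pmf.prob (answers p (replicate s U))
     {xs. \<bar>real (length (filter (\<lambda>x. x \<in> S) xs)) / real s - measure_pmf.prob (cond_sample q U) S\<bar> < t}"
  let ?B = "{x. 2 * t \<le> bias_gap p q x}"
  have "?h x \<le> 1 - indicator ?B x / 2" for x
  proof (cases "x \<in> ?B")
    case True
    obtain U S where x: "x = (U, S)" by force
    let ?X = "{xs. t \<le> \<bar>real (length (filter (\<lambda>x. x \<in> S) xs)) / real s - measure_pmf.prob (cond_sample p U) S\<bar>}"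
    have "?h x \<le> measure_pmf.prob (answers p (replicate s U)) ?X"
      using True by (auto simp: x bias_gap_def intro!: measure_pmf.finite_measure_mono)
    also have "\<dots> \<le> 1/2" using hits_answers_concentrated[OF assms(1,2), of p U S] s by linarith
    finally show ?thesis using True by simp
  qed (auto simp: case_prod_unfold)
  then have "E M ?h \<le> E M (\<lambda>x. 1 - indicator ?B x / 2)"
    by (intro expectation_mono_pmf[where B = 1]) (auto simp: case_prod_unfold indicator_def)
  also have "\<dots> = 1 - measure_pmf.prob M ?B / 2"
    by (subst Bochner_Integration.integral_diff) (auto simp: integrable_bounded_pmf[of M _ 1])
  finally show ?thesis by (simp add: accept_prob_coin_alg)
qed

section \<open>Testing coins with a large truncated mean bias\<close>

lemma prod_one_minus_ge:
  fixes b :: "nat \<Rightarrow> real"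
  assumes "\<And>a. a < k \<Longrightarrow> 0 \<le> b a \<and> b a \<le> 1"
  shows "1 - (\<Sum>a<k. b a) \<le> (\<Prod>a<k. 1 - b a)"
  using assms
proof (induction k)
  case (Suc k)
  have "(\<Prod>a<k. 1 - b a) \<le> 1" using Suc.prems by (intro prod_le_1) auto
  moreover have "b k * (\<Prod>a<k. 1 - b a) \<le> b k * 1"
    using calculation Suc.prems[of k] by (intro mult_left_mono) auto
  ultimately show ?case using Suc using less_SucI by (auto simp: algebra_simps)
qed simp

lemma one_minus_power_ge:
  fixes x :: real
  assumes "0 \<le> x" "x \<le> 1"
  shows "1 - real k * x \<le> (1 - x) ^ k"
  using Bernoulli_inequality[of "-x" k] assms by simp

lemma exp_two_ge: "4 \<le> exp (2::real)"
proof -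
  have "(2::real) ^ 2 \<le> exp 1 ^ 2" by (rule power_mono) (use exp_ge_add_one_self[of 1] in auto)
  then show ?thesis by (simp flip: exp_of_nat_mult)
qed

lemma sum_half_powers: "(\<Sum>a<k. (1/2::real) ^ a) = 2 - 2 / 2 ^ k"
  by (induction k) (auto simp: field_simps)

lemma sum_linear_half_powers: "(\<Sum>a<k. real a * (1/2) ^ a) = 2 - 2 * (real k + 1) / 2 ^ k"
proof (induction k)
  case (Suc k)
  have "(1/2::real) ^ k = 1 / 2 ^ k" by (simp add: power_divide)
  with Suc show ?case by (simp add: add_divide_distrib diff_divide_distrib)
qed simp

lemma level_of_gap:
  fixes t x :: real
  assumes "t \<le> x" "x < 4 ^ k * t"
  shows "\<exists>a<k. 4 ^ a * t \<le> x \<and> x < 4 ^ Suc a * t"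
  using assms(2)
proof (induction k)
  case (Suc k)
  then show ?case by (cases "x < 4 ^ k * t") (auto simp: less_Suc_eq)
qed (use assms in simp)

text \<open>A large truncated mean of the gap forces, on some scale \<open>4 ^ a * t\<close>, a probability
  of order \<open>8 ^ -a\<close>. Testing that scale takes \<open>8 ^ a\<close> coins tossed \<open>16 ^ -a\<close> times each, so the
  costs of the scales form a geometric series.\<close>

lemma gap_level_exists:
  fixes T :: "'a \<Rightarrow> real"
  assumes t: "0 < t" and T: "\<And>x. 0 \<le> T x \<and> T x \<le> 1" and k: "1 < 4 ^ k * t"
    and r: "0 < r" and mean: "8 * t * r \<le> E M (\<lambda>x. if t \<le> T x then T x else 0)"
  shows "\<exists>a<k. r / 8 ^ a \<le> measure_pmf.prob M {x. 4 ^ a * t \<le> T x}"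
proof (rule ccontr)
  assume neg: "\<not> ?thesis"
  let ?P = "\<lambda>a. {x. 4 ^ a * t \<le> T x}"
  \<comment> \<open>A dyadic majorant: if \<open>T x\<close> lies between \<open>4 ^ a * t\<close>
    and \<open>4 ^ Suc a * t\<close>, the summand for \<open>a\<close> alone exceeds
    \<open>T x\<close>.\<close>
  let ?g = "\<lambda>x. \<Sum>a<k. 4 * 4 ^ a * t * indicator (?P a) x"
  have g0: "0 \<le> ?g x" and gB: "?g x \<le> (\<Sum>a<k. 4 * 4 ^ a * t)" for x
    using t by (auto intro!: sum_nonneg sum_mono mult_right_le_one_le indicator_le_1
      simp del: sum_mult_indicator sum_indicator_mult)
  have "(if t \<le> T x then T x else 0) \<le> ?g x" for x
  proof (cases "t \<le> T x")
    case True
    have "T x < 4 ^ k * t" using T[of x] k by linarith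
    then obtain a where a: "a < k" "4 ^ a * t \<le> T x" "T x < 4 ^ Suc a * t"
      using level_of_gap[OF True] by blast
    have "4 * 4 ^ a * t * indicator (?P a) x \<le> ?g x"
      by (rule member_le_sum) (use a t in \<open>auto simp: indicator_def\<close>)
    then show ?thesis using a True by simp
  qed (use g0 in auto)
  then have "E M (\<lambda>x. if t \<le> T x then T x else 0) \<le> E M ?g"
    by (intro expectation_mono_pmf[where B = "max 1 (\<Sum>a<k. 4 * 4 ^ a * t)"])
       (use T g0 gB in \<open>auto simp: abs_of_nonneg intro: max.coboundedI1 max.coboundedI2\<close>)
  also have "E M ?g = (\<Sum>a<k. 4 * 4 ^ a * t * measure_pmf.prob M (?P a))"
    by (subst Bochner_Integration.integral_sum)
       (auto intro!: integrable_mult_right integrable_bounded_pmf[of M _ 1] simp: indicator_le_1)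
  also have "\<dots> \<le> (\<Sum>a<k. 4 * 4 ^ a * t * (r / 8 ^ a))"
    using neg t by (intro sum_mono mult_left_mono) (auto simp: not_le less_imp_le)
  also have "\<dots> = (\<Sum>a<k. 4 * t * r * (1/2) ^ a)"
  proof (rule sum.cong)
    fix a :: nat
    have "(8::real) ^ a = 4 ^ a * 2 ^ a" by (simp flip: power_mult_distrib)
    then show "4 * 4 ^ a * t * (r / 8 ^ a) = 4 * t * r * (1/2) ^ a"
      by (simp add: power_divide)
  qed simp
  also have "\<dots> = 4 * t * r * (2 - 2 / 2 ^ k)" by (simp flip: sum_distrib_left add: sum_half_powers)
  \<comment> \<open>The partial geometric sum stays strictly below 2; this is the origin of the 8 in
    the assumed mean.\<close>
  also have "\<dots> < 8 * t * r" using t r by (simp add: field_simps)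
  finally show False using mean by simp
qed

text \<open>Every coin of every scale has to pass. The coins of the scale found by
  \<open>gap_level_exists\<close> have an expected number of at least 4 large gaps, so that scale
  alone accepts with probability at most exp (-2). The cost is bounded by two series, of
  \<open>(1/2) ^ a\<close> and of \<open>a * (1/2) ^ a\<close>, both at most 2.\<close>

lemma multilevel_tester:
  fixes t r :: real
  assumes t: "0 < t" "t \<le> 1" and r: "0 < r" "r \<le> 1"
    and M: "\<And>U S. (U, S) \<in> set_pmf M \<Longrightarrow> U \<noteq> {} \<and> U \<subseteq> {1..n}"
  shows "\<exists>A. valid_alg n (480 * (1 + ln (1 / r)) / (r * t\<^sup>2)) A \<and> 11/12 \<le> accept_prob A q \<and>
    (\<forall>p. 8 * t * r \<le> E M (\<lambda>x. if t \<le> bias_gap p q x then bias_gap p q x else 0) \<longrightarrow>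
      accept_prob A p \<le> 1/4)"
proof -
  \<comment> \<open>Gaps never exceed 1, so no scale from \<open>k\<close> on can occur. Minimality
    keeps all tested thresholds at most 1, so \<open>y a\<close> is at least 1 and rounding up at
    most doubles it.\<close>
  define k where "k = (LEAST k. 1 < 4 ^ k * t)"
  have "\<exists>k. 1 < 4 ^ k * t"
    using real_arch_pow[of 4 "1 / t"] t by (auto simp: field_simps)
  then have k: "1 < 4 ^ k * t" unfolding k_def by (rule LeastI_ex)
  have k': "4 ^ a * t \<le> 1" if "a < k" for a
    using not_less_Least[of a "\<lambda>k. 1 < 4 ^ k * t"] that unfolding k_def by (simp add: not_less)
  define N where "N a = nat \<lceil>4 * 8 ^ a / r\<rceil>" for a :: nat
  \<comment> \<open>Here 240 = 2 * 24 * 5: the factor 2 of Hoeffding's bound, an error budget of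
    \<open>(1/2) ^ a / 24\<close> for scale \<open>a\<close>, and at most
    \<open>5 * 8 ^ a / r\<close> coins there. The term \<open>4 * real a\<close> gains
    \<open>16 ^ a\<close>, namely \<open>8 ^ a\<close> for the number of coins and
    \<open>2 ^ a\<close> for the shrinking budget. All budgets together come to at most
    1/12.\<close>
  define y where "y a = 2 * (ln (240 / r) + 4 * real a) / (16 ^ a * t\<^sup>2)" for a :: nat
  define s where "s a = nat \<lceil>y a\<rceil>" for a
  define F where "F a = coin_alg M (s a) (4 ^ a * t / 2) q" for a
  define A where "A = seq_alg (\<lambda>a. pow_alg (F a) (N a)) k"
  have N_ge: "4 * 8 ^ a / r \<le> real (N a)" for a
    unfolding N_def by linarith
  have one_le: "1 \<le> 8 ^ a / r" for a
  proof -
    have "r \<le> 8 ^ a" using r one_le_power[of "8::real" a] by linarith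
    then show ?thesis using r by simp
  qed
  have N_le: "real (N a) \<le> 5 * (8 ^ a / r)" for a
    using one_le[of a] unfolding N_def by simp linarith
  have ln1: "1 \<le> ln (240 / r)"
  proof -
    have "exp (1::real) \<le> 240" using exp_le by simp
    also have "\<dots> \<le> 240 / r" using r by (simp add: field_simps)
    finally show ?thesis using r by (simp add: ln_ge_iff)
  qed
  have y1: "1 \<le> y a" and s0: "0 < s a" and s_le: "real (s a) \<le> 2 * y a" and s_ge: "y a \<le> real (s a)"
    if "a < k" for a
  proof -
    have "(4 ^ a * t)\<^sup>2 \<le> 1" using k'[OF that] t by (simp add: power_le_one)
    moreover have "(4 ^ a * t)\<^sup>2 = 16 ^ a * t\<^sup>2"
      using power_mult[of "4::real" 2 a] by (simp add: power_mult_distrib mult.commute flip: power_mult)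
    ultimately have le: "16 ^ a * t\<^sup>2 \<le> 1" by simp
    have "1 + 0 \<le> ln (240 / r) + 4 * real a" using ln1 by (intro add_mono) auto
    then have "1 \<le> 2 * (ln (240 / r) + 4 * real a)" by argo
    with le have "16 ^ a * t\<^sup>2 \<le> 2 * (ln (240 / r) + 4 * real a)" by (rule order_trans)
    then show "1 \<le> y a" using t by (simp add: y_def)
    then show "0 < s a" "real (s a) \<le> 2 * y a" "y a \<le> real (s a)" unfolding s_def by linarith+
  qed
  have err: "2 * exp (- 2 * real (s a) * (4 ^ a * t / 2)\<^sup>2) \<le> (1/2) ^ a / (24 * real (N a))"
    if "a < k" for a
  proof -
    have sq: "(4 ^ a * t / 2)\<^sup>2 = 16 ^ a * t\<^sup>2 / 4"
      using power_mult[of "4::real" 2 a]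
      by (simp add: power_divide power_mult_distrib mult.commute flip: power_mult)
    have "ln (240 / r) + 4 * real a = y a * (16 ^ a * t\<^sup>2) / 2" using t by (simp add: y_def)
    also have "\<dots> \<le> real (s a) * (16 ^ a * t\<^sup>2) / 2"
      using s_ge[OF that] by (intro divide_right_mono mult_right_mono) auto
    also have "\<dots> = 2 * real (s a) * (4 ^ a * t / 2)\<^sup>2" by (simp add: sq)
    finally have "exp (- 2 * real (s a) * (4 ^ a * t / 2)\<^sup>2) \<le> exp (- (ln (240 / r) + 4 * real a))"
      by simp
    also have "\<dots> = r / 240 * exp (- (4 * real a))"
    proof -
      have "exp (- (ln (240 / r) + 4 * real a)) = exp (- ln (240 / r)) * exp (- (4 * real a))"
        by (simp flip: exp_add)
      then show ?thesis using r by (simp only: exp_minus exp_ln divide_pos_pos) simp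
    qed
    also have "exp (- (4 * real a)) \<le> (1/16) ^ a"
    proof -
      have "(4::real)\<^sup>2 \<le> exp 2 ^ 2" by (rule power_mono[OF exp_two_ge]) simp
      then have "16 \<le> exp (4::real)" by (simp flip: exp_of_nat_mult)
      then have "exp (- 4 :: real) \<le> 1/16" by (simp add: exp_minus field_simps)
      then have "exp (- 4 :: real) ^ a \<le> (1/16) ^ a" by (intro power_mono) auto
      then show ?thesis by (simp add: mult.commute flip: exp_of_nat_mult)
    qed
    finally have "2 * exp (- 2 * real (s a) * (4 ^ a * t / 2)\<^sup>2) \<le> r / 120 * (1/16) ^ a"
      using r by (simp add: mult_left_mono)
    also have "\<dots> = (1/2) ^ a / (24 * (5 * (8 ^ a / r)))"
    proof -
      have "(16::real) ^ a = 8 ^ a * 2 ^ a" by (simp flip: power_mult_distrib)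
      then show ?thesis by (simp add: power_divide)
    qed
    also have "\<dots> \<le> (1/2) ^ a / (24 * real (N a))"
    proof -
      have "0 < 4 * 8 ^ a / r" using r by simp
      then have "0 < real (N a)" using N_ge[of a] by linarith
      then show ?thesis using N_le[of a] r by (intro divide_left_mono) (auto intro!: divide_pos_pos)
    qed
    finally show ?thesis .
  qed
  have N1: "1 \<le> real (N a)" for a using N_ge[of a] one_le[of a] by linarith
  have "valid_alg n (\<Sum>a<k. real (N a) * real (s a)) A"
    unfolding A_def F_def using M by (intro valid_seq valid_pow valid_coin_alg)
  moreover have "(\<Sum>a<k. real (N a) * real (s a)) \<le> 480 * (1 + ln (1 / r)) / (r * t\<^sup>2)"
  proof -
    have "(\<Sum>a<k. real (N a) * real (s a)) \<le>
        (\<Sum>a<k. 20 / (r * t\<^sup>2) * (ln (240 / r) * (1/2) ^ a + 4 * (real a * (1/2) ^ a)))"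
    proof (rule sum_mono)
      fix a assume "a \<in> {..<k}"
      then have a: "a < k" by simp
      have "real (N a) * real (s a) \<le> 5 * (8 ^ a / r) * (2 * y a)"
        using N_le[of a] s_le[OF a] N1[of a] by (intro mult_mono) auto
      also have "\<dots> = 20 / (r * t\<^sup>2) * (ln (240 / r) * (1/2) ^ a + 4 * (real a * (1/2) ^ a))"
      proof -
        have "(16::real) ^ a = 8 ^ a * 2 ^ a" by (simp flip: power_mult_distrib)
        then show ?thesis using t r by (simp add: y_def power_divide field_simps)
      qed
      finally show "real (N a) * real (s a) \<le>
          20 / (r * t\<^sup>2) * (ln (240 / r) * (1/2) ^ a + 4 * (real a * (1/2) ^ a))" .
    qed
    also have "\<dots> = 20 / (r * t\<^sup>2) *
        (ln (240 / r) * (\<Sum>a<k. (1/2) ^ a) + 4 * (\<Sum>a<k. real a * (1/2) ^ a))"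
      by (simp only: sum_distrib_left sum.distrib distrib_left)
    also have "\<dots> \<le> 20 / (r * t\<^sup>2) * (ln (240 / r) * 2 + 4 * 2)"
      using r t ln1
      by (intro mult_left_mono add_mono) (auto simp: sum_half_powers sum_linear_half_powers)
    also have "\<dots> \<le> 20 / (r * t\<^sup>2) * (24 * (1 + ln (1 / r)))"
    proof -
      have "(240::real) \<le> exp 2 ^ 4"
        using power_mono[OF exp_two_ge, of 4] by simp
      then have "(240::real) \<le> exp 8" by (simp flip: exp_of_nat_mult)
      then have "ln (240::real) \<le> 8" using ln_mono[of 240 "exp 8 :: real"] by simp
      moreover have "ln (240 / r) = ln 240 + ln (1 / r)" using r by (simp add: ln_div)
      moreover have "0 \<le> ln (1 / r)" using r by simp
      ultimately have "ln (240 / r) * 2 + 4 * 2 \<le> 24 * (1 + ln (1 / r))" by argo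
      then show ?thesis using r t by (intro mult_left_mono) auto
    qed
    finally show ?thesis by simp
  qed
  ultimately have "valid_alg n (480 * (1 + ln (1 / r)) / (r * t\<^sup>2)) A"
    by (rule valid_alg_mono)
  moreover have "11/12 \<le> accept_prob A q"
  proof -
    have "(\<Sum>a<k. (1/2) ^ a / 24 :: real) \<le> 1/12"
      by (simp add: sum_half_powers flip: sum_divide_distrib)
    then have "11/12 \<le> 1 - (\<Sum>a<k. (1/2) ^ a / 24 :: real)" by simp
    also have "\<dots> \<le> (\<Prod>a<k. 1 - (1/2) ^ a / 24)"
      by (rule prod_one_minus_ge) (auto simp: power_le_one intro: order_trans[of _ 1])
    also have "\<dots> \<le> (\<Prod>a<k. accept_prob (pow_alg (F a) (N a)) q)"
    proof (rule prod_mono, safe)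
      fix a :: nat assume "a < k"
      have pos: "0 \<le> 1 - (1/2::real) ^ a / 24" by (simp add: power_le_one order_trans[of _ 1])
      then show "0 \<le> 1 - (1/2::real) ^ a / 24" .
      let ?e = "(1/2::real) ^ a / (24 * real (N a))"
      have "(1/2::real) ^ a \<le> 1" by (simp add: power_le_one)
      then have "(1/2::real) ^ a \<le> 24 * real (N a)" using N1[of a] by linarith
      then have e: "0 \<le> ?e" "?e \<le> 1" using N1[of a] by (simp_all only: divide_le_eq_1) simp_all
      have "1 - (1/2::real) ^ a / 24 = 1 - real (N a) * ?e" using N1[of a] by simp
      also have "\<dots> \<le> (1 - ?e) ^ N a" by (rule one_minus_power_ge[OF e])
      also have "\<dots> \<le> accept_prob (F a) q ^ N a"
      proof (rule power_mono)
        show "1 - ?e \<le> accept_prob (F a) q"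
          using coin_alg_complete[of "s a" "4 ^ a * t / 2" M q] err[OF \<open>a < k\<close>] s0[OF \<open>a < k\<close>] t
          by (auto simp: F_def)
      qed (use e in auto)
      finally show "1 - (1/2::real) ^ a / 24 \<le> accept_prob (pow_alg (F a) (N a)) q"
        by (simp add: accept_prob_pow)
    qed
    finally show ?thesis by (simp add: A_def accept_prob_seq)
  qed
  moreover have "accept_prob A p \<le> 1/4"
    if mean: "8 * t * r \<le> E M (\<lambda>x. if t \<le> bias_gap p q x then bias_gap p q x else 0)" for p
  proof -
    obtain a where a: "a < k" and P: "r / 8 ^ a \<le> measure_pmf.prob M {x. 4 ^ a * t \<le> bias_gap p q x}"
      using gap_level_exists[OF t(1) _ k r(1) mean] bias_gap_bounds by blast
    let ?P = "measure_pmf.prob M {x. 4 ^ a * t \<le> bias_gap p q x}"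
    have "2 * exp (- 2 * real (s a) * (4 ^ a * t / 2)\<^sup>2) \<le> 1/2"
    proof -
      have "(1/2::real) ^ a \<le> 1" by (simp add: power_le_one)
      then have "(1/2::real) ^ a / (24 * real (N a)) \<le> 1/2"
        using N1[of a] by (simp only: divide_le_eq) simp
      then show ?thesis using err[OF a] by linarith
    qed
    then have "accept_prob (F a) p \<le> 1 - ?P / 2"
      using coin_alg_sound[of "s a" "4 ^ a * t / 2" M q p] s0[OF a] t by (simp add: F_def)
    also have "\<dots> \<le> exp (- (?P / 2))" using exp_ge_add_one_self[of "- (?P / 2)"] by simp
    finally have "accept_prob (F a) p ^ N a \<le> exp (- (?P / 2)) ^ N a"
      by (intro power_mono accept_prob_bounds)
    also have "\<dots> = exp (- (real (N a) * ?P / 2))" by (simp flip: exp_of_nat_mult)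
    also have "\<dots> \<le> exp (-2)"
    proof -
      have "4 * 8 ^ a / r * (r / 8 ^ a) \<le> real (N a) * ?P"
        using N_ge[of a] P r by (intro mult_mono) auto
      then show ?thesis using r by simp
    qed
    also have "\<dots> \<le> 1/4" using exp_two_ge by (simp add: exp_minus field_simps)
    finally have F4: "accept_prob (pow_alg (F a) (N a)) p \<le> 1/4" by (simp add: accept_prob_pow)
    have "accept_prob A p = accept_prob (pow_alg (F a) (N a)) p *
        (\<Prod>b\<in>{..<k} - {a}. accept_prob (pow_alg (F b) (N b)) p)"
      unfolding A_def accept_prob_seq by (rule prod.remove) (use a in auto)
    also have "\<dots> \<le> accept_prob (pow_alg (F a) (N a)) p * 1"
      by (intro mult_left_mono prod_le_1) (auto simp: accept_prob_bounds)
    finally show ?thesis using F4 by simp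
  qed
  ultimately show ?thesis by blast
qed

section \<open>Random unions of classes\<close>

text \<open>A Rademacher sum with coefficients \<open>e\<close>, the subset \<open>J\<close>
  recording which signs are positive.\<close>

definition signed_sum :: "('b \<Rightarrow> real) \<Rightarrow> 'b set \<Rightarrow> 'b set \<Rightarrow> real" where
  "signed_sum e I J = (\<Sum>c\<in>I. if c \<in> J then e c else - e c)"

lemma sum_Pow_insert:
  fixes h :: "'b set \<Rightarrow> real"
  assumes "finite F" "x \<notin> F"
  shows "(\<Sum>J\<in>Pow (insert x F). h J) = (\<Sum>J\<in>Pow F. h J + h (insert x J))"
proof -
  have "inj_on (insert x) (Pow F)" using assms(2) by (auto simp: inj_on_def)
  moreover have "Pow F \<inter> insert x ` Pow F = {}" using assms(2) by auto
  ultimately show ?thesis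
    using assms(1) by (simp add: Pow_insert sum.union_disjoint sum.reindex sum.distrib)
qed

lemma signed_sum_insert:
  assumes "finite F" "x \<notin> F" "J \<subseteq> F"
  shows "signed_sum e (insert x F) J = signed_sum e F J - e x"
    and "signed_sum e (insert x F) (insert x J) = signed_sum e F J + e x"
proof -
  show "signed_sum e (insert x F) J = signed_sum e F J - e x"
    using assms by (auto simp: signed_sum_def)
  have "(\<Sum>c\<in>F. if c \<in> insert x J then e c else - e c) = (\<Sum>c\<in>F. if c \<in> J then e c else - e c)"
    using assms by (intro sum.cong) auto
  then show "signed_sum e (insert x F) (insert x J) = signed_sum e F J + e x"
    using assms by (simp add: signed_sum_def)
qed

lemma sum_signed_sum_power2:
  assumes "finite I"
  shows "(\<Sum>J\<in>Pow I. signed_sum e I J ^ 2) = 2 ^ card I * (\<Sum>c\<in>I. e c ^ 2)"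
  using assms
proof (induction I)
  case (insert x F)
  have "(\<Sum>J\<in>Pow (insert x F). signed_sum e (insert x F) J ^ 2) =
      (\<Sum>J\<in>Pow F. 2 * signed_sum e F J ^ 2 + 2 * e x ^ 2)"
    unfolding sum_Pow_insert[OF insert.hyps]
    using insert.hyps
    by (intro sum.cong) (auto simp: signed_sum_insert power2_eq_square algebra_simps)
  then show ?case
    using insert by (simp add: sum.distrib card_Pow algebra_simps flip: sum_distrib_left)
qed (simp add: signed_sum_def)

text \<open>Khinchine's inequality for the fourth moment. In the fourth powers of R + x and R - x
  the odd terms cancel and leave 2 R^4 + 12 x^2 R^2 + 2 x^4; raising the last coefficient to 6
  completes the square of V + x^2.\<close>

lemma sum_signed_sum_power4:
  assumes "finite I"
  shows "(\<Sum>J\<in>Pow I. signed_sum e I J ^ 4) \<le> 3 * 2 ^ card I * (\<Sum>c\<in>I. e c ^ 2) ^ 2"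
  using assms
proof (induction I)
  case (insert x F)
  let ?V = "\<Sum>c\<in>F. e c ^ 2" and ?N = "2 ^ card F :: real"
  have "(\<Sum>J\<in>Pow (insert x F). signed_sum e (insert x F) J ^ 4) =
      (\<Sum>J\<in>Pow F. 2 * signed_sum e F J ^ 4 + 12 * e x ^ 2 * signed_sum e F J ^ 2 + 2 * e x ^ 4)"
    unfolding sum_Pow_insert[OF insert.hyps]
    using insert.hyps
    by (intro sum.cong) (auto simp: signed_sum_insert power4_eq_xxxx power2_eq_square algebra_simps)
  also have "\<dots> = 2 * (\<Sum>J\<in>Pow F. signed_sum e F J ^ 4) + 12 * e x ^ 2 * (?N * ?V) + 2 * ?N * e x ^ 4"
    using insert.hyps
    by (simp add: sum.distrib card_Pow sum_signed_sum_power2 flip: sum_distrib_left)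
  also have "\<dots> \<le> 2 * (3 * ?N * ?V ^ 2) + 12 * e x ^ 2 * (?N * ?V) + 6 * ?N * e x ^ 4"
    using insert by (intro add_mono mult_left_mono) auto
  also have "\<dots> = 3 * 2 ^ card (insert x F) * (\<Sum>c\<in>insert x F. e c ^ 2) ^ 2"
    using insert.hyps by (simp add: power4_eq_xxxx power2_eq_square algebra_simps)
  finally show ?case .
qed (simp add: signed_sum_def)

text \<open>The Paley-Zygmund argument, with \<open>R\<^sup>2 \<le> R ^ 4 / (8 V) + 2 V\<close> in place of Cauchy-Schwarz.\<close>

lemma signed_sum_anticoncentration:
  assumes "finite I"
  shows "3 / 16 * 2 ^ card I \<le> real (card {J \<in> Pow I. (\<Sum>c\<in>I. e c ^ 2) / 4 \<le> signed_sum e I J ^ 2})"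
proof -
  let ?V = "\<Sum>c\<in>I. e c ^ 2" and ?N = "2 ^ card I :: real"
  let ?G = "{J \<in> Pow I. ?V / 4 \<le> signed_sum e I J ^ 2}"
  have fin: "finite (Pow I)" using assms by simp
  have V0: "0 \<le> ?V" by (intro sum_nonneg) auto
  show ?thesis
  proof (cases "?V = 0")
    case True
    then have "?G = Pow I" by auto
    then show ?thesis using assms by (simp add: card_Pow)
  next
    case False
    then have V: "0 < ?V" using V0 by linarith
    have pt: "signed_sum e I J ^ 2 \<le> ?V / 4 + signed_sum e I J ^ 4 / (8 * ?V) + 2 * ?V * indicator ?G J"
      if "J \<in> Pow I" for J
    proof (cases "J \<in> ?G")
      case True
      let ?x = "signed_sum e I J ^ 2"
      have "0 \<le> (?x - 4 * ?V)\<^sup>2 / (8 * ?V)" using V by simp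
      also have "\<dots> = signed_sum e I J ^ 4 / (8 * ?V) - ?x + 2 * ?V"
        using V by (simp add: field_simps power2_eq_square power4_eq_xxxx)
      finally show ?thesis using True V by simp
    next
      case False
      have "0 \<le> signed_sum e I J ^ 4 / (8 * ?V)" using V by simp
      moreover have "signed_sum e I J ^ 2 \<le> ?V / 4" using False that by auto
      ultimately show ?thesis using False by simp
    qed
    have "?N * ?V \<le> (\<Sum>J\<in>Pow I. ?V / 4 + signed_sum e I J ^ 4 / (8 * ?V) + 2 * ?V * indicator ?G J)"
      unfolding sum_signed_sum_power2[OF assms, of e, symmetric] by (rule sum_mono) (rule pt)
    also have "\<dots> = ?N * ?V / 4 + (\<Sum>J\<in>Pow I. signed_sum e I J ^ 4) / (8 * ?V) + 2 * ?V * real (card ?G)"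
    proof -
      have "(\<Sum>J\<in>Pow I. indicator ?G J) = (\<Sum>J\<in>Pow I. if J \<in> ?G then 1 else 0 :: real)"
        by (intro sum.cong) (auto simp: indicator_def)
      also have "\<dots> = real (card (Pow I \<inter> ?G))"
        unfolding sum.If_cases[OF fin] Collect_mem_eq by simp
      also have "Pow I \<inter> ?G = ?G" by blast
      finally have "(\<Sum>J\<in>Pow I. indicator ?G J) = real (card ?G)" .
      then show ?thesis
        unfolding sum.distrib sum_distrib_left[symmetric] sum_constant
        using assms by (simp add: card_Pow flip: sum_divide_distrib)
    qed
    also have "\<dots> \<le> ?N * ?V / 4 + (3 * ?N * ?V ^ 2) / (8 * ?V) + 2 * ?V * real (card ?G)"
      using V by (intro add_mono divide_right_mono sum_signed_sum_power4[OF assms]) auto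
    \<comment> \<open>Of the mean \<open>?V\<close> of the squares, the fractions 1/4 and 3/8 are
      accounted for. The remaining 3/8, divided by the weight 2 of the indicator, is the proportion
      3/16.\<close>
    also have "(3 * ?N * ?V ^ 2) / (8 * ?V) = 3 / 8 * ?N * ?V"
      using V by (simp add: power2_eq_square)
    finally have "?V * (3 / 16 * ?N) \<le> ?V * real (card ?G)" by (simp add: field_simps)
    then show ?thesis using V by (simp only: mult_le_cancel_left_pos)
  qed
qed

lemma cond_sample_full:
  assumes "is_dist n p"
  shows "cond_sample p {1..n} = p"
proof -
  have "AE x in measure_pmf p. x \<in> {1..n}" using assms by (auto simp: is_dist_def AE_measure_pmf_iff)
  then have 1: "measure_pmf.prob p {1..n} = 1" by (subst measure_pmf.prob_eq_1) auto
  then have "set_pmf p \<inter> {1..n} \<noteq> {}"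
    using assms set_pmf_not_empty[of p] by (auto simp: is_dist_def)
  then have "cond_pmf p {1..n} = p"
    using assms 1 by (intro pmf_eqI) (auto simp: pmf_cond is_dist_def set_pmf_iff subset_iff)
  then show ?thesis using 1 by (simp add: cond_sample_def)
qed

text \<open>By Cauchy-Schwarz the squared differences of the class masses sum to at least
  \<open>\<eta>\<^sup>2 / k\<close>. Anticoncentration then gives a random union of classes a
  discrepancy of at least \<open>\<eta> / (4 * sqrt k)\<close>, which is \<open>2 * t\<close>, with
  probability at least 3/16.\<close>

lemma label_tester:
  fixes lbl :: "nat \<Rightarrow> 'b"
  assumes n: "n \<ge> 1" and q: "is_dist n q"
    and I: "finite I" "lbl ` {1..n} \<subseteq> I" "real (card I) \<le> k" and k: "0 < k" and eta: "0 < \<eta>" "\<eta> \<le> 1" "1 \<le> k"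
  shows "\<exists>A. valid_alg n (14080 * k / \<eta>\<^sup>2) A \<and> 11/12 \<le> accept_prob A q \<and>
    (\<forall>p. is_dist n p \<and>
       \<eta> \<le> (\<Sum>c\<in>I. \<bar>measure_pmf.prob p {i \<in> {1..n}. lbl i = c} - measure_pmf.prob q {i \<in> {1..n}. lbl i = c}\<bar>) \<longrightarrow>
       accept_prob A p \<le> 1/4)"
proof -
  define M where "M = map_pmf (\<lambda>J. ({1..n}, {i \<in> {1..n}. lbl i \<in> J})) (pmf_of_set (Pow I))"
  define t where "t = \<eta> / (8 * sqrt k)"
  define s where "s = nat \<lceil>5 / t\<^sup>2\<rceil>"
  define F where "F = coin_alg M s t q"
  have t: "0 < t" using eta k by (simp add: t_def)
  have tt: "5 / t\<^sup>2 = 320 * k / \<eta>\<^sup>2" using eta k by (simp add: t_def power_divide power_mult_distrib)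
  have "\<eta>\<^sup>2 \<le> 1" using eta by (simp add: power_le_one)
  then have "1 \<le> 5 / t\<^sup>2" unfolding tt using eta by (simp add: field_simps)
  then have s: "0 < s" "real s \<le> 640 * k / \<eta>\<^sup>2" "5 / t\<^sup>2 \<le> real s"
    using tt unfolding s_def by linarith+
  have "5 \<le> real s * t\<^sup>2" using s(3) t by (simp add: field_simps)
  then have "exp (- 2 * real s * t\<^sup>2) \<le> exp (- 10)" by simp
  also have "exp (-10 :: real) \<le> 1 / 1024"
  proof -
    have "(4::real) ^ 5 \<le> exp 2 ^ 5" by (rule power_mono[OF exp_two_ge]) simp
    then have "1024 \<le> exp (10::real)" by (simp flip: exp_of_nat_mult)
    then show ?thesis by (simp add: exp_minus field_simps)
  qed
  finally have err: "2 * exp (- 2 * real s * t\<^sup>2) \<le> 1 / 512" by simp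
  \<comment> \<open>With 22 repetitions the exponent 22 * 3/32 exceeds 2, which makes acceptance at
    most exp (-2) for a far distribution, while on \<open>q\<close> at most 22/512 is lost, less
    than 1/12.\<close>
  have "valid_alg n (real 22 * real s) (pow_alg F 22)"
    unfolding F_def by (intro valid_pow valid_coin_alg) (use n in \<open>auto simp: M_def\<close>)
  moreover have "real 22 * real s \<le> 14080 * k / \<eta>\<^sup>2" using s by simp
  ultimately have "valid_alg n (14080 * k / \<eta>\<^sup>2) (pow_alg F 22)" by (rule valid_alg_mono)
  moreover have "11/12 \<le> accept_prob (pow_alg F 22) q"
  proof -
    have "1 - 1/512 \<le> accept_prob F q"
      using coin_alg_complete[of s t M q] s t err by (simp add: F_def)
    then have "(1 - 1/512) ^ 22 \<le> accept_prob F q ^ 22" by (intro power_mono) auto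
    moreover have "1 - real 22 * (1/512) \<le> (1 - 1/512) ^ 22" by (rule one_minus_power_ge) auto
    ultimately show ?thesis by (simp add: accept_prob_pow)
  qed
  moreover have "accept_prob (pow_alg F 22) p \<le> 1/4"
    if p: "is_dist n p"
      and far: "\<eta> \<le> (\<Sum>c\<in>I. \<bar>measure_pmf.prob p {i \<in> {1..n}. lbl i = c} - measure_pmf.prob q {i \<in> {1..n}. lbl i = c}\<bar>)"
    for p
  proof -
    define e where "e c = measure_pmf.prob p {i \<in> {1..n}. lbl i = c} - measure_pmf.prob q {i \<in> {1..n}. lbl i = c}" for c
    have cls: "(\<Sum>c\<in>J. measure_pmf.prob r {i \<in> {1..n}. lbl i = c}) = measure_pmf.prob r {i \<in> {1..n}. lbl i \<in> J}"
      if "J \<subseteq> I" for r :: "nat pmf" and J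
    proof -
      have "finite J" using that I(1) finite_subset by blast
      then have "(\<Sum>c\<in>J. measure_pmf.prob r {i \<in> {1..n}. lbl i = c}) =
          measure_pmf.prob r (\<Union>c\<in>J. {i \<in> {1..n}. lbl i = c})"
        by (intro measure_pmf.finite_measure_finite_Union[symmetric]) (auto simp: disjoint_family_on_def)
      also have "(\<Union>c\<in>J. {i \<in> {1..n}. lbl i = c}) = {i \<in> {1..n}. lbl i \<in> J}" by auto
      finally show ?thesis .
    qed
    have one: "measure_pmf.prob r {i \<in> {1..n}. lbl i \<in> I} = 1" if "is_dist n r" for r
      using that I(2) by (subst measure_pmf.prob_eq_1) (auto simp: is_dist_def AE_measure_pmf_iff image_subset_iff)
    have sumJ: "(\<Sum>c\<in>J. e c) = measure_pmf.prob p {i \<in> {1..n}. lbl i \<in> J} - measure_pmf.prob q {i \<in> {1..n}. lbl i \<in> J}"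
      if "J \<subseteq> I" for J
      unfolding e_def sum_subtractf using that by (simp only: cls)
    \<comment> \<open>Both distributions put mass 1 on the classes together; therefore the signed
      sum is exactly twice the discrepancy of the union of \<open>J\<close>.\<close>
    have sum0: "(\<Sum>c\<in>I. e c) = 0" unfolding sumJ[OF subset_refl] one[OF p] one[OF q] by simp
    have gap: "bias_gap p q ({1..n}, {i \<in> {1..n}. lbl i \<in> J}) = \<bar>signed_sum e I J\<bar> / 2" if "J \<subseteq> I" for J
    proof -
      have "signed_sum e I J = (\<Sum>c\<in>I. 2 * (if c \<in> J then e c else 0) - e c)"
        unfolding signed_sum_def by (intro sum.cong) auto
      also have "\<dots> = 2 * (\<Sum>c\<in>I. if c \<in> J then e c else 0) - (\<Sum>c\<in>I. e c)"
        by (simp only: sum_subtractf sum_distrib_left)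
      also have "(\<Sum>c\<in>I. if c \<in> J then e c else 0) = (\<Sum>c\<in>J. e c)"
        using that I(1) by (simp add: sum.If_cases Int_absorb1)
      finally have "signed_sum e I J = 2 * (measure_pmf.prob p {i \<in> {1..n}. lbl i \<in> J} -
          measure_pmf.prob q {i \<in> {1..n}. lbl i \<in> J})"
        unfolding sum0 sumJ[OF that] by simp
      then show ?thesis
        unfolding bias_gap_def prod.case cond_sample_full[OF p] cond_sample_full[OF q]
        by (simp only:) argo
    qed
    let ?V = "\<Sum>c\<in>I. e c ^ 2"
    have "\<eta>\<^sup>2 \<le> (\<Sum>c\<in>I. \<bar>e c\<bar>)\<^sup>2" using far eta by (intro power_mono) (auto simp: e_def)
    also have "\<dots> \<le> (\<Sum>c\<in>I. \<bar>e c\<bar>\<^sup>2) * real (card I)" by (rule sum_squared_le_sum_of_squares)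
    also have "\<dots> \<le> ?V * k" using I(3) by (simp add: mult_left_mono sum_nonneg)
    finally have V: "\<eta>\<^sup>2 / k \<le> ?V" using k by (simp add: field_simps)
    have big: "2 * t \<le> bias_gap p q ({1..n}, {i \<in> {1..n}. lbl i \<in> J})"
      if J: "J \<subseteq> I" "?V / 4 \<le> signed_sum e I J ^ 2" for J
    proof -
      have "(\<eta> / (2 * sqrt k))\<^sup>2 = \<eta>\<^sup>2 / k / 4" using k by (simp add: power_divide power_mult_distrib)
      also have "\<dots> \<le> signed_sum e I J ^ 2" using divide_right_mono[OF V, of 4] J(2) by simp
      finally have "\<bar>\<eta> / (2 * sqrt k)\<bar> \<le> \<bar>signed_sum e I J\<bar>" by (simp only: abs_le_square_iff)
      then show ?thesis unfolding gap[OF J(1)] t_def using eta k by simp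
    qed
    have "3 / 16 \<le> measure_pmf.prob M {x. 2 * t \<le> bias_gap p q x}"
    proof -
      have fin: "finite (Pow I)" "Pow I \<noteq> {}" using I by auto
      have "3 / 16 \<le> real (card {J \<in> Pow I. ?V / 4 \<le> signed_sum e I J ^ 2}) / real (card (Pow I))"
        using signed_sum_anticoncentration[OF I(1), of e] I(1) by (simp add: card_Pow field_simps)
      also have "\<dots> = measure_pmf.prob (pmf_of_set (Pow I)) {J. ?V / 4 \<le> signed_sum e I J ^ 2}"
        using fin by (simp add: measure_pmf_of_set Int_def)
      also have "\<dots> = measure_pmf.prob (pmf_of_set (Pow I)) {J \<in> Pow I. ?V / 4 \<le> signed_sum e I J ^ 2}"
        using fin by (intro measure_eq_AE) (auto simp: AE_measure_pmf_iff)
      also have "\<dots> \<le> measure_pmf.prob M {x. 2 * t \<le> bias_gap p q x}"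
        unfolding M_def measure_map_pmf
        by (intro measure_pmf.finite_measure_mono subsetI)
           (use big in \<open>simp_all only: vimage_def mem_Collect_eq Pow_iff\<close>, simp)
      finally show ?thesis .
    qed
    moreover have "accept_prob F p \<le> 1 - measure_pmf.prob M {x. 2 * t \<le> bias_gap p q x} / 2"
      unfolding F_def using s t err by (intro coin_alg_sound) auto
    ultimately have "accept_prob F p \<le> 1 + (- 3/32)" by linarith
    also have "\<dots> \<le> exp (- 3/32)" by (rule exp_ge_add_one_self)
    finally have "accept_prob F p ^ 22 \<le> exp (- 3/32) ^ 22"
      by (intro power_mono accept_prob_bounds)
    also have "\<dots> = exp (- 66/32)" by (simp flip: exp_of_nat_mult)
    also have "\<dots> \<le> exp (-2)" by simp
    also have "\<dots> \<le> 1/4" using exp_two_ge by (simp add: exp_minus field_simps)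
    finally show ?thesis by (simp add: accept_prob_pow)
  qed
  ultimately show ?thesis by blast
qed

section \<open>Merging random pairs of blocks\<close>

definition distinct_pairs :: "nat \<Rightarrow> (nat \<times> nat) set" where
  "distinct_pairs N = {(u, v). u < N \<and> v < N \<and> u \<noteq> v}"

lemma distinct_pairs_alt: "distinct_pairs N = Sigma {..<N} (\<lambda>u. {..<N} - {u})"
  by (auto simp: distinct_pairs_def)

lemma finite_distinct_pairs: "finite (distinct_pairs N)" by (simp add: distinct_pairs_alt)

lemma card_distinct_pairs: "card (distinct_pairs N) = N * (N - 1)"
  unfolding distinct_pairs_alt by (subst card_SigmaI) auto

text \<open>Twofold transitivity of the symmetric group; two transpositions suffice.\<close>

lemma exists_permutes_pair:
  assumes "(a, b) \<in> distinct_pairs N" "(a', b') \<in> distinct_pairs N"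
  shows "\<exists>\<tau>. \<tau> permutes {..<N} \<and> \<tau> a = a' \<and> \<tau> b = b'"
proof -
  define c where "c = Transposition.transpose a a' b"
  have c: "c \<noteq> a'" "c < N"
    using assms by (auto simp: c_def distinct_pairs_def Transposition.transpose_def)
  let ?t = "Transposition.transpose c b' \<circ> Transposition.transpose a a'"
  have "?t permutes {..<N}"
    using assms c by (intro permutes_compose permutes_swap_id) (auto simp: distinct_pairs_def)
  moreover have "?t a = a'" using assms c by (auto simp: distinct_pairs_def Transposition.transpose_def)
  moreover have "?t b = b'" by (simp add: c_def)
  ultimately show ?thesis by blast
qed

text \<open>By twofold transitivity the sum over permutations does not depend on the chosen pair.
  Summing over all pairs and exchanging the sums finishes the proof, since each permutation acts
  bijectively on \<open>distinct_pairs N\<close>.\<close>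

lemma sum_permutations_pair:
  fixes h :: "nat \<Rightarrow> nat \<Rightarrow> real"
  assumes ab: "(a, b) \<in> distinct_pairs N"
  shows "real (card (distinct_pairs N)) * (\<Sum>\<sigma> | \<sigma> permutes {..<N}. h (\<sigma> a) (\<sigma> b)) =
    fact N * (\<Sum>(u, v)\<in>distinct_pairs N. h u v)"
proof -
  let ?P = "{\<sigma>. \<sigma> permutes {..<N}}"
  have eq: "(\<Sum>\<sigma>\<in>?P. h (\<sigma> u) (\<sigma> v)) = (\<Sum>\<sigma>\<in>?P. h (\<sigma> a) (\<sigma> b))" if uv: "(u, v) \<in> distinct_pairs N" for u v
  proof -
    obtain \<tau> where \<tau>: "\<tau> permutes {..<N}" "\<tau> a = u" "\<tau> b = v"
      using exists_permutes_pair[OF ab uv] by blast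
    show ?thesis using sum_permutations_compose_right[OF \<tau>(1), of "\<lambda>\<sigma>. h (\<sigma> a) (\<sigma> b)"]
      by (simp add: \<tau>)
  qed
  have "real (card (distinct_pairs N)) * (\<Sum>\<sigma>\<in>?P. h (\<sigma> a) (\<sigma> b)) =
      (\<Sum>(u, v)\<in>distinct_pairs N. \<Sum>\<sigma>\<in>?P. h (\<sigma> u) (\<sigma> v))"
    by (simp add: case_prod_unfold eq cong: sum.cong)
  also have "\<dots> = (\<Sum>\<sigma>\<in>?P. \<Sum>(u, v)\<in>distinct_pairs N. h (\<sigma> u) (\<sigma> v))"
    unfolding case_prod_unfold by (rule sum.swap)
  also have "\<dots> = (\<Sum>\<sigma>\<in>?P. \<Sum>(u, v)\<in>distinct_pairs N. h u v)"
  proof (rule sum.cong[OF refl])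
    fix \<sigma> assume "\<sigma> \<in> ?P"
    then have \<sigma>: "\<sigma> permutes {..<N}" by simp
    have lt: "\<sigma> u < N \<longleftrightarrow> u < N" for u using permutes_in_image[OF \<sigma>, of u] by simp
    have inv: "inv \<sigma> u < N \<longleftrightarrow> u < N" for u
      using permutes_in_image[OF permutes_inv[OF \<sigma>], of u] by simp
    show "(\<Sum>(u, v)\<in>distinct_pairs N. h (\<sigma> u) (\<sigma> v)) = (\<Sum>(u, v)\<in>distinct_pairs N. h u v)"
      by (rule sum.reindex_bij_witness[of _ "\<lambda>(u, v). (inv \<sigma> u, inv \<sigma> v)" "\<lambda>(u, v). (\<sigma> u, \<sigma> v)"])
         (auto simp: distinct_pairs_def lt inv permutes_inverses[OF \<sigma>] dest: permutes_inj[OF \<sigma>, THEN injD]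
            permutes_inj[OF permutes_inv[OF \<sigma>], THEN injD])
  qed
  also have "\<dots> = fact N * (\<Sum>(u, v)\<in>distinct_pairs N. h u v)"
    by (simp add: card_permutations[of "{..<N}" N])
  finally show ?thesis .
qed

lemma finite_permutations_nat: "finite {\<sigma>. \<sigma> permutes {..<N :: nat}}"
  by (rule finite_permutations) simp

lemma permutations_nonempty: "{\<sigma>. \<sigma> permutes A} \<noteq> {}"
  using permutes_id by blast

text \<open>A random perfect matching is encoded by a random permutation of the blocks: the
  neighbours at positions \<open>2 * u\<close> and \<open>2 * u + 1\<close> become partners.\<close>

definition merge_blocks :: "(nat \<Rightarrow> nat set) \<Rightarrow> (nat \<Rightarrow> nat) \<Rightarrow> nat \<Rightarrow> nat set" where
  "merge_blocks f \<sigma> u = f (\<sigma> (2 * u)) \<union> f (\<sigma> (2 * u + 1))"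

text \<open>\<open>pairs l k f\<close> draws an ordered pair of distinct blocks after \<open>l\<close> rounds in each of which the
  current blocks are matched up at random and the two partners united; initially there are
  \<open>2 ^ k\<close> blocks.\<close>

primrec pairs :: "nat \<Rightarrow> nat \<Rightarrow> (nat \<Rightarrow> nat set) \<Rightarrow> (nat set \<times> nat set) pmf" where
  "pairs 0 k f = map_pmf (\<lambda>(u, v). (f u, f v)) (pmf_of_set (distinct_pairs (2 ^ k)))"
| "pairs (Suc l) k f =
     bind_pmf (pmf_of_set {\<sigma>. \<sigma> permutes {..<2 ^ k}}) (\<lambda>\<sigma>. pairs l (k - 1) (merge_blocks f \<sigma>))"

text \<open>The invariant of the merging. \<open>a\<close> and \<open>c\<close> stand for p and q
  conditioned on a group. A merge doubles both the lower and the upper bound on the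
  \<open>c\<close>-weights, so the ratio 2 between them survives all rounds.\<close>

definition blocks :: "(nat \<Rightarrow> real) \<Rightarrow> (nat \<Rightarrow> real) \<Rightarrow> real \<Rightarrow> nat \<Rightarrow> (nat \<Rightarrow> nat set) \<Rightarrow> bool" where
  "blocks a c w k f \<longleftrightarrow> 0 < w \<and>
     (\<forall>u<2^k. finite (f u) \<and> w \<le> sum c (f u) \<and> sum c (f u) \<le> 2 * w) \<and>
     (\<forall>u<2^k. \<forall>v<2^k. u \<noteq> v \<longrightarrow> f u \<inter> f v = {}) \<and>
     (\<Sum>u<2^k. sum a (f u)) = 1 \<and> (\<Sum>u<2^k. sum c (f u)) = 1"

lemma sum_even_odd:
  fixes g :: "nat \<Rightarrow> real"
  shows "(\<Sum>v<2 * M. g v) = (\<Sum>u<M. g (2 * u) + g (2 * u + 1))"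
  by (induction M) (auto simp: algebra_simps)

lemma blocks_merge:
  assumes b: "blocks a c w (Suc k) f" and \<sigma>: "\<sigma> permutes {..<2 ^ Suc k}"
  shows "blocks a c (2 * w) k (merge_blocks f \<sigma>)"
proof -
  have lt: "\<sigma> u < 2 ^ Suc k \<longleftrightarrow> u < 2 ^ Suc k" for u using permutes_in_image[OF \<sigma>, of u] by simp
  have inj: "\<sigma> u = \<sigma> v \<longleftrightarrow> u = v" for u v using permutes_inj[OF \<sigma>] by (auto simp: inj_def)
  have ev: "\<sigma> (2 * u) < 2 ^ Suc k" "\<sigma> (2 * u + 1) < 2 ^ Suc k" if "u < 2 ^ k" for u
    unfolding lt using that by auto
  have disj: "f (\<sigma> x) \<inter> f (\<sigma> y) = {}" if "x \<noteq> y" "x < 2 ^ Suc k" "y < 2 ^ Suc k" for x y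
    using b that unfolding blocks_def by (metis inj lt)
  have fin: "finite (f (\<sigma> x))" if "x < 2 ^ Suc k" for x
    using b that lt unfolding blocks_def by blast
  have sm: "sum h (merge_blocks f \<sigma> u) = sum h (f (\<sigma> (2 * u))) + sum h (f (\<sigma> (2 * u + 1)))"
    if "u < 2 ^ k" for u and h :: "nat \<Rightarrow> real"
    unfolding merge_blocks_def using that by (intro sum.union_disjoint fin disj) auto
  have tot: "(\<Sum>u<2^k. sum h (merge_blocks f \<sigma> u)) = (\<Sum>u<2 ^ Suc k. sum h (f u))" for h :: "nat \<Rightarrow> real"
  proof -
    have "(\<Sum>u<2^k. sum h (merge_blocks f \<sigma> u)) =
        (\<Sum>u<2^k. sum h (f (\<sigma> (2 * u))) + sum h (f (\<sigma> (2 * u + 1))))"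
      by (intro sum.cong) (auto simp: sm)
    also have "\<dots> = (\<Sum>v<2 ^ Suc k. sum h (f (\<sigma> v)))" by (simp add: sum_even_odd)
    also have "\<dots> = (\<Sum>u<2 ^ Suc k. sum h (f u))"
      using sum.permute[OF \<sigma>, of "\<lambda>u. sum h (f u)"] by (simp add: o_def)
    finally show ?thesis .
  qed
  have bnd: "w \<le> sum c (f (\<sigma> x))" "sum c (f (\<sigma> x)) \<le> 2 * w" if "x < 2 ^ Suc k" for x
    using b that lt unfolding blocks_def by blast+
  show ?thesis
    unfolding blocks_def
  proof (intro conjI allI impI)
    fix u :: nat assume u: "u < 2 ^ k"
    then have u2: "2 * u < 2 ^ Suc k" "2 * u + 1 < 2 ^ Suc k" by auto
    show "finite (merge_blocks f \<sigma> u)" unfolding merge_blocks_def using u2 by (simp add: fin)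
    show "2 * w \<le> sum c (merge_blocks f \<sigma> u)" "sum c (merge_blocks f \<sigma> u) \<le> 2 * (2 * w)"
      using sm[OF u, of c] bnd[OF u2(1)] bnd[OF u2(2)] by linarith+
    fix v assume v: "v < 2 ^ k" "u \<noteq> v"
    have "2 * u \<noteq> 2 * v + 1" "2 * u + 1 \<noteq> 2 * v" by presburger+
    then have "f (\<sigma> x) \<inter> f (\<sigma> y) = {}" if "x \<in> {2 * u, 2 * u + 1}" "y \<in> {2 * v, 2 * v + 1}" for x y
      using that u v by (intro disj) auto
    then show "merge_blocks f \<sigma> u \<inter> merge_blocks f \<sigma> v = {}"
      unfolding merge_blocks_def by blast
  qed (use b in \<open>auto simp: blocks_def tot\<close>)
qed

lemma pairs_support:
  assumes "blocks a c w k f" "l < k" "(S, S') \<in> set_pmf (pairs l k f)"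
  shows "finite S \<and> finite S' \<and> S \<inter> S' = {} \<and> S \<union> S' \<subseteq> (\<Union>u<2^k. f u) \<and>
    (\<exists>W>0. W \<le> sum c S \<and> sum c S \<le> 2 * W \<and> W \<le> sum c S' \<and> sum c S' \<le> 2 * W)"
  using assms
proof (induction l arbitrary: k f w)
  case 0
  \<comment> \<open>A pair exists only because \<open>k\<close> is positive; on an empty set
    \<open>pmf_of_set\<close> would say nothing about its support.\<close>
  have "(1::nat) < 2 ^ k" using 0(2) by (intro one_less_power) auto
  then have "(0, 1) \<in> distinct_pairs (2 ^ k)" by (simp add: distinct_pairs_def)
  then have "set_pmf (pmf_of_set (distinct_pairs (2 ^ k))) = distinct_pairs (2 ^ k)"
    using finite_distinct_pairs by (intro set_pmf_of_set) auto
  then obtain u v where uv: "S = f u" "S' = f v" "u < 2 ^ k" "v < 2 ^ k" "u \<noteq> v"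
    using 0(3) by (auto simp: distinct_pairs_def)
  then show ?case using 0(1) unfolding blocks_def uv by (intro conjI exI[of _ w]) auto
next
  case (Suc l)
  then obtain k' where k: "k = Suc k'" by (cases k) auto
  obtain \<sigma> where \<sigma>: "\<sigma> permutes {..<2 ^ Suc k'}" "(S, S') \<in> set_pmf (pairs l k' (merge_blocks f \<sigma>))"
    using Suc.prems(3) set_pmf_of_set[OF permutations_nonempty finite_permutations_nat] k by auto
  have lt: "\<sigma> u < 2 ^ Suc k'" if "u < 2 ^ Suc k'" for u
    using permutes_in_image[OF \<sigma>(1), of u] that by simp
  have "(\<Union>u<2^k'. merge_blocks f \<sigma> u) \<subseteq> (\<Union>u<2^k. f u)"
  proof
    fix x assume "x \<in> (\<Union>u<2^k'. merge_blocks f \<sigma> u)"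
    then obtain u where u: "u < 2 ^ k'" "x \<in> f (\<sigma> (2 * u)) \<union> f (\<sigma> (2 * u + 1))"
      by (auto simp: merge_blocks_def)
    moreover have "\<sigma> (2 * u) < 2 ^ Suc k'" "\<sigma> (2 * u + 1) < 2 ^ Suc k'"
      using u(1) by (intro lt; simp)+
    ultimately show "x \<in> (\<Union>u<2^k. f u)" unfolding k by blast
  qed
  then show ?case
    using Suc.IH[OF blocks_merge[OF Suc.prems(1)[unfolded k] \<sigma>(1)] _ \<sigma>(2)] Suc.prems(2) k by auto
qed

text \<open>The deficit is relative to \<open>sum c S\<close> because a conditional probability
  detects it in this form. The partner must not be deficient: two blocks short by the same factor
  would leave the conditional probability unchanged.\<close>

definition deficit :: "(nat \<Rightarrow> real) \<Rightarrow> (nat \<Rightarrow> real) \<Rightarrow> real \<Rightarrow> nat set \<times> nat set \<Rightarrow> real" where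
  "deficit a c \<theta> = (\<lambda>(S, S'). if sum a S < sum c S \<and> sum c S' \<le> sum a S' \<and> \<theta> \<le> 1 - sum a S / sum c S
     then 1 - sum a S / sum c S else 0)"

lemma deficit_bounds:
  assumes "\<And>i. 0 \<le> a i"
  shows "0 \<le> deficit a c \<theta> x" "deficit a c \<theta> x \<le> 1"
proof -
  obtain S S' where x: "x = (S, S')" by force
  have "0 \<le> sum a S" by (simp add: assms sum_nonneg)
  then show "0 \<le> deficit a c \<theta> x" "deficit a c \<theta> x \<le> 1"
    by (auto simp: deficit_def x field_simps)
qed

text \<open>Merging blocks with surplus signs \<open>x\<close> and \<open>y\<close> lowers the total
  positive part exactly when the signs are opposite. The loss is split into two ordered halves, one
  for each block in the deficient role, to match sums over ordered pairs.\<close>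

definition cancelled :: "real \<Rightarrow> real \<Rightarrow> real" where
  "cancelled x y = min (max 0 x) (max 0 (- y))"

lemma cancelled_eq: "max 0 x + max 0 y - max 0 (x + y) = cancelled x y + cancelled y x"
  by (auto simp: cancelled_def)

lemma cancelled_zero: "x \<le> 0 \<or> 0 \<le> y \<Longrightarrow> cancelled x y = 0"
  by (auto simp: cancelled_def)

lemma cancelled_le: "0 \<le> x \<Longrightarrow> cancelled x y \<le> x"
  by (simp add: cancelled_def)

text \<open>One round: since the two blocks are drawn independently up to distinctness, a deficient block
  meets a non-deficient partner as often as the decrease of the total deficit requires.\<close>

lemma deficit_round:
  assumes b: "blocks a c w k f" and k: "0 < k"
    and X: "4 * \<theta> \<le> (\<Sum>u<2^k. max 0 (sum c (f u) - sum a (f u)))" and th: "0 \<le> \<theta>"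
  shows "2 ^ k / 4 * (\<Sum>(u, v)\<in>distinct_pairs (2 ^ k). cancelled (sum c (f u) - sum a (f u)) (sum c (f v) - sum a (f v)))
    \<le> (\<Sum>(u, v)\<in>distinct_pairs (2 ^ k). deficit a c \<theta> (f u, f v))"
proof -
  define N where "N = (2::nat) ^ k"
  define x where "x u = sum c (f u) - sum a (f u)" for u
  define C where "C u = sum c (f u)" for u
  define P where "P = {u \<in> {..<N}. 0 < x u}"
  define Q where "Q = {u \<in> {..<N}. x u \<le> 0}"
  define g where "g u = (if \<theta> \<le> x u / C u then x u / C u else 0)" for u
  have C: "w \<le> C u" "C u \<le> 2 * w" if "u < N" for u using b that by (auto simp: blocks_def C_def N_def)
  have w: "0 < w" using b by (simp add: blocks_def)
  have "real N * w \<le> (\<Sum>u<N. C u)" using C sum_bounded_below[of "{..<N}" w C] by simp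
  then have Nw: "real N * w \<le> 1" using b by (simp add: blocks_def C_def N_def)
  have XP: "(\<Sum>u<N. max 0 (x u)) = (\<Sum>u\<in>P. x u)"
    unfolding P_def by (subst sum.inter_filter) (auto intro!: sum.cong)
  have sub: "P \<times> Q \<subseteq> distinct_pairs N" by (auto simp: P_def Q_def distinct_pairs_def)
  have fin: "finite P" "finite Q" by (auto simp: P_def Q_def)
  have "card P \<le> card {..<N}" by (rule card_mono) (auto simp: P_def)
  then have cP: "card P \<le> N" by simp
  have "(\<Sum>(u, v)\<in>distinct_pairs N. cancelled (x u) (x v)) = (\<Sum>(u, v)\<in>P \<times> Q. cancelled (x u) (x v))"
    by (rule sum.mono_neutral_right[OF finite_distinct_pairs sub])
       (auto simp: P_def Q_def distinct_pairs_def intro!: cancelled_zero)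
  also have "\<dots> \<le> (\<Sum>(u, v)\<in>P \<times> Q. x u)"
    by (rule sum_mono) (auto simp: P_def intro!: cancelled_le)
  also have "\<dots> = real (card Q) * (\<Sum>u\<in>P. x u)"
    using fin by (simp add: sum_distrib_left flip: sum.cartesian_product)
  finally have 1: "(\<Sum>(u, v)\<in>distinct_pairs N. cancelled (x u) (x v)) \<le> real (card Q) * (\<Sum>u\<in>P. x u)" .
  \<comment> \<open>Truncation loses at most \<theta> for each of at most \<open>N\<close> deficient
    blocks; as the total deficit is at least \<open>4 * \<theta>\<close>, half of the main term pays
    for this.\<close>
  have "real N / 4 * (\<Sum>u\<in>P. x u) \<le> real N / 2 * (\<Sum>u\<in>P. x u) - real N * \<theta>"
    using X[folded x_def N_def] mult_left_mono[of "4 * \<theta>" "\<Sum>u\<in>P. x u" "real N / 4"]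
    unfolding N_def[symmetric] XP by (simp add: field_simps)
  also have "\<dots> \<le> (\<Sum>u\<in>P. real N / 2 * x u) - (\<Sum>u\<in>P. \<theta>)"
    using cP th mult_right_mono[of "real (card P)" "real N" \<theta>] by (simp add: sum_distrib_left)
  also have "\<dots> \<le> (\<Sum>u\<in>P. g u)"
    unfolding sum_subtractf[symmetric]
  proof (rule sum_mono)
    fix u assume u: "u \<in> P"
    then have "u < N" "0 < x u" by (auto simp: P_def)
    \<comment> \<open>Total \<open>c\<close>-weight 1 forces \<open>N * w\<close> to be at most 1,
      so no block weighs more than 2 / N, and passing from absolute to relative deficits gains a
      factor N / 2.\<close>
    have "C u * real N \<le> 2 * w * real N" using C[OF \<open>u < N\<close>] by (intro mult_right_mono) auto
    then have "C u * real N \<le> 2" using Nw by (simp add: mult.commute mult.assoc) argo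
    then have "x u * (C u * real N) \<le> x u * 2" using \<open>0 < x u\<close> by (intro mult_left_mono) auto
    then have "real N / 2 * x u \<le> x u / C u"
      using C[OF \<open>u < N\<close>] w by (simp add: field_simps)
    moreover have "x u / C u - \<theta> \<le> g u" using th by (simp add: g_def)
    ultimately show "real N / 2 * x u - \<theta> \<le> g u" by argo
  qed
  finally have 2: "real N / 4 * (\<Sum>u\<in>P. x u) \<le> (\<Sum>u\<in>P. g u)" .
  have "real N / 4 * (\<Sum>(u, v)\<in>distinct_pairs N. cancelled (x u) (x v)) \<le> real N / 4 * (real (card Q) * (\<Sum>u\<in>P. x u))"
    using 1 by (intro mult_left_mono) auto
  also have "\<dots> \<le> real (card Q) * (\<Sum>u\<in>P. g u)"
    using mult_left_mono[OF 2, of "real (card Q)"] by (simp add: algebra_simps)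
  also have "\<dots> = (\<Sum>(u, v)\<in>P \<times> Q. g u)"
    using fin by (simp add: sum_distrib_left flip: sum.cartesian_product)
  also have "\<dots> = (\<Sum>(u, v)\<in>P \<times> Q. deficit a c \<theta> (f u, f v))"
  proof (rule sum.cong[OF refl], clarify)
    fix u v assume "u \<in> P" "v \<in> Q"
    then have uv: "u < N" "0 < x u" "x v \<le> 0" by (auto simp: P_def Q_def)
    have "x u / C u = 1 - sum a (f u) / sum c (f u)"
      using C[OF uv(1)] w by (simp add: x_def C_def diff_divide_distrib)
    then show "g u = deficit a c \<theta> (f u, f v)"
      using uv by (auto simp: g_def deficit_def x_def)
  qed
  also have "\<dots> = (\<Sum>(u, v)\<in>distinct_pairs N. deficit a c \<theta> (f u, f v))"
    by (rule sum.mono_neutral_left[OF finite_distinct_pairs sub])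
       (auto simp: deficit_def P_def Q_def distinct_pairs_def x_def split: if_splits)
  finally show ?thesis by (simp add: N_def x_def)
qed

text \<open>Each of the \<open>2 ^ k\<close> matched pairs is uniform on the ordered pairs and loses
  \<open>cancelled\<close> in both orders. This makes \<open>2 ^ Suc k\<close> times the mean over
  \<open>distinct_pairs\<close>.\<close>

lemma deficit_after_matching:
  assumes b: "blocks a c w (Suc k) f"
  defines "x \<equiv> \<lambda>u. sum c (f u) - sum a (f u)"
  shows "E (pmf_of_set {\<sigma>. \<sigma> permutes {..<2 ^ Suc k}})
      (\<lambda>\<sigma>. \<Sum>u<2^k. max 0 (sum c (merge_blocks f \<sigma> u) - sum a (merge_blocks f \<sigma> u))) =
    (\<Sum>u<2 ^ Suc k. max 0 (x u)) -
      2 ^ Suc k * ((\<Sum>(u, v)\<in>distinct_pairs (2 ^ Suc k). cancelled (x u) (x v)) / real (card (distinct_pairs (2 ^ Suc k))))"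
proof -
  define N where "N = (2::nat) ^ Suc k"
  let ?S = "{\<sigma>. \<sigma> permutes {..<N}}"
  let ?D = "\<Sum>(u, v)\<in>distinct_pairs N. cancelled (x u) (x v)"
  have step: "(\<Sum>u<2^k. max 0 (sum c (merge_blocks f \<sigma> u) - sum a (merge_blocks f \<sigma> u))) =
      (\<Sum>u<N. max 0 (x u)) - (\<Sum>u<2^k. cancelled (x (\<sigma> (2 * u))) (x (\<sigma> (2 * u + 1))) + cancelled (x (\<sigma> (2 * u + 1))) (x (\<sigma> (2 * u))))"
    if "\<sigma> permutes {..<N}" for \<sigma>
  proof -
    have lt: "\<sigma> u < N \<longleftrightarrow> u < N" for u using permutes_in_image[OF that, of u] by simp
    have inj: "\<sigma> u = \<sigma> v \<longleftrightarrow> u = v" for u v using permutes_inj[OF that] by (auto simp: inj_def)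
    have sm: "sum h (merge_blocks f \<sigma> u) = sum h (f (\<sigma> (2 * u))) + sum h (f (\<sigma> (2 * u + 1)))"
      if u: "u < 2 ^ k" for u and h :: "nat \<Rightarrow> real"
    proof -
      have *: "\<sigma> (2 * u) < N" "\<sigma> (2 * u + 1) < N" "\<sigma> (2 * u) \<noteq> \<sigma> (2 * u + 1)"
        unfolding lt inj using u by (auto simp: N_def)
      then show ?thesis
        using b unfolding merge_blocks_def blocks_def N_def by (intro sum.union_disjoint) auto
    qed
    have "(\<Sum>u<2^k. max 0 (sum c (merge_blocks f \<sigma> u) - sum a (merge_blocks f \<sigma> u))) =
      (\<Sum>u<2^k. (max 0 (x (\<sigma> (2 * u))) + max 0 (x (\<sigma> (2 * u + 1)))) -
         (cancelled (x (\<sigma> (2 * u))) (x (\<sigma> (2 * u + 1))) + cancelled (x (\<sigma> (2 * u + 1))) (x (\<sigma> (2 * u)))))"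
    proof (rule sum.cong[OF refl])
      fix u assume "u \<in> {..<(2::nat)^k}"
      then have "sum c (merge_blocks f \<sigma> u) - sum a (merge_blocks f \<sigma> u) = x (\<sigma> (2 * u)) + x (\<sigma> (2 * u + 1))"
        by (simp add: sm x_def)
      then show "max 0 (sum c (merge_blocks f \<sigma> u) - sum a (merge_blocks f \<sigma> u)) =
        (max 0 (x (\<sigma> (2 * u))) + max 0 (x (\<sigma> (2 * u + 1)))) -
         (cancelled (x (\<sigma> (2 * u))) (x (\<sigma> (2 * u + 1))) + cancelled (x (\<sigma> (2 * u + 1))) (x (\<sigma> (2 * u))))"
        using cancelled_eq[of "x (\<sigma> (2 * u))" "x (\<sigma> (2 * u + 1))"] by simp
    qed
    also have "\<dots> = (\<Sum>u<2^k. max 0 (x (\<sigma> (2 * u))) + max 0 (x (\<sigma> (2 * u + 1)))) -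
        (\<Sum>u<2^k. cancelled (x (\<sigma> (2 * u))) (x (\<sigma> (2 * u + 1))) + cancelled (x (\<sigma> (2 * u + 1))) (x (\<sigma> (2 * u))))"
      by (rule sum_subtractf)
    also have "(\<Sum>u<2^k. max 0 (x (\<sigma> (2 * u))) + max 0 (x (\<sigma> (2 * u + 1)))) = (\<Sum>u<N. max 0 (x (\<sigma> u)))"
      by (simp add: N_def sum_even_odd)
    also have "\<dots> = (\<Sum>u<N. max 0 (x u))"
      using sum.permute[OF that, of "\<lambda>u. max 0 (x u)"] by (simp add: o_def)
    finally show ?thesis .
  qed
  have card: "real (card (distinct_pairs N)) > 0"
  proof -
    have "(1::nat) < N" unfolding N_def by (intro one_less_power) auto
    then show ?thesis unfolding card_distinct_pairs by simp
  qed
  have avg: "(\<Sum>\<sigma>\<in>?S. cancelled (x (\<sigma> i)) (x (\<sigma> j))) = fact N * (?D / real (card (distinct_pairs N)))"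
    if "(i, j) \<in> distinct_pairs N" for i j
    using sum_permutations_pair[OF that, of "\<lambda>u v. cancelled (x u) (x v)"] card by (simp add: field_simps)
  have cS: "card ?S = fact N" by (simp add: card_permutations)
  have "(\<Sum>\<sigma>\<in>?S. \<Sum>u<2^k. max 0 (sum c (merge_blocks f \<sigma> u) - sum a (merge_blocks f \<sigma> u))) =
    fact N * (\<Sum>u<N. max 0 (x u)) -
    (\<Sum>u<2^k. (\<Sum>\<sigma>\<in>?S. cancelled (x (\<sigma> (2 * u))) (x (\<sigma> (2 * u + 1)))) + (\<Sum>\<sigma>\<in>?S. cancelled (x (\<sigma> (2 * u + 1))) (x (\<sigma> (2 * u)))))"
  proof -
    have "(\<Sum>\<sigma>\<in>?S. \<Sum>u<2^k. cancelled (x (\<sigma> (2 * u))) (x (\<sigma> (2 * u + 1))) + cancelled (x (\<sigma> (2 * u + 1))) (x (\<sigma> (2 * u)))) =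
      (\<Sum>u<2^k. \<Sum>\<sigma>\<in>?S. cancelled (x (\<sigma> (2 * u))) (x (\<sigma> (2 * u + 1))) + cancelled (x (\<sigma> (2 * u + 1))) (x (\<sigma> (2 * u))))"
      by (rule sum.swap)
    then show ?thesis by (simp add: step sum_subtractf cS sum.distrib)
  qed
  also have "(\<Sum>u<2^k. (\<Sum>\<sigma>\<in>?S. cancelled (x (\<sigma> (2 * u))) (x (\<sigma> (2 * u + 1)))) + (\<Sum>\<sigma>\<in>?S. cancelled (x (\<sigma> (2 * u + 1))) (x (\<sigma> (2 * u))))) =
     (\<Sum>u<(2::nat)^k. fact N * (?D / real (card (distinct_pairs N))) + fact N * (?D / real (card (distinct_pairs N))))"
    by (intro sum.cong refl arg_cong2[where f = "(+)"] avg) (auto simp: distinct_pairs_def N_def)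
  finally have "(\<Sum>\<sigma>\<in>?S. \<Sum>u<2^k. max 0 (sum c (merge_blocks f \<sigma> u) - sum a (merge_blocks f \<sigma> u))) =
      fact N * ((\<Sum>u<N. max 0 (x u)) - 2 ^ Suc k * (?D / real (card (distinct_pairs N))))"
    by (simp add: algebra_simps)
  then show ?thesis
    unfolding N_def[symmetric]
    by (subst integral_pmf_of_set[OF permutations_nonempty finite_permutations_nat]) (simp add: cS)
qed

text \<open>A telescoping argument for the potential (X - 4 \<theta>) / 4, X being the total
  deficit. It is at most 0 at the end, where a single block has weight 1 under both \<open>a\<close>
  and \<open>c\<close>. Its expected decrease in a round is bounded by the mean truncated deficit of
  that round's pairs as long as X is at least 4 \<theta>; below that value the claim is
  trivial.\<close>

lemma deficit_sum:
  assumes a: "\<And>i. 0 \<le> a i" and th: "0 \<le> \<theta>" and b: "blocks a c w k f"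
  shows "((\<Sum>u<2^k. max 0 (sum c (f u) - sum a (f u))) - 4 * \<theta>) / 4 \<le> (\<Sum>l<k. E (pairs l k f) (deficit a c \<theta>))"
  using b
proof (induction k arbitrary: f w)
  case 0
  then show ?case using th by (simp add: blocks_def)
next
  case (Suc k)
  let ?X = "\<Sum>u<2^Suc k. max 0 (sum c (f u) - sum a (f u))"
  let ?S = "pmf_of_set {\<sigma>. \<sigma> permutes {..<2 ^ Suc k :: nat}}"
  let ?g = "deficit a c \<theta>"
  have g: "0 \<le> ?g z" "?g z \<le> 1" for z by (rule deficit_bounds[OF a])+
  show ?case
  proof (cases "?X < 4 * \<theta>")
    case True
    then have "(?X - 4 * \<theta>) / 4 \<le> 0" by simp
    also have "0 \<le> (\<Sum>l<Suc k. E (pairs l (Suc k) f) ?g)"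
      by (intro sum_nonneg Bochner_Integration.integral_nonneg g)
    finally show ?thesis .
  next
    case False
    define D where "D = (\<Sum>(u, v)\<in>distinct_pairs (2 ^ Suc k). cancelled (sum c (f u) - sum a (f u)) (sum c (f v) - sum a (f v))) / real (card (distinct_pairs (2 ^ Suc k)))"
    have ne: "distinct_pairs (2 ^ Suc k) \<noteq> {}"
    proof -
      have "(1::nat) < 2 ^ Suc k" by (intro one_less_power) auto
      then have "(0, 1) \<in> distinct_pairs (2 ^ Suc k)" by (simp add: distinct_pairs_def)
      then show ?thesis by blast
    qed
    have "2 ^ Suc k / 4 * D \<le> (\<Sum>(u, v)\<in>distinct_pairs (2 ^ Suc k). ?g (f u, f v)) / real (card (distinct_pairs (2 ^ Suc k)))"
      using divide_right_mono[OF deficit_round[OF Suc.prems], of \<theta> "real (card (distinct_pairs (2 ^ Suc k)))"] False th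
      by (simp add: D_def)
    also have "\<dots> = E (pairs 0 (Suc k) f) ?g"
      using ne finite_distinct_pairs by (simp add: integral_pmf_of_set case_prod_unfold)
    finally have first: "2 ^ Suc k / 4 * D \<le> E (pairs 0 (Suc k) f) ?g" .
    have fin: "finite (set_pmf ?S)"
      using set_pmf_of_set[OF permutations_nonempty finite_permutations_nat] finite_permutations_nat
      by simp
    have int: "integrable (measure_pmf ?S) h" for h :: "(nat \<Rightarrow> nat) \<Rightarrow> real"
      using fin by (rule integrable_measure_pmf_finite)
    have lin: "E ?S (\<lambda>\<sigma>. (h \<sigma> - 4 * \<theta>) / 4) = (E ?S h - 4 * \<theta>) / 4" for h
      by (subst integral_divide_zero) (subst Bochner_Integration.integral_diff[OF int int], simp)
    have "(?X - 2 ^ Suc k * D - 4 * \<theta>) / 4 =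
        E ?S (\<lambda>\<sigma>. ((\<Sum>u<2^k. max 0 (sum c (merge_blocks f \<sigma> u) - sum a (merge_blocks f \<sigma> u))) - 4 * \<theta>) / 4)"
      unfolding lin deficit_after_matching[OF Suc.prems] D_def by simp
    also have "\<dots> \<le> E ?S (\<lambda>\<sigma>. \<Sum>l<k. E (pairs l k (merge_blocks f \<sigma>)) ?g)"
    proof (rule integral_mono_AE[OF int int])
      show "AE \<sigma> in ?S. ((\<Sum>u<2^k. max 0 (sum c (merge_blocks f \<sigma> u) - sum a (merge_blocks f \<sigma> u))) - 4 * \<theta>) / 4
          \<le> (\<Sum>l<k. E (pairs l k (merge_blocks f \<sigma>)) ?g)"
        unfolding AE_measure_pmf_iff
        using Suc.IH[OF blocks_merge[OF Suc.prems]]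
          set_pmf_of_set[OF permutations_nonempty finite_permutations_nat] by blast
    qed
    also have "\<dots> = (\<Sum>l<k. E ?S (\<lambda>\<sigma>. E (pairs l k (merge_blocks f \<sigma>)) ?g))"
      by (rule Bochner_Integration.integral_sum) (rule int)
    also have "\<dots> = (\<Sum>l<k. E (pairs (Suc l) (Suc k) f) ?g)"
      using g by (simp add: expectation_bind_pmf[where B = 1])
    finally show ?thesis
      using first by (simp add: sum.lessThan_Suc_shift del: sum.lessThan_Suc pairs.simps)
  qed
qed

section \<open>Groups with a nearly constant distribution\<close>

lemma prob_cond_sample:
  assumes "measure_pmf.prob p U \<noteq> 0" "S \<subseteq> U"
  shows "measure_pmf.prob (cond_sample p U) S = measure_pmf.prob p S / measure_pmf.prob p U"
proof -
  have ne: "set_pmf p \<inter> U \<noteq> {}"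
    using assms(1) by (auto simp: measure_pmf_zero_iff)
  have "measure_pmf.prob (cond_pmf p U) S = measure_pmf.prob p (U \<inter> S) / measure_pmf.prob p U"
    by (subst cond_pmf.rep_eq[OF ne], subst measure_uniform_measure)
       (use assms in \<open>auto simp: measure_pmf.emeasure_eq_measure\<close>)
  then show ?thesis using assms by (simp add: cond_sample_def Int_absorb1)
qed

definition trunc :: "real \<Rightarrow> real \<Rightarrow> real" where
  "trunc t x = (if t \<le> x then x else 0)"

text \<open>Since \<open>c'\<close> is at most \<open>a'\<close>, the worst case is
  \<open>a' = c'\<close>, where the difference equals (c - a) c' / ((c + c') (a + c')). As
  \<open>a\<close> is below \<open>c\<close>, this is at least (1 - a / c) times c c' / (c + c')^2,
  and 2/9 is the value of the last fraction at ratio 2, the extreme one allowed.\<close>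

lemma bias_difference_ge:
  fixes a a' c c' W :: real
  assumes "0 \<le> a" "a < c" "c' \<le> a'" "0 < W" "W \<le> c" "c \<le> 2 * W" "W \<le> c'" "c' \<le> 2 * W"
  shows "2 / 9 * (1 - a / c) \<le> c / (c + c') - a / (a + a')"
proof -
  have pos: "0 < c" "0 < c'" using assms by linarith+
  have "0 \<le> (2 * c - c') * (2 * c' - c)" using assms by (intro mult_nonneg_nonneg) auto
  then have r: "2 * (c + c')\<^sup>2 \<le> 9 * (c * c')" by (simp add: power2_eq_square algebra_simps)
  have "2 / 9 * (1 - a / c) = (c - a) * (2 / (9 * c))" using pos by (simp add: field_simps)
  also have "\<dots> \<le> (c - a) * (c' / (c + c')\<^sup>2)"
    using assms pos r by (intro mult_left_mono) (simp_all add: field_simps)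
  also have "\<dots> \<le> (c - a) * (c' / ((c + c') * (a + c')))"
    using assms pos by (intro mult_left_mono divide_left_mono) (auto simp: power2_eq_square)
  also have "\<dots> = c / (c + c') - a / (a + c')"
    using assms pos by (simp add: divide_simps) (simp add: algebra_simps)
  also have "\<dots> \<le> c / (c + c') - a / (a + a')"
    using assms pos by (intro diff_mono divide_left_mono) (auto intro!: mult_pos_pos)
  finally show ?thesis .
qed

text \<open>The normalising masses \<open>P\<close> and \<open>Q\<close> cancel in conditional
  probabilities, so deficits measured inside a group are seen by queries to \<open>p\<close>
  itself.\<close>

lemma bias_gap_ge_deficit:
  assumes PQ: "0 < P" "0 < Q" and fin: "finite S" "finite S'" "S \<inter> S' = {}"
    and W: "0 < W" "W \<le> (\<Sum>i\<in>S. pmf q i / Q)" "(\<Sum>i\<in>S. pmf q i / Q) \<le> 2 * W"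
      "W \<le> (\<Sum>i\<in>S'. pmf q i / Q)" "(\<Sum>i\<in>S'. pmf q i / Q) \<le> 2 * W"
  shows "2 / 9 * deficit (\<lambda>i. pmf p i / P) (\<lambda>i. pmf q i / Q) \<theta> (S, S') \<le>
    trunc (2 / 9 * \<theta>) (bias_gap p q (S \<union> S', S))"
proof -
  define a where "a = (\<lambda>S. \<Sum>i\<in>S. pmf p i / P)"
  define c where "c = (\<lambda>S. \<Sum>i\<in>S. pmf q i / Q)"
  have W': "W \<le> c S" "c S \<le> 2 * W" "W \<le> c S'" "c S' \<le> 2 * W"
    using W unfolding c_def by auto
  have d: "deficit (\<lambda>i. pmf p i / P) (\<lambda>i. pmf q i / Q) \<theta> (S, S') =
      (if a S < c S \<and> c S' \<le> a S' \<and> \<theta> \<le> 1 - a S / c S then 1 - a S / c S else 0)"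
    by (simp add: deficit_def a_def c_def)
  show ?thesis
  proof (cases "a S < c S \<and> c S' \<le> a S' \<and> \<theta> \<le> 1 - a S / c S")
    case False
    then show ?thesis
      unfolding d if_not_P[OF False] using bias_gap_bounds(1)[of p q "(S \<union> S', S)"]
      by (simp add: trunc_def)
  next
    case True
    have pa: "measure_pmf.prob p T = P * a T" and qc: "measure_pmf.prob q T = Q * c T" if "finite T" for T
      using that PQ by (simp_all add: a_def c_def measure_measure_pmf_finite sum_divide_distrib[symmetric])
    have a0: "0 \<le> a S" using PQ by (simp add: a_def sum_nonneg)
    have un: "a (S \<union> S') = a S + a S'" "c (S \<union> S') = c S + c S'"
      using fin by (simp_all add: a_def c_def sum.union_disjoint)
    have pos: "0 < a S + a S'" "0 < c S + c S'" using True W W' a0 by linarith+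
    have "2 / 9 * (1 - a S / c S) \<le> c S / (c S + c S') - a S / (a S + a S')"
      by (rule bias_difference_ge) (use True W W' a0 in auto)
    also have "\<dots> \<le> bias_gap p q (S \<union> S', S)"
      using fin pos PQ by (simp add: bias_gap_def prob_cond_sample pa qc un)
    finally have "2 / 9 * (1 - a S / c S) \<le> bias_gap p q (S \<union> S', S)" .
    moreover have "2 / 9 * \<theta> \<le> 2 / 9 * (1 - a S / c S)" using True by simp
    ultimately show ?thesis unfolding d using True by (simp add: trunc_def)
  qed
qed

lemma trunc_bounds: "0 \<le> trunc t (bias_gap p q x)" "trunc t (bias_gap p q x) \<le> 1"
  using bias_gap_bounds[of p q x] by (auto simp: trunc_def)

lemma blocks_singletons:
  assumes g: "bij_betw g {..<2 ^ k} G"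
    and ratio: "\<And>i j. i \<in> G \<Longrightarrow> j \<in> G \<Longrightarrow> pmf q i \<le> 2 * pmf q j"
    and qpos: "\<And>i. i \<in> G \<Longrightarrow> 0 < pmf q i" and P: "0 < (\<Sum>i\<in>G. pmf p i)"
  shows "\<exists>w. blocks (\<lambda>i. pmf p i / (\<Sum>i\<in>G. pmf p i)) (\<lambda>i. pmf q i / (\<Sum>i\<in>G. pmf q i)) w k (\<lambda>u. {g u})"
proof -
  have fin: "finite G" using g bij_betw_finite by blast
  have "g 0 \<in> G" using g by (auto simp: bij_betw_def)
  then have ne: "G \<noteq> {}" by blast
  define Q where "Q = (\<Sum>i\<in>G. pmf q i)"
  define P where "P = (\<Sum>i\<in>G. pmf p i)"
  have P: "0 < P" using P by (simp add: P_def)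
  have Q: "0 < Q" unfolding Q_def using fin ne qpos by (intro sum_pos) auto
  define a where "a = (\<lambda>i. pmf p i / P)"
  define c where "c = (\<lambda>i. pmf q i / Q)"
  define f where "f = (\<lambda>u. {g u})"
  define m where "m = Min (pmf q ` G)"
  have m: "m \<in> pmf q ` G" "\<And>i. i \<in> G \<Longrightarrow> m \<le> pmf q i"
    unfolding m_def using fin ne by auto
  have m2: "0 < m" "\<And>i. i \<in> G \<Longrightarrow> pmf q i \<le> 2 * m" using m(1) qpos ratio by auto
  have gG: "g u \<in> G" if "u < 2 ^ k" for u using g that by (auto simp: bij_betw_def)
  have resum: "(\<Sum>u<2^k. h (g u)) = (\<Sum>i\<in>G. h i)" for h :: "nat \<Rightarrow> real"
    using sum.reindex_bij_betw[OF g] by simp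
  have b: "blocks a c (m / Q) k f"
    unfolding blocks_def
  proof (intro conjI allI impI)
    show "(\<Sum>u<2^k. sum a (f u)) = 1" "(\<Sum>u<2^k. sum c (f u)) = 1"
      using P Q resum[of a] resum[of c]
      by (simp_all add: f_def a_def c_def P_def[symmetric] Q_def[symmetric] flip: sum_divide_distrib)
    fix u v :: nat assume "u < 2 ^ k" "v < 2 ^ k" "u \<noteq> v"
    then show "f u \<inter> f v = {}" using g by (auto simp: f_def bij_betw_def inj_on_def)
  next
    fix u :: nat assume "u < 2 ^ k"
    then show "m / Q \<le> sum c (f u)" "sum c (f u) \<le> 2 * (m / Q)"
      using divide_right_mono[OF m(2)[OF gG], of u Q] divide_right_mono[OF m2(2)[OF gG], of u Q] Q
      by (simp_all add: f_def c_def)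
  qed (use m2 Q in \<open>auto simp: f_def\<close>)
  then show ?thesis unfolding a_def c_def f_def P_def Q_def by blast
qed

text \<open>Writing p - q = a (P - Q) + Q (a - c) with conditional distributions a and c bounds the
  distance on \<open>G\<close> by the difference of the group masses plus 2 Q times the initial
  deficit. The factor 1/18 is 1/4 from \<open>deficit_sum\<close> times 2/9 from
  \<open>bias_gap_ge_deficit\<close>.\<close>

lemma group_gap:
  assumes g: "bij_betw g {..<2 ^ k} G"
    and ratio: "\<And>i j. i \<in> G \<Longrightarrow> j \<in> G \<Longrightarrow> pmf q i \<le> 2 * pmf q j"
    and qpos: "\<And>i. i \<in> G \<Longrightarrow> 0 < pmf q i" and th: "0 \<le> \<theta>"
  shows "1 / 18 * (((\<Sum>i\<in>G. \<bar>pmf p i - pmf q i\<bar>) - \<bar>measure_pmf.prob p G - measure_pmf.prob q G\<bar>) / 2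
      - 4 * \<theta> * measure_pmf.prob q G)
    \<le> measure_pmf.prob q G * (\<Sum>l<k. E (pairs l k (\<lambda>u. {g u}))
        (\<lambda>(S, S'). trunc (2 / 9 * \<theta>) (bias_gap p q (S \<union> S', S))))"
proof -
  have fin: "finite G" using g bij_betw_finite by blast
  have "g 0 \<in> G" using g by (auto simp: bij_betw_def)
  then have ne: "G \<noteq> {}" by blast
  define Q where "Q = measure_pmf.prob q G"
  define P where "P = measure_pmf.prob p G"
  have Qs: "Q = (\<Sum>i\<in>G. pmf q i)" and Ps: "P = (\<Sum>i\<in>G. pmf p i)"
    using fin by (simp_all add: Q_def P_def measure_measure_pmf_finite)
  have Q: "0 < Q" unfolding Qs using fin ne qpos by (intro sum_pos) auto
  let ?R = "\<Sum>l<k. E (pairs l k (\<lambda>u. {g u})) (\<lambda>(S, S'). trunc (2 / 9 * \<theta>) (bias_gap p q (S \<union> S', S)))"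
  have R: "0 \<le> ?R"
    by (intro sum_nonneg Bochner_Integration.integral_nonneg) (auto simp: trunc_bounds)
  show ?thesis
  proof (cases "P = 0")
    \<comment> \<open>Without mass on \<open>G\<close> there is no conditional distribution of
      \<open>p\<close>, but then the whole distance on \<open>G\<close> is the difference of the
      masses and the left side is at most 0.\<close>
    case True
    then have "pmf p i = 0" if "i \<in> G" for i
      using that fin unfolding Ps by (subst (asm) sum_nonneg_eq_0_iff) auto
    then have "(\<Sum>i\<in>G. \<bar>pmf p i - pmf q i\<bar>) = Q" by (simp add: Qs)
    then have "1 / 18 * (((\<Sum>i\<in>G. \<bar>pmf p i - pmf q i\<bar>) - \<bar>P - Q\<bar>) / 2 - 4 * \<theta> * Q) \<le> 0"
      using True Q th by simp
    also have "0 \<le> Q * ?R" using Q R by simp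
    finally show ?thesis unfolding P_def Q_def .
  next
    case False
    then have P: "0 < P" unfolding P_def by (simp add: zero_less_measure_iff)
    define a where "a = (\<lambda>i. pmf p i / P)"
    define c where "c = (\<lambda>i. pmf q i / Q)"
    define f where "f = (\<lambda>u. {g u})"
    have resum: "(\<Sum>u<2^k. h (g u)) = (\<Sum>i\<in>G. h i)" for h :: "nat \<Rightarrow> real"
      using sum.reindex_bij_betw[OF g] by simp
    obtain w where b: "blocks a c w k f"
      using blocks_singletons[OF g ratio qpos, of p] P unfolding a_def c_def f_def Ps Qs by blast
    define d where "d = (\<Sum>i\<in>G. max 0 (c i - a i))"
    have dsum: "(d - 4 * \<theta>) / 4 \<le> (\<Sum>l<k. E (pairs l k f) (deficit a c \<theta>))"
      using deficit_sum[OF _ th b] P resum[of "\<lambda>i. max 0 (c i - a i)"] by (simp add: f_def a_def d_def)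
    have a0: "0 \<le> a i" for i using P by (simp add: a_def)
    have le: "E (pairs l k f) (deficit a c \<theta>) * (2 / 9) \<le>
        E (pairs l k f) (\<lambda>(S, S'). trunc (2 / 9 * \<theta>) (bias_gap p q (S \<union> S', S)))" if "l < k" for l
    proof -
      have "E (pairs l k f) (deficit a c \<theta>) * (2 / 9) = E (pairs l k f) (\<lambda>x. deficit a c \<theta> x * (2 / 9))"
        by simp
      also have "\<dots> \<le> E (pairs l k f) (\<lambda>(S, S'). trunc (2 / 9 * \<theta>) (bias_gap p q (S \<union> S', S)))"
      proof (rule expectation_mono_pmf[where B = 1])
        fix x assume x: "x \<in> set_pmf (pairs l k f)"
        obtain S S' where S: "x = (S, S')" by force
        note * = pairs_support[OF b that x[unfolded S]]
        then obtain W where W: "0 < W" "W \<le> sum c S" "sum c S \<le> 2 * W" "W \<le> sum c S'" "sum c S' \<le> 2 * W"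
          by blast
        show "deficit a c \<theta> x * (2 / 9) \<le> (case x of (S, S') \<Rightarrow> trunc (2 / 9 * \<theta>) (bias_gap p q (S \<union> S', S)))"
          using bias_gap_ge_deficit[OF P Q, where S = S and S' = S' and W = W and q = q and p = p and \<theta> = \<theta>] * W by (simp add: S a_def c_def mult.commute)
      next
        fix x :: "nat set \<times> nat set"
        show "\<bar>deficit a c \<theta> x * (2 / 9)\<bar> \<le> 1"
          using deficit_bounds[where a = a and c = c and \<theta> = \<theta> and x = x, OF a0] by (simp add: abs_mult)
        show "\<bar>case x of (S, S') \<Rightarrow> trunc (2 / 9 * \<theta>) (bias_gap p q (S \<union> S', S))\<bar> \<le> 1"
          by (cases x) (simp add: trunc_bounds)
      qed
      finally show ?thesis .
    qed
    have "(d - 4 * \<theta>) / 4 * (2 / 9) \<le> (\<Sum>l<k. E (pairs l k f) (deficit a c \<theta>)) * (2 / 9)"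
      using dsum by (rule mult_right_mono) simp
    also have "\<dots> \<le> ?R"
      unfolding sum_distrib_right f_def[symmetric] by (intro sum_mono le) simp
    finally have 1: "1 / 18 * (d - 4 * \<theta>) \<le> ?R" by simp
    have "(\<Sum>i\<in>G. \<bar>pmf p i - pmf q i\<bar>) \<le> \<bar>P - Q\<bar> + 2 * (Q * d)"
    proof -
      \<comment> \<open>Equal total weights make the sum of absolute differences twice the sum of
        the positive parts.\<close>
      have "(\<Sum>i\<in>G. a i - c i) = 0"
        using P Q by (simp add: a_def c_def sum_subtractf Ps Qs flip: sum_divide_distrib)
      then have "(\<Sum>i\<in>G. \<bar>a i - c i\<bar>) = (\<Sum>i\<in>G. \<bar>a i - c i\<bar>) - (\<Sum>i\<in>G. a i - c i)" by simp
      also have "\<dots> = (\<Sum>i\<in>G. 2 * max 0 (c i - a i))"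
        unfolding sum_subtractf[symmetric] by (intro sum.cong) (auto simp: max_def abs_if)
      finally have ac: "(\<Sum>i\<in>G. \<bar>a i - c i\<bar>) = 2 * d" by (simp add: d_def sum_distrib_left)
      have "(\<Sum>i\<in>G. \<bar>pmf p i - pmf q i\<bar>) \<le> (\<Sum>i\<in>G. a i * \<bar>P - Q\<bar> + Q * \<bar>a i - c i\<bar>)"
      proof (rule sum_mono)
        fix i
        have "pmf p i - pmf q i = a i * (P - Q) + Q * (a i - c i)"
        proof -
          have "pmf p i = P * a i" "pmf q i = Q * c i" using P Q by (simp_all add: a_def c_def)
          then show ?thesis by (simp only:) (simp add: algebra_simps)
        qed
        also have "\<bar>\<dots>\<bar> \<le> \<bar>a i * (P - Q)\<bar> + \<bar>Q * (a i - c i)\<bar>" by (rule abs_triangle_ineq)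
        also have "\<dots> = a i * \<bar>P - Q\<bar> + Q * \<bar>a i - c i\<bar>"
          using Q a0[of i] by (simp add: abs_mult)
        finally show "\<bar>pmf p i - pmf q i\<bar> \<le> a i * \<bar>P - Q\<bar> + Q * \<bar>a i - c i\<bar>" .
      qed
      also have "\<dots> = (\<Sum>i\<in>G. a i) * \<bar>P - Q\<bar> + Q * (\<Sum>i\<in>G. \<bar>a i - c i\<bar>)"
        by (simp add: sum.distrib sum_distrib_left sum_distrib_right)
      also have "(\<Sum>i\<in>G. a i) = 1" using P by (simp add: a_def Ps flip: sum_divide_distrib)
      finally show ?thesis by (simp add: ac)
    qed
    then have "1 / 18 * (((\<Sum>i\<in>G. \<bar>pmf p i - pmf q i\<bar>) - \<bar>P - Q\<bar>) / 2 - 4 * \<theta> * Q) \<le>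
        Q * (1 / 18 * (d - 4 * \<theta>))"
      by (simp add: algebra_simps)
    also have "\<dots> \<le> Q * ?R" using 1 Q by (intro mult_left_mono) auto
    finally show ?thesis unfolding P_def Q_def .
  qed
qed

section \<open>Dyadic covers\<close>

text \<open>\<open>j\<close> assigns a level to each element; level \<open>J\<close> is the light
  tail, and \<open>q\<close> is constant up to a factor 2 on every other level.
  \<open>G t True\<close> and \<open>G t False\<close> may overlap, \<open>g\<close> enumerates them
  as starting blocks, and \<open>D\<close> bounds the number of merging rounds.\<close>

locale dyadic_cover =
  fixes n :: nat and q :: "nat pmf" and \<epsilon> :: real and D J :: nat
    and j :: "nat \<Rightarrow> nat" and G :: "nat \<Rightarrow> bool \<Rightarrow> nat set" and g :: "nat \<Rightarrow> bool \<Rightarrow> nat \<Rightarrow> nat"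
    and k :: "nat \<Rightarrow> nat"
  assumes n: "1 \<le> n" and q: "is_dist n q" and eps: "0 < \<epsilon>" and D: "1 \<le> D"
    and j_le: "\<And>i. i \<in> {1..n} \<Longrightarrow> j i \<le> J"
    and cover: "\<And>t. t < J \<Longrightarrow> G t True \<union> G t False = {i \<in> {1..n}. j i = t}"
    and bij: "\<And>t b. t < J \<Longrightarrow> {i \<in> {1..n}. j i = t} \<noteq> {} \<Longrightarrow> bij_betw (g t b) {..<2 ^ k t} (G t b)"
    and k_le: "\<And>t. t < J \<Longrightarrow> {i \<in> {1..n}. j i = t} \<noteq> {} \<Longrightarrow> k t \<le> D"
    and ratio: "\<And>i i'. i \<in> {1..n} \<Longrightarrow> i' \<in> {1..n} \<Longrightarrow> j i = j i' \<Longrightarrow> j i < J \<Longrightarrow> pmf q i \<le> 2 * pmf q i'"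
    and qpos: "\<And>i. i \<in> {1..n} \<Longrightarrow> j i < J \<Longrightarrow> 0 < pmf q i"
    and tail: "measure_pmf.prob q {i \<in> {1..n}. j i = J} \<le> \<epsilon> / 16"
begin

definition B :: "nat \<Rightarrow> nat set" where
  "B t = {i \<in> {1..n}. j i = t}"

text \<open>Sampling \<open>i\<close> from the known \<open>q\<close> costs no query and selects a
  level with its \<open>q\<close>-mass. The round is uniform below the common bound
  \<open>D\<close>; choices in the tail or beyond the last round of a group yield a query of the
  whole domain, whose bias is always 1.\<close>

definition coins :: "(nat set \<times> nat set) pmf" where
  "coins = bind_pmf q (\<lambda>i. bind_pmf (pmf_of_set UNIV) (\<lambda>b. bind_pmf (pmf_of_set {..<D}) (\<lambda>l.
     if i \<in> {1..n} \<and> j i < J \<and> l < k (j i)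
     then map_pmf (\<lambda>(S, S'). (S \<union> S', S)) (pairs l (k (j i)) (\<lambda>u. {g (j i) b u}))
     else return_pmf ({1..n}, {1..n}))))"

text \<open>The fibres are the atoms of the partition generated by levels and groups. Recording both
  memberships copes with the overlap and makes every group, and the tail, a union of fibres of a
  single level.\<close>

definition lbl :: "nat \<Rightarrow> nat \<times> bool \<times> bool" where
  "lbl i = (j i, i \<in> G (j i) True, i \<in> G (j i) False)"

lemma G_subset: "t < J \<Longrightarrow> G t b \<subseteq> B t"
proof -
  assume t: "t < J"
  have "G t b \<subseteq> G t True \<union> G t False" by (cases b) auto
  then show ?thesis unfolding cover[OF t] B_def .
qed

lemma finite_B [simp]: "finite (B t)" by (simp add: B_def)

lemma finite_G: "t < J \<Longrightarrow> finite (G t b)"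
  by (rule finite_subset[OF G_subset finite_B])

lemma coins_valid:
  assumes "(U, S) \<in> set_pmf coins"
  shows "U \<noteq> {} \<and> U \<subseteq> {1..n}"
proof (cases "U = {1..n}")
  case False
  obtain i b l where mem: "(U, S) \<in> set_pmf (if i \<in> {1..n} \<and> j i < J \<and> l < k (j i)
     then map_pmf (\<lambda>(S, S'). (S \<union> S', S)) (pairs l (k (j i)) (\<lambda>u. {g (j i) b u}))
     else return_pmf ({1..n}, {1..n}))"
    using assms unfolding coins_def set_bind_pmf by blast
  have i: "i \<in> {1..n}" "j i < J" "l < k (j i)"
    using mem False by (auto simp del: atLeastAtMost_iff split: if_splits)
  then obtain T T' where T: "(T, T') \<in> set_pmf (pairs l (k (j i)) (\<lambda>u. {g (j i) b u}))" and U: "U = T \<union> T'"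
    using mem by (auto simp del: atLeastAtMost_iff)
  have ne: "{i' \<in> {1..n}. j i' = j i} \<noteq> {}" using i by blast
  let ?G = "G (j i) b" and ?g = "g (j i) b"
  have bg: "bij_betw ?g {..<2 ^ k (j i)} ?G" by (rule bij[OF i(2) ne])
  have sub: "?G \<subseteq> {1..n}" and jG: "x \<in> ?G \<Longrightarrow> j x = j i" for x
    using G_subset[OF i(2), of b] by (auto simp: B_def)
  have "?g 0 \<in> ?G" using bg by (auto simp: bij_betw_def)
  have pos: "0 < pmf q x" if "x \<in> ?G" for x
    using sub that i(2) jG[OF that] by (intro qpos) auto
  have rat: "pmf q x \<le> 2 * pmf q y" if "x \<in> ?G" "y \<in> ?G" for x y
    using sub that i(2) jG[OF that(1)] jG[OF that(2)] by (intro ratio) auto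
  have "0 < (\<Sum>x\<in>?G. pmf q x)"
    using \<open>?g 0 \<in> ?G\<close> finite_G[OF i(2), of b] pos by (intro sum_pos) auto
  \<comment> \<open>\<open>q\<close> takes both roles here: the purpose is only to learn from
    positive block weights that the drawn blocks are nonempty.\<close>
  then obtain w where "blocks (\<lambda>x. pmf q x / sum (pmf q) ?G) (\<lambda>x. pmf q x / sum (pmf q) ?G) w (k (j i)) (\<lambda>u. {?g u})"
    using blocks_singletons[OF bg rat pos, of q] by blast
  note * = pairs_support[OF this i(3) T]
  then have "T \<noteq> {}" by auto
  moreover have "(\<Union>u<2 ^ k (j i). {?g u}) \<subseteq> ?G" using bg by (auto simp: bij_betw_def)
  moreover have "T \<union> T' \<subseteq> (\<Union>u<2 ^ k (j i). {?g u})" using * by (elim conjE)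
  ultimately show ?thesis unfolding U using sub by (meson Un_empty subset_trans)
next
  case True
  then show ?thesis using n by simp
qed

text \<open>A level is drawn with probability \<open>q (B t)\<close>, which is at least the mass of
  either of its groups; a fixed group and round then have probability 1 / (2 D).\<close>

lemma expectation_coins_ge:
  fixes h :: "nat set \<times> nat set \<Rightarrow> real"
  assumes h: "\<And>x. 0 \<le> h x" "\<And>x. h x \<le> 1"
  shows "(\<Sum>t<J. \<Sum>b\<in>UNIV. measure_pmf.prob q (G t b) *
      (\<Sum>l<k t. E (pairs l (k t) (\<lambda>u. {g t b u})) (\<lambda>(S, S'). h (S \<union> S', S)))) / (2 * real D)
    \<le> E coins h"
proof -
  define R where "R t b = (\<Sum>l<k t. E (pairs l (k t) (\<lambda>u. {g t b u})) (\<lambda>(S, S'). h (S \<union> S', S)))" for t b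
  have R0: "0 \<le> R t b" for t b
    unfolding R_def by (intro sum_nonneg Bochner_Integration.integral_nonneg) (auto simp: h)
  define \<phi> where "\<phi> i = E (pmf_of_set UNIV) (\<lambda>b. E (pmf_of_set {..<D}) (\<lambda>l.
     E (if i \<in> {1..n} \<and> j i < J \<and> l < k (j i)
     then map_pmf (\<lambda>(S, S'). (S \<union> S', S)) (pairs l (k (j i)) (\<lambda>u. {g (j i) b u}))
     else return_pmf ({1..n}, {1..n})) h))" for i
  have \<phi>0: "0 \<le> \<phi> i" for i
    unfolding \<phi>_def by (intro Bochner_Integration.integral_nonneg h)
  have E: "E coins h = E q \<phi>"
    unfolding coins_def \<phi>_def by (simp add: expectation_bind_pmf[where B = 1] h cong: if_cong)
  have \<phi>_ge: "(\<Sum>b\<in>UNIV. R (j i) b) / (2 * real D) \<le> \<phi> i" if i: "i \<in> {1..n}" "j i < J" for i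
  proof -
    have "0 \<in> {..<D}" using D by simp
    then have ne: "{..<D} \<noteq> {}" by blast
    have kD: "k (j i) \<le> D" using k_le[OF i(2)] i by blast
    have inner: "R (j i) b / real D \<le> E (pmf_of_set {..<D}) (\<lambda>l.
       E (if i \<in> {1..n} \<and> j i < J \<and> l < k (j i)
       then map_pmf (\<lambda>(S, S'). (S \<union> S', S)) (pairs l (k (j i)) (\<lambda>u. {g (j i) b u}))
       else return_pmf ({1..n}, {1..n})) h)" (is "_ \<le> E _ ?F") for b
    proof -
      have "R (j i) b = (\<Sum>l<k (j i). ?F l)"
        unfolding R_def using i by (intro sum.cong) (auto simp: case_prod_unfold)
      also have "\<dots> \<le> (\<Sum>l<D. ?F l)"
        using kD by (intro sum_mono2) (auto intro!: Bochner_Integration.integral_nonneg h)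
      finally have "R (j i) b / real D \<le> (\<Sum>l<D. ?F l) / real D" by (rule divide_right_mono) simp
      also have "\<dots> = E (pmf_of_set {..<D}) ?F" using ne by (subst integral_pmf_of_set) auto
      finally show ?thesis .
    qed
    have "(\<Sum>b\<in>UNIV. R (j i) b) / (2 * real D) = (\<Sum>b\<in>UNIV. R (j i) b / real D) / 2"
      by (simp add: sum_divide_distrib mult.commute)
    also have "\<dots> \<le> \<phi> i"
      unfolding \<phi>_def by (subst integral_pmf_of_set) (use inner in \<open>auto intro!: divide_right_mono sum_mono\<close>)
    finally show ?thesis .
  qed
  have "(\<Sum>t<J. \<Sum>b\<in>UNIV. measure_pmf.prob q (G t b) * R t b) / (2 * real D) =
      (\<Sum>t<J. (\<Sum>b\<in>UNIV. measure_pmf.prob q (G t b) * R t b) / (2 * real D))"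
    by (rule sum_divide_distrib)
  also have "\<dots> \<le> (\<Sum>t<J. measure_pmf.prob q (B t) * ((\<Sum>b\<in>UNIV. R t b) / (2 * real D)))"
  proof (rule sum_mono)
    fix t assume "t \<in> {..<J}"
    then have "measure_pmf.prob q (G t b) \<le> measure_pmf.prob q (B t)" for b
      by (intro measure_pmf.finite_measure_mono G_subset) auto
    then have "(\<Sum>b\<in>UNIV. measure_pmf.prob q (G t b) * R t b) / (2 * real D) \<le>
        (\<Sum>b\<in>UNIV. measure_pmf.prob q (B t) * R t b) / (2 * real D)"
      by (intro divide_right_mono sum_mono mult_right_mono R0) auto
    also have "\<dots> = measure_pmf.prob q (B t) * ((\<Sum>b\<in>UNIV. R t b) / (2 * real D))"
      by (simp add: sum_distrib_left)
    finally show "(\<Sum>b\<in>UNIV. measure_pmf.prob q (G t b) * R t b) / (2 * real D) \<le>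
        measure_pmf.prob q (B t) * ((\<Sum>b\<in>UNIV. R t b) / (2 * real D))" .
  qed
  also have "\<dots> = (\<Sum>t<J. \<Sum>i\<in>B t. pmf q i * ((\<Sum>b\<in>UNIV. R (j i) b) / (2 * real D)))"
  proof (intro sum.cong refl)
    fix t
    let ?Y = "\<lambda>t. (\<Sum>b\<in>UNIV. R t b) / (2 * real D)"
    have "(\<Sum>i\<in>B t. pmf q i * ?Y (j i)) = (\<Sum>i\<in>B t. pmf q i * ?Y t)"
      by (intro sum.cong refl) (auto simp: B_def)
    also have "\<dots> = measure_pmf.prob q (B t) * ?Y t"
      by (simp only: measure_measure_pmf_finite finite_B sum_distrib_right)
    finally show "measure_pmf.prob q (B t) * ?Y t = (\<Sum>i\<in>B t. pmf q i * ?Y (j i))" by simp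
  qed
  also have "\<dots> \<le> (\<Sum>t<J. \<Sum>i\<in>B t. pmf q i * \<phi> i)"
    by (intro sum_mono mult_left_mono \<phi>_ge) (auto simp: B_def)
  also have "\<dots> = (\<Sum>i\<in>(\<Union>t<J. B t). pmf q i * \<phi> i)"
    by (rule sum.UNION_disjoint[symmetric]) (auto simp: B_def)
  also have "\<dots> \<le> (\<Sum>i\<in>{1..n}. pmf q i * \<phi> i)"
    by (rule sum_mono2) (auto simp: B_def intro!: mult_nonneg_nonneg \<phi>0)
  also have "\<dots> = E q \<phi>"
    using q by (subst integral_measure_pmf_real[of "{1..n}"]) (auto simp: is_dist_def mult.commute)
  finally show ?thesis unfolding E R_def .
qed

lemma lbl_range: "lbl ` {1..n} \<subseteq> {..J} \<times> UNIV"
proof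
  fix c assume "c \<in> lbl ` {1..n}"
  then obtain i where "i \<in> {1..n}" "c = lbl i" by blast
  then show "c \<in> {..J} \<times> UNIV" using j_le[of i] by (simp add: lbl_def)
qed

text \<open>With nearly correct label masses, the distance must come from inside the groups. Of the
  sum of absolute differences, at least 2 \<epsilon>, the tail and the group masses take only a
  small part. After halving and truncating, at least \<epsilon> / 4 remains, and (1/18) (\<epsilon>
  / 4) / (2 D) is the claimed mean.\<close>

lemma coins_mean:
  assumes p: "is_dist n p" and far: "\<epsilon> \<le> dTV n p q"
    and lab: "(\<Sum>c\<in>{..J} \<times> UNIV. \<bar>measure_pmf.prob p {i \<in> {1..n}. lbl i = c} - measure_pmf.prob q {i \<in> {1..n}. lbl i = c}\<bar>) < \<epsilon> / 4"
  shows "\<epsilon> / (144 * real D) \<le> E coins (\<lambda>x. trunc (\<epsilon> / 144) (bias_gap p q x))"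
proof -
  \<comment> \<open>The groups have total \<open>q\<close>-mass at most 2, two groups per level, so
    truncation at \<epsilon> / 32 costs at most 4 * 2 * \<epsilon> / 32 = \<epsilon> / 4; the factor
    2/9 turns it into the coin threshold \<epsilon> / 144.\<close>
  define \<theta> where "\<theta> = \<epsilon> / 32"
  define e where "e c = \<bar>measure_pmf.prob p {i \<in> {1..n}. lbl i = c} - measure_pmf.prob q {i \<in> {1..n}. lbl i = c}\<bar>" for c
  define s where "s t = (\<Sum>x\<in>UNIV. e (t, x))" for t
  define R where "R t b = (\<Sum>l<k t. E (pairs l (k t) (\<lambda>u. {g t b u}))
      (\<lambda>(S, S'). trunc (\<epsilon> / 144) (bias_gap p q (S \<union> S', S))))" for t b
  have th: "0 \<le> \<theta>" and tt: "2 / 9 * \<theta> = \<epsilon> / 144" using eps by (simp_all add: \<theta>_def)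
  have s_sum: "(\<Sum>t\<le>J. s t) < \<epsilon> / 4"
    using lab sum.cartesian_product[of "\<lambda>t x. e (t, x)" UNIV "{..J}"] by (simp add: s_def e_def)
  have s0: "0 \<le> s t" for t unfolding s_def by (intro sum_nonneg) (auto simp: e_def)
  have union: "\<bar>measure_pmf.prob p A - measure_pmf.prob q A\<bar> \<le> s t"
    if A: "A = {i \<in> {1..n}. lbl i \<in> L}" and L: "L \<subseteq> {t} \<times> UNIV" for A L t
  proof -
    have finL: "finite L" using L finite_subset[of L "{t} \<times> UNIV"] by simp
    have dec: "measure_pmf.prob r A = (\<Sum>c\<in>L. measure_pmf.prob r {i \<in> {1..n}. lbl i = c})" for r :: "nat pmf"
    proof -
      have "A = (\<Union>c\<in>L. {i \<in> {1..n}. lbl i = c})" using A by blast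
      then show ?thesis
        using finL by (simp only:) (intro measure_pmf.finite_measure_finite_Union, auto simp: disjoint_family_on_def)
    qed
    have "\<bar>measure_pmf.prob p A - measure_pmf.prob q A\<bar> \<le> (\<Sum>c\<in>L. e c)"
      unfolding dec sum_subtractf[symmetric] e_def by (rule sum_abs)
    also have "\<dots> \<le> (\<Sum>c\<in>{t} \<times> UNIV. e c)" by (rule sum_mono2) (use L in \<open>auto simp: e_def\<close>)
    also have "\<dots> = s t"
      using sum.cartesian_product[of "\<lambda>t x. e (t, x)" UNIV "{t}"] by (simp add: s_def)
    finally show ?thesis .
  qed
  have eG: "\<bar>measure_pmf.prob p (G t b) - measure_pmf.prob q (G t b)\<bar> \<le> s t" if t: "t < J" for t b
  proof (cases b)
    case True
    have "G t True = {i \<in> {1..n}. lbl i \<in> {t} \<times> {True} \<times> UNIV}"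
      using G_subset[OF t, of True] by (auto simp: lbl_def B_def)
    from union[OF this] True show ?thesis by auto
  next
    case False
    have "G t False = {i \<in> {1..n}. lbl i \<in> {t} \<times> UNIV \<times> {True}}"
      using G_subset[OF t, of False] by (auto simp: lbl_def B_def)
    from union[OF this] False show ?thesis by auto
  qed
  have eB: "\<bar>measure_pmf.prob p (B J) - measure_pmf.prob q (B J)\<bar> \<le> s J"
    by (rule union[of _ "{J} \<times> UNIV"]) (auto simp: B_def lbl_def)
  define d where "d A = (\<Sum>i\<in>A. \<bar>pmf p i - pmf q i\<bar>)" for A
  have d0: "0 \<le> d A" for A unfolding d_def by (intro sum_nonneg) auto
  have Bun: "{1..n} = (\<Union>t\<le>J. B t)" using j_le by (auto simp: B_def)
  have dist: "2 * \<epsilon> \<le> d {1..n}" using far by (simp add: dTV_def d_def)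
  have "d {1..n} = (\<Sum>t\<le>J. d (B t))"
    unfolding Bun d_def by (rule sum.UNION_disjoint) (auto simp: B_def)
  also have "\<dots> = (\<Sum>t<J. d (B t)) + d (B J)"
    by (simp add: lessThan_Suc_atMost[symmetric])
  finally have d1: "2 * \<epsilon> \<le> (\<Sum>t<J. d (B t)) + d (B J)" using dist by simp
  \<comment> \<open>Inside the tail only total masses are compared: that of \<open>q\<close> is at
    most \<epsilon> / 16, and that of \<open>p\<close> exceeds it by at most
    \<open>s J\<close>.\<close>
  have "d (B J) \<le> (\<Sum>i\<in>B J. pmf p i + pmf q i)"
    unfolding d_def by (intro sum_mono) (auto simp: abs_le_iff intro: add_increasing add_increasing2)
  also have "\<dots> = measure_pmf.prob p (B J) + measure_pmf.prob q (B J)"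
    by (simp add: sum.distrib measure_measure_pmf_finite)
  finally have dJ: "d (B J) \<le> s J + \<epsilon> / 8" using eB tail by (simp add: B_def[of J] abs_le_iff)
  have dB: "d (B t) \<le> d (G t True) + d (G t False)" if "t < J" for t
  proof -
    have "B t = G t True \<union> G t False" using cover[OF that] by (simp add: B_def)
    then have "d (B t) + d (G t True \<inter> G t False) = d (G t True) + d (G t False)"
      unfolding d_def using finite_G[OF that] by (simp add: sum.union_inter)
    then show ?thesis using d0[of "G t True \<inter> G t False"] by linarith
  qed
  have "(\<Sum>t<J. measure_pmf.prob q (B t)) \<le> 1"
  proof -
    have "(\<Sum>t<J. measure_pmf.prob q (B t)) = measure_pmf.prob q (\<Union>t<J. B t)"
      by (rule measure_pmf.finite_measure_finite_Union[symmetric]) (auto simp: disjoint_family_on_def B_def)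
    then show ?thesis by simp
  qed
  then have qsum: "(\<Sum>t<J. \<Sum>b\<in>UNIV. measure_pmf.prob q (G t b)) \<le> 2"
  proof -
    assume 1: "(\<Sum>t<J. measure_pmf.prob q (B t)) \<le> 1"
    have "(\<Sum>t<J. \<Sum>b\<in>(UNIV :: bool set). measure_pmf.prob q (G t b)) \<le>
        (\<Sum>t<J. \<Sum>b\<in>(UNIV :: bool set). measure_pmf.prob q (B t))"
      by (intro sum_mono measure_pmf.finite_measure_mono G_subset) auto
    also have "\<dots> = 2 * (\<Sum>t<J. measure_pmf.prob q (B t))" by (simp add: sum_distrib_left)
    finally show ?thesis using 1 by simp
  qed
  have group: "1 / 18 * ((d (G t b) - s t) / 2 - 4 * \<theta> * measure_pmf.prob q (G t b)) \<le>
      measure_pmf.prob q (G t b) * R t b" if t: "t < J" for t b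
  proof (cases "B t = {}")
    case True
    then have "G t b = {}" using G_subset[OF t, of b] by blast
    then show ?thesis using s0[of t] by (simp add: d_def)
  next
    case False
    then have ne: "{i \<in> {1..n}. j i = t} \<noteq> {}" by (simp add: B_def)
    have mem: "x \<in> {1..n} \<and> j x = t" if "x \<in> G t b" for x
      using that G_subset[OF t, of b] by (auto simp: B_def)
    have "1 / 18 * (((\<Sum>i\<in>G t b. \<bar>pmf p i - pmf q i\<bar>) - \<bar>measure_pmf.prob p (G t b) - measure_pmf.prob q (G t b)\<bar>) / 2
      - 4 * \<theta> * measure_pmf.prob q (G t b)) \<le> measure_pmf.prob q (G t b) * R t b"
      unfolding R_def tt[symmetric]
    proof (rule group_gap[OF bij[OF t ne] _ _ th])
      show "pmf q x \<le> 2 * pmf q y" if "x \<in> G t b" "y \<in> G t b" for x y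
        using mem[OF that(1)] mem[OF that(2)] t by (intro ratio) auto
      show "0 < pmf q x" if "x \<in> G t b" for x using mem[OF that] t by (intro qpos) auto
    qed
    moreover have "d (G t b) - s t \<le>
        (\<Sum>i\<in>G t b. \<bar>pmf p i - pmf q i\<bar>) - \<bar>measure_pmf.prob p (G t b) - measure_pmf.prob q (G t b)\<bar>"
      using eG[OF t, of b] by (simp add: d_def)
    ultimately show ?thesis by argo
  qed
  have "1 / 18 * (\<epsilon> / 4) \<le> (\<Sum>t<J. \<Sum>b\<in>UNIV. 1 / 18 * ((d (G t b) - s t) / 2 - 4 * \<theta> * measure_pmf.prob q (G t b)))"
  proof -
    have "(\<Sum>t<J. d (B t)) \<le> (\<Sum>t<J. \<Sum>b\<in>UNIV. d (G t b))"
      by (intro sum_mono) (use dB in \<open>simp add: UNIV_bool add.commute\<close>)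
    then have "2 * \<epsilon> \<le> (\<Sum>t<J. \<Sum>b\<in>UNIV. d (G t b)) + s J + \<epsilon> / 8" using d1 dJ by linarith
    moreover have "(\<Sum>t<J. s t) + s J < \<epsilon> / 4"
      using s_sum by (simp add: lessThan_Suc_atMost[symmetric])
    moreover have "4 * \<theta> * (\<Sum>t<J. \<Sum>b\<in>UNIV. measure_pmf.prob q (G t b)) \<le> 4 * \<theta> * 2"
      using qsum th by (intro mult_left_mono) auto
    moreover have "0 \<le> (\<Sum>t<J. s t)" by (intro sum_nonneg s0)
    ultimately have "\<epsilon> / 4 \<le> ((\<Sum>t<J. \<Sum>b\<in>UNIV. d (G t b)) - 2 * (\<Sum>t<J. s t)) / 2 -
         4 * \<theta> * (\<Sum>t<J. \<Sum>b\<in>UNIV. measure_pmf.prob q (G t b))"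
      using s0[of J] eps unfolding \<theta>_def by argo
    also have "\<dots> = (\<Sum>t<J. \<Sum>b\<in>UNIV. (d (G t b) - s t) / 2 - 4 * \<theta> * measure_pmf.prob q (G t b))"
    proof -
      have "(\<Sum>t<J. \<Sum>b\<in>(UNIV :: bool set). s t) = 2 * (\<Sum>t<J. s t)"
        by (simp add: sum_distrib_left)
      then show ?thesis
        by (simp only: sum_subtractf sum_divide_distrib[symmetric] sum_distrib_left[symmetric])
    qed
    finally show ?thesis
      by (simp only: sum_distrib_left[symmetric])
  qed
  also have "\<dots> \<le> (\<Sum>t<J. \<Sum>b\<in>UNIV. measure_pmf.prob q (G t b) * R t b)"
    by (intro sum_mono group) simp
  finally have "1 / 18 * (\<epsilon> / 4) / (2 * real D) \<le> (\<Sum>t<J. \<Sum>b\<in>UNIV. measure_pmf.prob q (G t b) * R t b) / (2 * real D)"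
    by (rule divide_right_mono) simp
  also have "\<dots> \<le> E coins (\<lambda>x. trunc (\<epsilon> / 144) (bias_gap p q x))"
    unfolding R_def by (rule expectation_coins_ge) (auto simp: trunc_bounds)
  finally show ?thesis by (simp add: mult.commute)
qed

end

section \<open>The identity tester\<close>

text \<open>For the largest power of two not exceeding the size of \<open>B\<close>, the complement
  of \<open>G1\<close> has fewer than \<open>2 ^ k\<close> elements and is padded with elements of
  \<open>G1\<close>.\<close>

lemma dyadic_pair_cover:
  assumes "finite B" "B \<noteq> {}"
  shows "\<exists>k G1 G2. card G1 = 2 ^ k \<and> card G2 = 2 ^ k \<and> G1 \<union> G2 = B \<and> (2::nat) ^ k \<le> card B"
proof -
  have "1 \<le> card B" using assms by (simp add: Suc_le_eq card_gt_0_iff)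
  then obtain k where k: "2 ^ k \<le> card B" "card B < 2 ^ (k + 1)"
    using ex_power_ivl1[of 2 "card B"] by auto
  obtain G1 where G1: "G1 \<subseteq> B" "card G1 = 2 ^ k" "finite G1"
    using obtain_subset_with_card_n[OF k(1)] by blast
  have c: "card (B - G1) = card B - 2 ^ k" using G1 assms by (simp add: card_Diff_subset)
  then have "2 ^ k - card (B - G1) \<le> card G1" using G1 by simp
  then obtain R where R: "R \<subseteq> G1" "card R = 2 ^ k - card (B - G1)" "finite R"
    using obtain_subset_with_card_n by blast
  have "card ((B - G1) \<union> R) = card (B - G1) + card R"
    using assms R by (intro card_Un_disjoint) auto
  then have "card ((B - G1) \<union> R) = 2 ^ k" using R c k by simp
  moreover have "G1 \<union> ((B - G1) \<union> R) = B" using G1 R by blast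
  ultimately show ?thesis using G1 k(1) by blast
qed

lemma power_two_floor_log:
  fixes x :: real
  assumes "0 < x" "x \<le> 1"
  shows "x \<le> (1/2) ^ nat \<lfloor>- log 2 x\<rfloor>" and "(1/2) ^ nat \<lfloor>- log 2 x\<rfloor> \<le> 2 * x"
proof -
  define t where "t = nat \<lfloor>- log 2 x\<rfloor>"
  have "0 \<le> - log 2 x" using assms by simp
  then have t: "real t \<le> - log 2 x" "- log 2 x < real t + 1" unfolding t_def by linarith+
  have x: "x = 2 powr log 2 x" using assms by simp
  have h: "(1/2) ^ t = (2::real) powr (- real t)"
    by (simp add: powr_minus powr_realpow power_divide inverse_eq_divide)
  have "2 powr log 2 x \<le> 2 powr (- real t)" using t(1) by (intro powr_mono) auto
  then show "x \<le> (1/2) ^ nat \<lfloor>- log 2 x\<rfloor>" unfolding t_def[symmetric] h using x by simp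
  have "2 powr (- real t) \<le> 2 powr (1 + log 2 x)" using t(2) by (intro powr_mono) auto
  then show "(1/2) ^ nat \<lfloor>- log 2 x\<rfloor> \<le> 2 * x"
    unfolding t_def[symmetric] h using x by (simp add: powr_add)
qed

lemma dyadic_cover_exists:
  assumes n: "2 \<le> n" and eps: "0 < \<epsilon>" "\<epsilon> < 1" and q: "is_dist n q"
  shows "\<exists>j G g k. dyadic_cover n q \<epsilon> (nat \<lfloor>log 2 (real n)\<rfloor>) (nat \<lfloor>log 2 (16 * real n / \<epsilon>)\<rfloor> + 1) j G g k"
proof -
  define D where "D = nat \<lfloor>log 2 (real n)\<rfloor>"
  define J where "J = nat \<lfloor>log 2 (16 * real n / \<epsilon>)\<rfloor> + 1"
  \<comment> \<open>At most \<open>n\<close> elements lie below this cutoff, so the tail weighs at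
    most \<epsilon> / 16.\<close>
  define s where "s = \<epsilon> / (16 * real n)"
  define j where "j i = (if pmf q i \<le> s then J else nat \<lfloor>- log 2 (pmf q i)\<rfloor>)" for i
  have s0: "0 < s" using eps n by (simp add: s_def)
  have j_lt: "j i < J" if "\<not> pmf q i \<le> s" for i
  proof -
    have "log 2 s \<le> log 2 (pmf q i)" using that s0 by simp
    moreover have "log 2 s = - log 2 (16 * real n / \<epsilon>)" using eps n by (simp add: s_def log_divide)
    ultimately have "- log 2 (pmf q i) \<le> log 2 (16 * real n / \<epsilon>)" by linarith
    then have "nat \<lfloor>- log 2 (pmf q i)\<rfloor> \<le> nat \<lfloor>log 2 (16 * real n / \<epsilon>)\<rfloor>"
      by (intro nat_mono floor_mono)
    then show ?thesis using that by (simp add: j_def J_def)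
  qed
  have jJ: "j i < J \<longleftrightarrow> \<not> pmf q i \<le> s" for i using j_lt[of i] by (auto simp: j_def)
  have n1: "1 \<le> log 2 (real n)" using n by (simp add: le_log_iff)
  have ex: "\<exists>x. case x of (k, G, g) \<Rightarrow> G True \<union> G False = {i \<in> {1..n}. j i = t} \<and>
      ({i \<in> {1..n}. j i = t} \<noteq> {} \<longrightarrow> k \<le> D \<and> (\<forall>b. bij_betw (g b) {..<(2::nat) ^ k} (G b)))"
    for t :: nat
  proof (cases "{i \<in> {1..n}. j i = t} = {}")
    case True
    then show ?thesis by (intro exI[of _ "(0, \<lambda>_. {}, \<lambda>_ _. 0)"]) simp
  next
    case False
    let ?B = "{i \<in> {1..n}. j i = t}"
    have fin: "finite ?B" by simp
    obtain k G1 G2 where G: "card G1 = 2 ^ k" "card G2 = 2 ^ k" "G1 \<union> G2 = ?B" "(2::nat) ^ k \<le> card ?B"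
      using dyadic_pair_cover[OF fin False] by blast
    have "finite G1" "finite G2" using G(3) fin by (metis finite_Un)+
    then obtain g1 g2 :: "nat \<Rightarrow> nat" where g: "bij_betw g1 {..<2 ^ k} G1" "bij_betw g2 {..<2 ^ k} G2"
      using ex_bij_betw_nat_finite[of G1] ex_bij_betw_nat_finite[of G2] G(1,2)
      by (auto simp: atLeast0LessThan)
    have "card ?B \<le> card {1..n}" by (intro card_mono) auto
    then have "(2::nat) ^ k \<le> n" using G(4) by simp
    then have "(2::real) ^ k \<le> real n" by (metis of_nat_le_iff of_nat_numeral of_nat_power)
    then have "real k \<le> log 2 (real n)" using n by (simp add: le_log_iff powr_realpow)
    then have "k \<le> D" unfolding D_def by linarith
    then show ?thesis
      using G(3) g by (intro exI[of _ "(k, \<lambda>b. if b then G1 else G2, \<lambda>b. if b then g1 else g2)"]) simp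
  qed
  define X where "X t = (SOME x. case x of (k, G, g) \<Rightarrow> G True \<union> G False = {i \<in> {1..n}. j i = t} \<and>
      ({i \<in> {1..n}. j i = t} \<noteq> {} \<longrightarrow> k \<le> D \<and> (\<forall>b. bij_betw (g b) {..<(2::nat) ^ k} (G b))))" for t
  have X: "case X t of (k, G, g) \<Rightarrow> G True \<union> G False = {i \<in> {1..n}. j i = t} \<and>
      ({i \<in> {1..n}. j i = t} \<noteq> {} \<longrightarrow> k \<le> D \<and> (\<forall>b. bij_betw (g b) {..<(2::nat) ^ k} (G b)))" for t
    unfolding X_def by (rule someI_ex[OF ex])
  define k where "k t = fst (X t)" for t
  define G where "G t = fst (snd (X t))" for t
  define g where "g t = snd (snd (X t))" for t
  have X1: "G t True \<union> G t False = {i \<in> {1..n}. j i = t}"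
    and X2: "{i \<in> {1..n}. j i = t} \<noteq> {} \<Longrightarrow> k t \<le> D"
    and X3: "{i \<in> {1..n}. j i = t} \<noteq> {} \<Longrightarrow> bij_betw (g t b) {..<2 ^ k t} (G t b)" for t b
    using X[of t] unfolding k_def G_def g_def case_prod_unfold by blast+
  have "dyadic_cover n q \<epsilon> D J j G g k"
  proof
    show "1 \<le> n" "is_dist n q" "0 < \<epsilon>" using n q eps by auto
    show "1 \<le> D" unfolding D_def using n1 by linarith
    show "j i \<le> J" for i using j_lt[of i] by (cases "pmf q i \<le> s") (auto simp: j_def less_imp_le)
    show "G t True \<union> G t False = {i \<in> {1..n}. j i = t}" for t by (rule X1)
    show "bij_betw (g t b) {..<2 ^ k t} (G t b)" if "{i \<in> {1..n}. j i = t} \<noteq> {}" for t b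
      using X3[OF that] .
    show "k t \<le> D" if "{i \<in> {1..n}. j i = t} \<noteq> {}" for t using X2[OF that] .
    show "0 < pmf q i" if "j i < J" for i using that s0 unfolding jJ by linarith
    show "pmf q i \<le> 2 * pmf q i'" if ij: "j i = j i'" "j i < J" for i i'
    proof -
      have big: "\<not> pmf q i \<le> s" "\<not> pmf q i' \<le> s" using ij jJ by metis+
      then have "pmf q i \<le> (1/2) ^ j i" using s0 power_two_floor_log(1)[of "pmf q i"]
        by (simp add: j_def pmf_le_1)
      also have "\<dots> \<le> 2 * pmf q i'" unfolding ij(1)
        using s0 big power_two_floor_log(2)[of "pmf q i'"] by (simp add: j_def pmf_le_1)
      finally show ?thesis .
    qed
    show "measure_pmf.prob q {i \<in> {1..n}. j i = J} \<le> \<epsilon> / 16"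
    proof -
      have "measure_pmf.prob q {i \<in> {1..n}. j i = J} = (\<Sum>i\<in>{i \<in> {1..n}. j i = J}. pmf q i)"
        by (rule measure_measure_pmf_finite) simp
      also have "\<dots> \<le> (\<Sum>i\<in>{i \<in> {1..n}. j i = J}. s)"
        by (intro sum_mono) (metis (mono_tags, lifting) jJ less_irrefl mem_Collect_eq)
      also have "\<dots> \<le> (\<Sum>i\<in>{1..n}. s)" using s0 by (intro sum_mono2) auto
      also have "\<dots> = \<epsilon> / 16" using n by (simp add: s_def)
      finally show ?thesis .
    qed
  qed
  then show ?thesis unfolding D_def J_def by blast
qed

text \<open>A far distribution either shows label masses off by \<epsilon> / 4 in total, or gives
  the coins the mean gap of \<open>coins_mean\<close>. Both testers must accept, so one of them
  rejecting is enough; on \<open>q\<close> the product of two factors 11/12 still exceeds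
  2/3.\<close>

lemma identity_tester_exists:
  assumes n2: "2 \<le> n" and eps1: "0 < \<epsilon>" "\<epsilon> < 1" and qd: "is_dist n q"
  defines "L \<equiv> log 2 (real n / \<epsilon>)"
  shows "\<exists>A. valid_alg n (325000000 * L * (1 + ln L) / \<epsilon>\<^sup>2) A \<and> correct_tester n \<epsilon> (1/3) q A"
proof -
  define D where "D = nat \<lfloor>log 2 (real n)\<rfloor>"
  define J where "J = nat \<lfloor>log 2 (16 * real n / \<epsilon>)\<rfloor> + 1"
  obtain j G g k where cov: "dyadic_cover n q \<epsilon> D J j G g k"
    using dyadic_cover_exists[OF n2 eps1 qd] unfolding D_def J_def by blast
  interpret dyadic_cover n q \<epsilon> D J j G g k by (rule cov)
  have L1: "1 \<le> L"
  proof -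
    have "2 * \<epsilon> \<le> real n" using n2 eps1 by linarith
    then show ?thesis using eps1 n2 by (simp add: L_def le_log_iff field_simps)
  qed
  have lnL: "0 \<le> ln L" using L1 by simp
  have D_L: "real D \<le> L"
  proof -
    have "real n * \<epsilon> \<le> real n * 1" using eps1 by (intro mult_left_mono) auto
    then have "log 2 (real n) \<le> L" unfolding L_def using n2 eps1 by (simp add: field_simps)
    moreover have "0 \<le> log 2 (real n)" using n2 by simp
    ultimately show ?thesis unfolding D_def by linarith
  qed
  have J_L: "real (J + 1) \<le> 7 * L"
  proof -
    have "log 2 (16 * real n / \<epsilon>) = log 2 (2 ^ 4) + L"
      using n2 eps1 unfolding L_def by (subst log_mult_pos[symmetric]) (auto simp: field_simps)
    moreover have "log 2 ((2::real) ^ 4) = real 4" by (rule log_pow_cancel) auto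
    ultimately have "log 2 (16 * real n / \<epsilon>) = 4 + L" by linarith
    then show ?thesis unfolding J_def using L1 by linarith
  qed
  \<comment> \<open>\<open>r = 1 / (8 * D)\<close> is chosen so that \<open>8 * t * r\<close> is the
    mean \<epsilon> / (144 D) of \<open>coins_mean\<close>.\<close>
  obtain A1 where A1: "valid_alg n (480 * (1 + ln (1 / (1 / (8 * real D)))) / (1 / (8 * real D) * (\<epsilon> / 144)\<^sup>2)) A1"
      "11/12 \<le> accept_prob A1 q"
    and A1s: "\<And>p. 8 * (\<epsilon> / 144) * (1 / (8 * real D)) \<le> E coins (\<lambda>x. if \<epsilon> / 144 \<le> bias_gap p q x then bias_gap p q x else 0)
      \<Longrightarrow> accept_prob A1 p \<le> 1/4"
    using multilevel_tester[of "\<epsilon> / 144" "1 / (8 * real D)" coins n q] coins_valid eps1 D by auto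
  have "card ({..J} \<times> (UNIV :: (bool \<times> bool) set)) = 4 * (J + 1)"
    by (simp add: card_cartesian_product card_UNIV_bool flip: UNIV_Times_UNIV)
  then have cI: "real (card ({..J} \<times> (UNIV :: (bool \<times> bool) set))) \<le> 28 * L" using J_L by simp
  obtain A2 where A2: "valid_alg n (14080 * (28 * L) / (\<epsilon> / 4)\<^sup>2) A2" "11/12 \<le> accept_prob A2 q"
    and A2s: "\<And>p. is_dist n p \<Longrightarrow> \<epsilon> / 4 \<le> (\<Sum>c\<in>{..J} \<times> UNIV. \<bar>measure_pmf.prob p {i \<in> {1..n}. lbl i = c} - measure_pmf.prob q {i \<in> {1..n}. lbl i = c}\<bar>)
      \<Longrightarrow> accept_prob A2 p \<le> 1/4"
    using label_tester[of n q "{..J} \<times> UNIV" lbl "28 * L" "\<epsilon> / 4"] n q lbl_range cI eps1 L1 by auto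
  have "valid_alg n (480 * (1 + ln (1 / (1 / (8 * real D)))) / (1 / (8 * real D) * (\<epsilon> / 144)\<^sup>2) +
      14080 * (28 * L) / (\<epsilon> / 4)\<^sup>2) (and_alg A1 A2)"
    by (rule valid_and_alg[OF A1(1) A2(1)])
  moreover have "480 * (1 + ln (1 / (1 / (8 * real D)))) / (1 / (8 * real D) * (\<epsilon> / 144)\<^sup>2) +
      14080 * (28 * L) / (\<epsilon> / 4)\<^sup>2 \<le> 325000000 * L * (1 + ln L) / \<epsilon>\<^sup>2"
  proof -
    have "ln (8 * real D) \<le> ln (8 * L)" using D_L D L1 by simp
    moreover have "ln (8 * L) = ln 8 + ln L" using L1 by (simp add: ln_mult)
    moreover have "ln (8::real) \<le> 3"
    proof -
      have "(2::real) ^ 3 \<le> exp 1 ^ 3" by (rule power_mono) (use exp_ge_add_one_self[of 1] in auto)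
      then have "8 \<le> exp (3::real)" by (simp flip: exp_of_nat_mult)
      then show ?thesis using ln_mono[of 8 "exp 3 :: real"] by simp
    qed
    ultimately have "1 + ln (8 * real D) \<le> 4 * (1 + ln L)" using lnL by argo
    moreover have "0 \<le> 1 + ln (8 * real D)" using D by simp
    ultimately have "real D * (1 + ln (8 * real D)) \<le> L * (4 * (1 + ln L))"
      using D_L D L1 by (intro mult_mono) auto
    moreover have "L * 1 \<le> L * (1 + ln L)" using L1 lnL by (intro mult_left_mono) auto
    \<comment> \<open>79626240 = 480 * 8 * 144^2 and 6307840 = 14080 * 28 * 16; four times the first
      plus the second is below 325000000.\<close>
    ultimately have "79626240 * (real D * (1 + ln (8 * real D))) + 6307840 * L \<le> 325000000 * (L * (1 + ln L))"
      using mult_nonneg_nonneg[of L "1 + ln L"] L1 lnL by argo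
    then have "(79626240 * (real D * (1 + ln (8 * real D))) + 6307840 * L) / \<epsilon>\<^sup>2 \<le> 325000000 * (L * (1 + ln L)) / \<epsilon>\<^sup>2"
      by (rule divide_right_mono) simp
    moreover have "480 * (1 + ln (1 / (1 / (8 * real D)))) / (1 / (8 * real D) * (\<epsilon> / 144)\<^sup>2) =
        79626240 * (real D * (1 + ln (8 * real D))) / \<epsilon>\<^sup>2"
      using eps D by (simp add: power_divide)
    moreover have "14080 * (28 * L) / (\<epsilon> / 4)\<^sup>2 = 6307840 * L / \<epsilon>\<^sup>2"
      by (simp add: power_divide)
    ultimately show ?thesis by (simp only: add_divide_distrib mult.assoc)
  qed
  ultimately have "valid_alg n (325000000 * L * (1 + ln L) / \<epsilon>\<^sup>2) (and_alg A1 A2)"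
    by (rule valid_alg_mono)
  moreover have "correct_tester n \<epsilon> (1/3) q (and_alg A1 A2)"
    unfolding correct_tester_def accept_prob_and_alg
  proof (intro allI impI conjI)
    fix p assume p: "is_dist n p"
    show "1 - 1/3 \<le> accept_prob A1 p * accept_prob A2 p" if "p = q"
    proof -
      have "11/12 * (11/12) \<le> accept_prob A1 p * accept_prob A2 p"
        using A1(2) A2(2) that by (intro mult_mono) auto
      then show ?thesis by simp
    qed
    assume far: "\<epsilon> \<le> dTV n p q"
    have "accept_prob A1 p \<le> 1/4 \<or> accept_prob A2 p \<le> 1/4"
    proof (cases "\<epsilon> / 4 \<le> (\<Sum>c\<in>{..J} \<times> UNIV. \<bar>measure_pmf.prob p {i \<in> {1..n}. lbl i = c} - measure_pmf.prob q {i \<in> {1..n}. lbl i = c}\<bar>)")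
      case True
      then show ?thesis using A2s[OF p] by blast
    next
      case False
      then have "\<epsilon> / (144 * real D) \<le> E coins (\<lambda>x. trunc (\<epsilon> / 144) (bias_gap p q x))"
        using coins_mean[OF p far] by simp
      then show ?thesis using A1s[of p] by (simp add: trunc_def mult.commute)
    qed
    then have "accept_prob A1 p * accept_prob A2 p \<le> 1/4"
    proof
      assume "accept_prob A1 p \<le> 1/4"
      then have "accept_prob A1 p * accept_prob A2 p \<le> 1/4 * 1"
        by (intro mult_mono accept_prob_bounds) auto
      then show ?thesis by simp
    next
      assume "accept_prob A2 p \<le> 1/4"
      then have "accept_prob A1 p * accept_prob A2 p \<le> 1 * (1/4)"
        by (intro mult_mono accept_prob_bounds) auto
      then show ?thesis by simp
    qed
    then show "1 - 1/3 \<le> 1 - accept_prob A1 p * accept_prob A2 p" by simp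
  qed
  ultimately show ?thesis by blast
qed

section \<open>Second moments of likelihood ratios\<close>

text \<open>Cauchy-Schwarz with the likelihood ratio \<open>r\<close> restricted to one query set.
  Its second moment relative to its squared mean is 1 plus variance over squared mean; the deviation
  is at most \<beta> - \<alpha> and the mean at least \<alpha>, whatever the set.\<close>

lemma weighted_second_moment:
  fixes r W \<psi> :: "nat \<Rightarrow> real"
  assumes S: "finite S" and W: "\<And>i. i \<in> S \<Longrightarrow> 0 \<le> W i" "0 < (\<Sum>i\<in>S. W i)"
    and r: "0 < \<alpha>" "\<And>i. i \<in> S \<Longrightarrow> \<alpha> \<le> r i \<and> r i \<le> \<beta>"
  shows "((\<Sum>i\<in>S. \<psi> i * (r i * W i)) / (\<Sum>i\<in>S. r i * W i))\<^sup>2 \<le>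
    (1 + (\<beta> - \<alpha>)\<^sup>2 / \<alpha>\<^sup>2) * ((\<Sum>i\<in>S. (\<psi> i)\<^sup>2 * W i) / (\<Sum>i\<in>S. W i))"
proof -
  define Q where "Q = (\<Sum>i\<in>S. W i)"
  define P where "P = (\<Sum>i\<in>S. r i * W i)"
  define V where "V = (\<Sum>i\<in>S. (r i)\<^sup>2 * W i)"
  define Y where "Y = (\<Sum>i\<in>S. (\<psi> i)\<^sup>2 * W i)"
  have Q: "0 < Q" using W by (simp add: Q_def)
  have lo: "\<alpha> * Q \<le> P" unfolding Q_def P_def sum_distrib_left
    using r W by (intro sum_mono mult_right_mono) auto
  have hi: "P \<le> \<beta> * Q" unfolding Q_def P_def sum_distrib_left
    using r W by (intro sum_mono mult_right_mono) auto
  have P: "0 < P" using lo r Q by (meson less_le_trans mult_pos_pos)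
  have Y: "0 \<le> Y" unfolding Y_def using W by (intro sum_nonneg) auto
  have "(\<Sum>i\<in>S. \<psi> i * (r i * W i))\<^sup>2 = (\<Sum>i\<in>S. (\<psi> i * sqrt (W i)) * (r i * sqrt (W i)))\<^sup>2"
    using W by (intro arg_cong[where f = "\<lambda>x. x\<^sup>2"] sum.cong) auto
  also have "\<dots> \<le> (\<Sum>i\<in>S. (\<psi> i * sqrt (W i))\<^sup>2) * (\<Sum>i\<in>S. (r i * sqrt (W i))\<^sup>2)"
    by (rule Cauchy_Schwarz_ineq_sum)
  also have "\<dots> = Y * V"
    unfolding Y_def V_def using W by (intro arg_cong2[where f = "(*)"] sum.cong) (auto simp: power_mult_distrib)
  finally have CS: "(\<Sum>i\<in>S. \<psi> i * (r i * W i))\<^sup>2 \<le> Y * V" .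
  have "(\<Sum>i\<in>S. (r i - P / Q)\<^sup>2 * W i) \<le> (\<Sum>i\<in>S. (\<beta> - \<alpha>)\<^sup>2 * W i)"
  proof (intro sum_mono mult_right_mono W)
    fix i assume i: "i \<in> S"
    have "\<alpha> \<le> P / Q" "P / Q \<le> \<beta>" using lo hi Q by (simp_all add: field_simps)
    then have "\<bar>r i - P / Q\<bar> \<le> \<bar>\<beta> - \<alpha>\<bar>" using r(2)[OF i] by linarith
    then show "(r i - P / Q)\<^sup>2 \<le> (\<beta> - \<alpha>)\<^sup>2" by (simp only: abs_le_square_iff)
  qed
  also have "\<dots> = (\<beta> - \<alpha>)\<^sup>2 * Q" by (simp add: Q_def sum_distrib_left)
  also have "(\<Sum>i\<in>S. (r i - P / Q)\<^sup>2 * W i) =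
      (\<Sum>i\<in>S. (r i)\<^sup>2 * W i - 2 * (P / Q) * (r i * W i) + (P / Q)\<^sup>2 * W i)"
    by (intro sum.cong) (auto simp: power2_eq_square algebra_simps)
  also have "\<dots> = V - 2 * (P / Q) * P + (P / Q)\<^sup>2 * Q"
    unfolding V_def P_def Q_def by (simp only: sum.distrib sum_subtractf sum_distrib_left)
  also have "\<dots> = V - P\<^sup>2 / Q" using Q by (simp add: power2_eq_square)
  finally have "(V - P\<^sup>2 / Q) * Q \<le> (\<beta> - \<alpha>)\<^sup>2 * Q * Q" using Q by (intro mult_right_mono) auto
  then have "V * Q \<le> P\<^sup>2 + (\<beta> - \<alpha>)\<^sup>2 * Q\<^sup>2"
    using Q by (simp add: power2_eq_square left_diff_distrib)
  also have "\<dots> \<le> P\<^sup>2 + (\<beta> - \<alpha>)\<^sup>2 * (P\<^sup>2 / \<alpha>\<^sup>2)"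
  proof -
    have "(\<alpha> * Q)\<^sup>2 \<le> P\<^sup>2" using lo r Q by (intro power_mono) auto
    then have "Q\<^sup>2 \<le> P\<^sup>2 / \<alpha>\<^sup>2" using r by (simp add: field_simps power_mult_distrib)
    then show ?thesis by (intro add_left_mono mult_left_mono) auto
  qed
  also have "\<dots> = (1 + (\<beta> - \<alpha>)\<^sup>2 / \<alpha>\<^sup>2) * P\<^sup>2" by (simp add: distrib_right)
  finally have VQ: "V * Q \<le> (1 + (\<beta> - \<alpha>)\<^sup>2 / \<alpha>\<^sup>2) * P\<^sup>2" .
  have "((\<Sum>i\<in>S. \<psi> i * (r i * W i)) / P)\<^sup>2 \<le> Y * V / P\<^sup>2"
    unfolding power_divide using CS by (rule divide_right_mono) simp
  also have "\<dots> = (Y / Q) * (V * Q / P\<^sup>2)" using Q by simp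
  also have "\<dots> \<le> (Y / Q) * (1 + (\<beta> - \<alpha>)\<^sup>2 / \<alpha>\<^sup>2)"
    using VQ P Q Y by (intro mult_left_mono) (auto simp: pos_divide_le_eq)
  finally show ?thesis unfolding P_def Q_def Y_def by (simp add: mult.commute)
qed

lemma expectation_cond_sample:
  fixes \<psi> :: "nat \<Rightarrow> real"
  assumes "finite S" "(\<Sum>i\<in>S. pmf p i) \<noteq> 0"
  shows "E (cond_sample p S) \<psi> = (\<Sum>i\<in>S. \<psi> i * pmf p i) / (\<Sum>i\<in>S. pmf p i)"
proof -
  have m: "measure_pmf.prob p S = (\<Sum>i\<in>S. pmf p i)" using assms by (simp add: measure_measure_pmf_finite)
  then have ne: "set_pmf p \<inter> S \<noteq> {}" using assms by (auto simp: measure_pmf_zero_iff[symmetric])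
  have "E (cond_sample p S) \<psi> = E (cond_pmf p S) \<psi>" using assms m by (simp add: cond_sample_def)
  also have "\<dots> = (\<Sum>i\<in>S. \<psi> i * pmf (cond_pmf p S) i)"
    by (rule integral_measure_pmf_real) (use assms ne in auto)
  finally show ?thesis by (simp add: pmf_cond[OF ne] m sum_divide_distrib)
qed

text \<open>Tensorisation: for a fixed list of query sets the answers are independent. The induction
  applies the one-query bound to the conditional expectation given the first answer.\<close>

lemma second_moment_answers:
  fixes h :: "nat list \<Rightarrow> real"
  assumes h: "\<And>xs. 0 \<le> h xs \<and> h xs \<le> 1" and M: "0 \<le> M"
    and step: "\<And>S \<psi>. S \<in> set Qs \<Longrightarrow> (E (cond_sample p S) \<psi>)\<^sup>2 \<le> M * E (cond_sample q S) (\<lambda>x. (\<psi> x)\<^sup>2)"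
  shows "(E (answers p Qs) h)\<^sup>2 \<le> M ^ length Qs * E (answers q Qs) (\<lambda>xs. (h xs)\<^sup>2)"
  using h step
proof (induction Qs arbitrary: h)
  case (Cons S Qs)
  have hb: "0 \<le> h xs" "h xs \<le> 1" "0 \<le> (h xs)\<^sup>2" "(h xs)\<^sup>2 \<le> 1" for xs
    using Cons.prems(1)[of xs] by (auto simp: power_le_one)
  define \<psi> where "\<psi> r f x = E (answers r Qs) (\<lambda>xs. f (x # xs))" for r and f :: "nat list \<Rightarrow> real" and x
  have "E (answers p (S # Qs)) h = E (cond_sample p S) (\<psi> p h)"
    unfolding \<psi>_def by (simp add: expectation_bind_pmf[where B = 1] hb)
  then have "(E (answers p (S # Qs)) h)\<^sup>2 \<le> M * E (cond_sample q S) (\<lambda>x. (\<psi> p h x)\<^sup>2)"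
    using Cons.prems(2)[of S] by simp
  also have "\<dots> \<le> M * E (cond_sample q S) (\<lambda>x. M ^ length Qs * \<psi> q (\<lambda>xs. (h xs)\<^sup>2) x)"
  proof (intro mult_left_mono M expectation_mono_pmf)
    fix x
    show le: "(\<psi> p h x)\<^sup>2 \<le> M ^ length Qs * \<psi> q (\<lambda>xs. (h xs)\<^sup>2) x"
      unfolding \<psi>_def by (rule Cons.IH) (use Cons.prems in auto)
    have avg: "0 \<le> \<psi> r f x" "\<psi> r f x \<le> 1" if f: "\<And>xs. 0 \<le> f xs" "\<And>xs. f xs \<le> 1" for r f
    proof -
      show "0 \<le> \<psi> r f x" unfolding \<psi>_def by (rule Bochner_Integration.integral_nonneg) (rule f)
      have "\<psi> r f x \<le> E (answers r Qs) (\<lambda>_. 1)"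
        unfolding \<psi>_def by (rule expectation_mono_pmf[where B = 1]) (simp_all add: f)
      then show "\<psi> r f x \<le> 1" by simp
    qed
    have "M ^ length Qs * \<psi> q (\<lambda>xs. (h xs)\<^sup>2) x \<le> M ^ length Qs * 1"
      using M by (intro mult_left_mono avg hb) auto
    moreover have "0 \<le> M ^ length Qs * \<psi> q (\<lambda>xs. (h xs)\<^sup>2) x"
      using M by (intro mult_nonneg_nonneg avg hb) auto
    moreover have "(\<psi> p h x)\<^sup>2 \<le> 1"
      by (intro power_le_one avg hb)
    ultimately show "\<bar>(\<psi> p h x)\<^sup>2\<bar> \<le> max 1 (M ^ length Qs)"
      "\<bar>M ^ length Qs * \<psi> q (\<lambda>xs. (h xs)\<^sup>2) x\<bar> \<le> max 1 (M ^ length Qs)"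
      by (simp_all add: max.coboundedI1 max.coboundedI2)
  qed
  also have "\<dots> = M ^ length (S # Qs) * E (answers q (S # Qs)) (\<lambda>xs. (h xs)\<^sup>2)"
    unfolding \<psi>_def by (simp add: expectation_bind_pmf[where B = 1] hb)
  finally show ?case .
qed simp

text \<open>The second moment of the likelihood ratio grows by at most a constant factor per query.\<close>

lemma query_lower_bound:
  assumes A: "valid_alg n (real m) A" and corr: "1 - \<delta> \<le> accept_prob A q" "1 - \<delta> \<le> 1 - accept_prob A p"
    and \<delta>: "\<delta> \<le> 1/4"
    and ratio: "\<And>i. i \<in> {1..n} \<Longrightarrow> 0 < pmf q i \<and> \<alpha> * pmf q i \<le> pmf p i \<and> pmf p i \<le> \<beta> * pmf q i"
    and \<alpha>: "0 < \<alpha>"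
  shows "1 / 2 \<le> \<delta> * (1 + (\<beta> - \<alpha>)\<^sup>2 / \<alpha>\<^sup>2) ^ m"
proof -
  define M where "M = 1 + (\<beta> - \<alpha>)\<^sup>2 / \<alpha>\<^sup>2"
  have M1: "1 \<le> M" by (simp add: M_def)
  define rej where "rej r = (\<lambda>(Qs, d). measure_pmf.prob (answers r Qs) {xs. \<not> d xs})" for r
  have rej_eq: "1 - accept_prob A r = E A (rej r)" for r
  proof -
    have "rej r x = 1 - (case x of (Qs, d) \<Rightarrow> measure_pmf.prob (answers r Qs) {xs. d xs})" for x
      by (cases x)
         (simp add: rej_def measure_pmf.prob_compl[symmetric] Compl_eq_Diff_UNIV[symmetric] Collect_neg_eq)
    then have "E A (rej r) = E A (\<lambda>x. 1 - (case x of (Qs, d) \<Rightarrow> measure_pmf.prob (answers r Qs) {xs. d xs}))"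
      by (intro expectation_cong_pmf) blast
    also have "\<dots> = 1 - accept_prob A r"
      unfolding accept_prob_eq
      by (subst Bochner_Integration.integral_diff)
         (auto intro!: integrable_bounded_pmf[of A _ 1] split: prod.splits)
    finally show ?thesis by simp
  qed
  have rej01: "0 \<le> rej r x" "rej r x \<le> 1" for r x by (auto simp: rej_def case_prod_unfold)
  have pt: "rej p x \<le> M ^ m * rej q x + 1/4" if x: "x \<in> set_pmf A" for x
  proof -
    obtain Qs d where xd: "x = (Qs, d)" by force
    have len: "length Qs \<le> m" and Qs: "\<And>S. S \<in> set Qs \<Longrightarrow> S \<noteq> {} \<and> S \<subseteq> {1..n}"
      using A x unfolding valid_alg_def xd of_nat_le_iff by blast+
    have "(E (cond_sample p S) \<psi>)\<^sup>2 \<le> M * E (cond_sample q S) (\<lambda>x. (\<psi> x)\<^sup>2)" if "S \<in> set Qs" for S \<psi>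
    proof -
      have S: "S \<noteq> {}" "S \<subseteq> {1..n}" using Qs[OF that] by auto
      then have fin: "finite S" using finite_subset by blast
      have qS: "0 < (\<Sum>i\<in>S. pmf q i)" using S fin ratio by (intro sum_pos) auto
      define r where "r i = pmf p i / pmf q i" for i
      have r: "pmf p i = r i * pmf q i" "\<alpha> \<le> r i" "r i \<le> \<beta>" if "i \<in> S" for i
      proof -
        have "i \<in> {1..n}" using that S by blast
        from ratio[OF this] show "pmf p i = r i * pmf q i" "\<alpha> \<le> r i" "r i \<le> \<beta>"
          by (simp_all add: r_def field_simps)
      qed
      have rs: "(\<Sum>i\<in>S. f i * pmf p i) = (\<Sum>i\<in>S. f i * (r i * pmf q i))" for f :: "nat \<Rightarrow> real"
        by (intro sum.cong) (auto simp: r(1))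
      have rs1: "(\<Sum>i\<in>S. pmf p i) = (\<Sum>i\<in>S. r i * pmf q i)"
        by (intro sum.cong) (auto simp: r(1))
      have "0 < pmf p i" if "i \<in> S" for i
      proof -
        have "i \<in> {1..n}" using that S by blast
        then show ?thesis using ratio[of i] \<alpha> by (meson less_le_trans mult_pos_pos)
      qed
      then have pS: "0 < (\<Sum>i\<in>S. pmf p i)" using S fin by (intro sum_pos) auto
      show ?thesis
        using weighted_second_moment[of S "pmf q" \<alpha> r \<beta> \<psi>] fin qS \<alpha> r(2,3)
          expectation_cond_sample[of S p \<psi>] expectation_cond_sample[of S q "\<lambda>x. (\<psi> x)\<^sup>2"] pS
        unfolding M_def rs rs1 by simp
    qed
    then have "(E (answers p Qs) (indicator {xs. \<not> d xs}))\<^sup>2 \<le>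
        M ^ length Qs * E (answers q Qs) (\<lambda>xs. (indicator {xs. \<not> d xs} xs)\<^sup>2)"
      using M1 by (intro second_moment_answers) (auto simp: indicator_le_1)
    moreover have "(\<lambda>xs. (indicator {xs. \<not> d xs} xs)\<^sup>2) = (indicator {xs. \<not> d xs} :: nat list \<Rightarrow> real)"
      by (auto simp: indicator_def)
    ultimately have "(rej p x)\<^sup>2 \<le> M ^ length Qs * rej q x" by (simp add: rej_def xd)
    also have "\<dots> \<le> M ^ m * rej q x"
      using M1 len rej01 by (intro mult_right_mono power_increasing) auto
    finally have "(rej p x)\<^sup>2 \<le> M ^ m * rej q x" .
    \<comment> \<open>A linear substitute for the square root, which can be averaged over the
      algorithm's randomness. It costs 1/4, and \<delta> another 1/4, leaving the 1/2 of the
      conclusion.\<close>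
    moreover have "rej p x \<le> (rej p x)\<^sup>2 + 1/4"
      using zero_le_power2[of "rej p x - 1/2"] by (simp add: power2_eq_square algebra_simps)
    ultimately show ?thesis by linarith
  qed
  have "1 - \<delta> \<le> E A (rej p)" using corr(2) rej_eq by simp
  also have "\<dots> \<le> E A (\<lambda>x. M ^ m * rej q x + 1/4)"
  proof (rule expectation_mono_pmf[OF pt])
    fix x
    have "M ^ m * rej q x \<le> M ^ m * 1" "0 \<le> M ^ m * rej q x"
      using M1 rej01 by (auto intro!: mult_left_mono)
    moreover have "1 \<le> M ^ m" using M1 by simp
    ultimately show "\<bar>rej p x\<bar> \<le> M ^ m + 1" "\<bar>M ^ m * rej q x + 1/4\<bar> \<le> M ^ m + 1"
      using rej01[of p x] by linarith+
  qed
  also have "\<dots> = M ^ m * E A (rej q) + 1/4"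
    using rej01 by (subst Bochner_Integration.integral_add) (auto intro!: integrable_mult_right integrable_bounded_pmf[of A _ 1])
  also have "E A (rej q) \<le> \<delta>" using corr(1) rej_eq[of q] by simp
  then have "M ^ m * E A (rej q) + 1/4 \<le> M ^ m * \<delta> + 1/4"
    using M1 by (intro add_right_mono mult_left_mono) auto
  finally show ?thesis using \<delta> by (simp add: M_def mult.commute)
qed

section \<open>Lower bound and conclusion\<close>

lemma pmf_on_interval_exists:
  assumes f: "\<And>i. i \<in> {1..n} \<Longrightarrow> 0 \<le> f i" and one: "(\<Sum>i\<in>{1..n}. f i) = (1::real)"
  shows "\<exists>p. is_dist n p \<and> (\<forall>i\<in>{1..n}. pmf p i = f i)"
proof -
  define g where "g i = (if i \<in> {1..n} then f i else 0)" for i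
  have g0: "0 \<le> g i" for i using f by (simp add: g_def)
  have "(\<integral>\<^sup>+ i. ennreal (g i) \<partial>count_space UNIV) = (\<integral>\<^sup>+ i. ennreal (g i) \<partial>count_space {1..n})"
    by (rule nn_integral_count_space_eq) (auto simp: g_def)
  also have "\<dots> = (\<Sum>i\<in>{1..n}. ennreal (f i))"
    by (subst nn_integral_count_space_finite) (auto simp: g_def intro!: sum.cong)
  also have "\<dots> = 1" using f one by (subst sum_ennreal) auto
  finally have eq: "pmf (embed_pmf g) i = g i" for i by (intro pmf_embed_pmf g0)
  have "is_dist n (embed_pmf g)"
    unfolding is_dist_def by (auto simp: set_pmf_iff eq g_def split: if_splits)
  then show ?thesis using eq by (intro exI[of _ "embed_pmf g"]) (simp add: g_def)
qed

text \<open>Mass is shifted from the first \<open>a\<close> elements to the other \<open>b\<close>,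
  the larger half to the smaller; \<open>c = a / b\<close> keeps the total at 1 and is at most 2
  even for odd \<open>n\<close>. The total variation distance is \<epsilon> a / n, hence at least
  \<epsilon> / 2.\<close>

lemma hard_pair_exists:
  assumes n: "2 \<le> n" and eps: "0 < \<epsilon>" "\<epsilon> < 1"
  shows "\<exists>q p. is_dist n q \<and> is_dist n p \<and> dist_unif_inf n q \<le> 1 / (100 * real n) \<and> \<epsilon> / 2 \<le> dTV n p q \<and>
    (\<exists>\<alpha> \<beta>. 0 < \<alpha> \<and> (\<beta> - \<alpha>)\<^sup>2 / \<alpha>\<^sup>2 \<le> 646416 * \<epsilon>\<^sup>2 \<and>
      (\<forall>i\<in>{1..n}. 0 < pmf q i \<and> \<alpha> * pmf q i \<le> pmf p i \<and> pmf p i \<le> \<beta> * pmf q i))"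
proof -
  define a where "a = (n + 1) div 2"
  define b where "b = n - a"
  define c where "c = real a / real b"
  \<comment> \<open>Putting \<open>q\<close> at tilt -1/200 instead of 0 uses the permitted
    deviation from uniform. Then \<open>1 - y\<close> stays above 1/200 and the ratio \<alpha> above
    1/201, even for \<epsilon> near 1.\<close>
  define y where "y = \<epsilon> - 1/200"
  have ab: "1 \<le> b" "a \<le> 2 * b" "b \<le> a" "a + b = n" "a \<le> n" using n by (auto simp: a_def b_def)
  then have c: "1 \<le> c" "c \<le> 2" "real b * c = real a" by (auto simp: c_def field_simps)
  have n0: "0 < real n" using n by simp
  have an: "real n \<le> 2 * real a" using ab by linarith
  define tilt where "tilt x i = (if i \<le> a then (1 - x) / real n else (1 + x * c) / real n)" for x :: real and i :: nat
  have split: "(\<Sum>i\<in>{1..n}. if i \<le> a then u else v) = real a * u + real b * v" for u v :: real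
  proof -
    have "{1..n} \<inter> {i. i \<le> a} = {1..a}" "{1..n} \<inter> - {i. i \<le> a} = {a+1..n}" using ab(5) by auto
    then show ?thesis by (subst sum.If_cases) (simp_all add: b_def)
  qed
  have tot: "(\<Sum>i\<in>{1..n}. tilt x i) = 1" for x
  proof -
    have "real a * ((1 - x) / real n) + real b * ((1 + x * c) / real n) = (real a + real b + x * (real b * c - real a)) / real n"
      by (simp add: add_divide_distrib diff_divide_distrib algebra_simps)
    also have "\<dots> = 1" using ab c n0 by (simp flip: of_nat_add)
    finally show ?thesis unfolding tilt_def split .
  qed
  have pos: "0 < tilt x i" if "- 1 / 200 \<le> x" "x \<le> 199 / 200" for x i
  proof -
    have "(- 1 / 200) * c \<le> x * c" using that c by (intro mult_right_mono) auto
    then have "0 < 1 + x * c" using c by simp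
    then show ?thesis using that n0 by (simp add: tilt_def)
  qed
  have y: "- 1 / 200 \<le> y" "y \<le> 199 / 200" using eps by (auto simp: y_def)
  have dist: "\<exists>r. is_dist n r \<and> (\<forall>i\<in>{1..n}. pmf r i = tilt x i)"
    if "- 1 / 200 \<le> x" "x \<le> 199 / 200" for x
    by (rule pmf_on_interval_exists[OF _ tot]) (rule less_imp_le[OF pos[OF that]])
  obtain q where q: "is_dist n q" "\<And>i. i \<in> {1..n} \<Longrightarrow> pmf q i = tilt (- 1 / 200) i"
    using dist[of "- 1 / 200"] by auto
  obtain p where p: "is_dist n p" "\<And>i. i \<in> {1..n} \<Longrightarrow> pmf p i = tilt y i"
    using dist[OF y] by blast
  have near: "dist_unif_inf n q \<le> 1 / (100 * real n)"
    unfolding dist_unif_inf_def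
  proof (rule Max.boundedI)
    fix z assume "z \<in> (\<lambda>i. \<bar>pmf q i - 1 / real n\<bar>) ` {1..n}"
    then obtain i where i: "i \<in> {1..n}" "z = \<bar>pmf q i - 1 / real n\<bar>" by blast
    have "pmf q i - 1 / real n = (if i \<le> a then 1 / 200 else - c / 200) / real n"
      by (simp add: q(2)[OF i(1)] tilt_def diff_divide_distrib add_divide_distrib)
    then have "z = (if i \<le> a then 1 / 200 else c / 200) / real n"
      using c n0 by (simp add: i(2))
    also have "\<dots> \<le> (1 / 100) / real n" using c n0 by (intro divide_right_mono) auto
    finally show "z \<le> 1 / (100 * real n)" by simp
  qed (use n in auto)
  have "(\<Sum>i\<in>{1..n}. \<bar>pmf p i - pmf q i\<bar>) = (\<Sum>i\<in>{1..n}. if i \<le> a then \<epsilon> / real n else \<epsilon> * c / real n)"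
  proof (rule sum.cong[OF refl])
    fix i assume i: "i \<in> {1..n}"
    have "pmf p i - pmf q i = (if i \<le> a then - \<epsilon> / real n else \<epsilon> * c / real n)"
      unfolding p(2)[OF i] q(2)[OF i] tilt_def y_def using n0 by (simp add: field_simps)
    then show "\<bar>pmf p i - pmf q i\<bar> = (if i \<le> a then \<epsilon> / real n else \<epsilon> * c / real n)"
      using eps c n0 by (simp add: abs_mult)
  qed
  also have "\<dots> = real a * (\<epsilon> / real n) + real b * (\<epsilon> * c / real n)" by (rule split)
  also have "real b * (\<epsilon> * c / real n) = (real b * c) * (\<epsilon> / real n)" by simp
  finally have "dTV n p q = real a * \<epsilon> / real n" unfolding c by (simp add: dTV_def)
  moreover have "real n * \<epsilon> \<le> 2 * real a * \<epsilon>" using an eps by (intro mult_right_mono) auto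
  ultimately have "real n * (\<epsilon> / 2) \<le> real n * dTV n p q" using n0 by simp
  then have far: "\<epsilon> / 2 \<le> dTV n p q" using n0 by (simp only: mult_le_cancel_left_pos)
  define \<alpha> where "\<alpha> = (1 - y) / (1 + 1/200)"
  define \<beta> where "\<beta> = (1 + y * c) / (1 - c / 200)"
  have c99: "99 / 100 \<le> 1 - c / 200" using c by simp
  have \<alpha>1: "\<alpha> = 1 - \<epsilon> / (1 + 1/200)" by (simp add: \<alpha>_def y_def field_simps)
  have \<beta>1: "\<beta> = 1 + \<epsilon> * c / (1 - c / 200)" using c99 by (simp add: \<beta>_def y_def field_simps)
  have \<alpha>: "1 / 201 \<le> \<alpha>" using eps by (simp add: \<alpha>_def y_def field_simps)
  have \<alpha>le: "\<alpha> \<le> 1" using eps by (simp add: \<alpha>1)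
  have hi: "0 \<le> \<epsilon> * c / (1 - c / 200)" using eps c c99 by (intro divide_nonneg_nonneg) auto
  have "\<epsilon> * c / (1 - c / 200) \<le> \<epsilon> * 2 / (99 / 100)"
    using eps c c99 by (intro frac_le mult_left_mono) auto
  moreover have "\<epsilon> / (1 + 1/200) \<le> \<epsilon>" using eps by (simp add: field_simps)
  ultimately have "\<beta> - \<alpha> \<le> 4 * \<epsilon>" using eps unfolding \<alpha>1 \<beta>1 by simp
  moreover have "0 \<le> \<beta> - \<alpha>" using hi \<alpha>le unfolding \<beta>1 by simp
  \<comment> \<open>646416 is the square of 4 * 201.\<close>
  ultimately have "((\<beta> - \<alpha>) / \<alpha>)\<^sup>2 \<le> (4 * \<epsilon> / (1 / 201))\<^sup>2"
    using \<alpha> by (intro power_mono frac_le divide_nonneg_nonneg) auto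
  then have "(\<beta> - \<alpha>)\<^sup>2 / \<alpha>\<^sup>2 \<le> 646416 * \<epsilon>\<^sup>2" by (simp add: power_divide power_mult_distrib)
  moreover have "0 < pmf q i \<and> \<alpha> * pmf q i \<le> pmf p i \<and> pmf p i \<le> \<beta> * pmf q i" if i: "i \<in> {1..n}" for i
  proof -
    have q0: "0 < pmf q i" unfolding q(2)[OF i] by (rule pos) auto
    have "pmf p i = (if i \<le> a then \<alpha> else \<beta>) * pmf q i"
      unfolding p(2)[OF i] q(2)[OF i] tilt_def \<alpha>_def \<beta>_def using c99 n0 by (simp add: field_simps)
    moreover have "\<alpha> \<le> \<beta>" using \<open>0 \<le> \<beta> - \<alpha>\<close> by simp
    ultimately show ?thesis using q0 by (auto intro: mult_right_mono)
  qed
  moreover have "0 < \<alpha>" using \<alpha> by linarith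
  ultimately show ?thesis using q(1) p(1) near far by blast
qed

text \<open>\<delta> is at most 1 / (300 L), so \<open>query_lower_bound\<close> makes the
  exponential of \<open>646416 * \<epsilon>\<^sup>2 * real m\<close> at least 150 L. As 150 exceeds
  e, taking logarithms yields 1 + ln L.\<close>

lemma tester_cost_lower_bound:
  fixes m :: nat
  assumes n: "2 \<le> n" and eps: "0 < \<epsilon>" "\<epsilon> < 1"
  defines "L \<equiv> log 2 (real n / \<epsilon>)"
  defines "\<delta> \<equiv> log 2 (1 + 1/100) / (6 * log 2 (100 * real n / \<epsilon>))"
  assumes A: "\<And>q. is_dist n q \<Longrightarrow> dist_unif_inf n q \<le> 1 / (100 * real n) \<Longrightarrow>
    valid_alg n (real m) (A q) \<and> correct_tester n (\<epsilon> / 2) \<delta> q (A q)"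
  shows "1 + ln L \<le> 646416 * \<epsilon>\<^sup>2 * real m"
proof -
  have L1: "1 \<le> L"
  proof -
    have "2 * \<epsilon> \<le> real n" using n eps by linarith
    then show ?thesis using eps n by (simp add: L_def le_log_iff field_simps)
  qed
  have "log 2 (100 * real n / \<epsilon>) = log 2 100 + L"
    unfolding L_def using n eps by (subst log_mult_pos[symmetric]) (auto simp: field_simps)
  then have L2: "L \<le> log 2 (100 * real n / \<epsilon>)" by simp
  have "ln (1 + 1/100 :: real) \<le> 1/100" by (rule ln_add_one_self_le_self) simp
  moreover have "1/2 \<le> ln (2::real)" using ln2_ge_two_thirds by linarith
  ultimately have "ln (1 + 1/100 :: real) / ln 2 \<le> (1/100) / (1/2)" by (intro frac_le) auto
  then have l: "log 2 (1 + 1/100 :: real) \<le> 1/50" by (simp add: log_def)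
  have \<delta>_le: "\<delta> \<le> 1 / (300 * L)"
  proof -
    have "\<delta> \<le> (1/50) / (6 * L)" unfolding \<delta>_def using l L1 L2 by (intro frac_le) auto
    then show ?thesis by simp
  qed
  have \<delta>0: "0 < \<delta>" unfolding \<delta>_def using L1 L2 by (intro divide_pos_pos) auto
  have "1 / (300 * L) \<le> 1 / 300" using L1 by (intro divide_left_mono) auto
  then have \<delta>4: "\<delta> \<le> 1/4" using \<delta>_le by linarith
  obtain q p \<alpha> \<beta> where q: "is_dist n q" and p: "is_dist n p" and near: "dist_unif_inf n q \<le> 1 / (100 * real n)"
    and far: "\<epsilon> / 2 \<le> dTV n p q" and \<alpha>: "0 < \<alpha>" and chi: "(\<beta> - \<alpha>)\<^sup>2 / \<alpha>\<^sup>2 \<le> 646416 * \<epsilon>\<^sup>2"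
    and ratio: "\<And>i. i \<in> {1..n} \<Longrightarrow> 0 < pmf q i \<and> \<alpha> * pmf q i \<le> pmf p i \<and> pmf p i \<le> \<beta> * pmf q i"
    using hard_pair_exists[OF n eps] by blast
  have valid: "valid_alg n (real m) (A q)" and corr: "correct_tester n (\<epsilon> / 2) \<delta> q (A q)"
    using A[OF q near] by auto
  have "1 / 2 \<le> \<delta> * (1 + (\<beta> - \<alpha>)\<^sup>2 / \<alpha>\<^sup>2) ^ m"
  proof (rule query_lower_bound[OF valid _ _ \<delta>4 ratio \<alpha>])
    show "1 - \<delta> \<le> accept_prob (A q) q" "1 - \<delta> \<le> 1 - accept_prob (A q) p"
      using corr q p far unfolding correct_tester_def by auto
  qed
  also have "\<dots> \<le> (1 / (300 * L)) * exp (646416 * \<epsilon>\<^sup>2) ^ m"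
  proof (intro mult_mono power_mono \<delta>_le)
    have "1 + (\<beta> - \<alpha>)\<^sup>2 / \<alpha>\<^sup>2 \<le> 1 + 646416 * \<epsilon>\<^sup>2" using chi by simp
    also have "\<dots> \<le> exp (646416 * \<epsilon>\<^sup>2)" by (rule exp_ge_add_one_self)
    finally show "1 + (\<beta> - \<alpha>)\<^sup>2 / \<alpha>\<^sup>2 \<le> exp (646416 * \<epsilon>\<^sup>2)" .
  qed (use L1 in auto)
  also have "exp (646416 * \<epsilon>\<^sup>2) ^ m = exp (646416 * \<epsilon>\<^sup>2 * real m)"
    by (simp add: mult.commute flip: exp_of_nat_mult)
  finally have "150 * L \<le> exp (646416 * \<epsilon>\<^sup>2 * real m)" using L1 by (simp add: field_simps)
  moreover have "exp 1 * L \<le> 150 * L" using exp_le L1 by (intro mult_right_mono) auto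
  moreover have "exp (1 + ln L) = exp 1 * L" using L1 by (simp add: exp_add)
  ultimately have "exp (1 + ln L) \<le> exp (646416 * \<epsilon>\<^sup>2 * real m)" by linarith
  then show ?thesis by simp
qed

text \<open>There is only one distribution on a single point, so no far case exists and accepting
  without a query is correct.\<close>

lemma single_element_tester:
  assumes "is_dist 1 q" "0 < \<epsilon>"
  shows "valid_alg 1 0 triv_alg \<and> correct_tester 1 \<epsilon> (1/3) q triv_alg"
proof -
  have one: "pmf r 1 = 1" if "is_dist 1 r" for r
    using that set_pmf_subset_singleton[of r 1] by (simp add: is_dist_def)
  show ?thesis
    using assms by (auto simp: correct_tester_def valid_triv accept_prob_triv dTV_def one[unfolded One_nat_def])
qed

theorem theorem6p1:
  "\<exists>C>0. \<forall>(m :: nat \<Rightarrow> real \<Rightarrow> real \<Rightarrow> nat) (A :: nat \<Rightarrow> real \<Rightarrow> real \<Rightarrow> nat pmf \<Rightarrow> nacond_alg).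
     (\<forall>n eps delta q. n \<ge> 1 \<and> 0 < eps \<and> eps < 1 \<and> 0 < delta \<and> delta < 1 \<and>
        is_dist n q \<and> dist_unif_inf n q \<le> 1 / (100 * real n) \<longrightarrow>
        valid_alg n (real (m n eps delta)) (A n eps delta q) \<and>
        correct_tester n eps delta q (A n eps delta q))
     \<longrightarrow>
     (\<exists>B :: nat \<Rightarrow> real \<Rightarrow> nat pmf \<Rightarrow> nacond_alg.
       \<forall>n eps q. n \<ge> 1 \<and> 0 < eps \<and> eps < 1 \<and> is_dist n q \<longrightarrow>
         valid_alg n
           (C * (log 2 (real n / eps) *
                   real (m n (eps / 2) (log 2 (1 + 1/100) / (6 * log 2 (100 * real n / eps))))
                 + sqrt (log 2 (real n / eps)) / eps\<^sup>2))
           (B n eps q) \<and>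
         correct_tester n eps (1/3) q (B n eps q))"
proof -
  \<comment> \<open>The constant of the tester times the constant of the lower bound: together they
    turn \<open>L * (1 + ln L) / eps\<^sup>2\<close> into \<open>L * M\<close>.\<close>
  define C :: real where "C = 325000000 * 646416"
  define cost where "cost m n eps = C * (log 2 (real n / eps) *
      real (m n (eps / 2) (log 2 (1 + 1/100) / (6 * log 2 (100 * real n / eps))))
      + sqrt (log 2 (real n / eps)) / eps\<^sup>2)" for m :: "nat \<Rightarrow> real \<Rightarrow> real \<Rightarrow> nat" and n :: nat and eps :: real
  have ex: "\<exists>B. valid_alg n (cost m n eps) B \<and> correct_tester n eps (1/3) q B"
    if A: "\<forall>n eps delta q. n \<ge> 1 \<and> 0 < eps \<and> eps < 1 \<and> 0 < delta \<and> delta < 1 \<and>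
        is_dist n q \<and> dist_unif_inf n q \<le> 1 / (100 * real n) \<longrightarrow>
        valid_alg n (real (m n eps delta)) (A n eps delta q) \<and>
        correct_tester n eps delta q (A n eps delta q)"
      and n: "1 \<le> n" and eps: "0 < eps" "eps < 1" and q: "is_dist n q"
    for m :: "nat \<Rightarrow> real \<Rightarrow> real \<Rightarrow> nat" and A :: "nat \<Rightarrow> real \<Rightarrow> real \<Rightarrow> nat pmf \<Rightarrow> nacond_alg"
      and n :: nat and eps :: real and q
  proof -
    define L where "L = log 2 (real n / eps)"
    define \<delta> where "\<delta> = log 2 (1 + 1/100) / (6 * log 2 (100 * real n / eps))"
    define M where "M = real (m n (eps / 2) \<delta>)"
    have cost: "cost m n eps = C * (L * M + sqrt L / eps\<^sup>2)"
      by (simp add: cost_def L_def M_def \<delta>_def)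
    have "1 \<le> real n / eps" using n eps by (simp add: field_simps)
    then have L0: "0 \<le> L" unfolding L_def by simp
    show ?thesis
    proof (cases "n = 1")
      case True
      have "0 \<le> cost m n eps" unfolding cost C_def M_def using L0 by simp
      then show ?thesis using single_element_tester[of q eps] q eps True valid_alg_mono by blast
    next
      case False
      then have n2: "2 \<le> n" using n by simp
      have "0 < \<delta> \<and> \<delta> < 1"
      proof -
        have "2 \<le> 100 * real n / eps" using n eps by (simp add: field_simps)
        then have "1 \<le> log 2 (100 * real n / eps)" using n eps by (subst le_log_iff) auto
        moreover have "0 < log 2 (1 + 1/100 :: real)" by simp
        moreover have "log 2 (1 + 1/100 :: real) \<le> 1" by (subst log_le_one_cancel_iff) auto
        ultimately have "0 < log 2 (1 + 1/100 :: real)" "0 < 6 * log 2 (100 * real n / eps)"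
          "log 2 (1 + 1/100 :: real) < 6 * log 2 (100 * real n / eps)"
          by linarith+
        then show ?thesis unfolding \<delta>_def by (intro conjI divide_pos_pos; simp add: divide_less_eq_1)
      qed
      then have "1 + ln L \<le> 646416 * eps\<^sup>2 * M"
        unfolding L_def M_def \<delta>_def
        by (intro tester_cost_lower_bound[OF n2 eps, of _ "A n (eps / 2) \<delta>"]) (use A n eps in \<open>auto simp: \<delta>_def\<close>)
      then have "325000000 * L * (1 + ln L) \<le> 325000000 * L * (646416 * eps\<^sup>2 * M)"
        using L0 by (intro mult_left_mono) auto
      then have "325000000 * L * (1 + ln L) / eps\<^sup>2 \<le> 325000000 * L * (646416 * eps\<^sup>2 * M) / eps\<^sup>2"
        by (rule divide_right_mono) simp
      also have "\<dots> = C * (L * M)" using eps by (simp add: C_def)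
      also have "\<dots> \<le> cost m n eps" unfolding cost C_def using L0 by (intro mult_left_mono) auto
      finally show ?thesis
        using identity_tester_exists[OF n2 eps q] valid_alg_mono unfolding L_def by blast
    qed
  qed
  show ?thesis
  proof (intro exI[of _ C] conjI allI impI)
    show "0 < C" by (simp add: C_def)
    fix m :: "nat \<Rightarrow> real \<Rightarrow> real \<Rightarrow> nat" and A :: "nat \<Rightarrow> real \<Rightarrow> real \<Rightarrow> nat pmf \<Rightarrow> nacond_alg"
    assume A: "\<forall>n eps delta q. n \<ge> 1 \<and> 0 < eps \<and> eps < 1 \<and> 0 < delta \<and> delta < 1 \<and>
        is_dist n q \<and> dist_unif_inf n q \<le> 1 / (100 * real n) \<longrightarrow>
        valid_alg n (real (m n eps delta)) (A n eps delta q) \<and>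
        correct_tester n eps delta q (A n eps delta q)"
    define B where "B n eps q = (SOME B. valid_alg n (cost m n eps) B \<and> correct_tester n eps (1/3) q B)" for n eps q
    have "valid_alg n (cost m n eps) (B n eps q) \<and> correct_tester n eps (1/3) q (B n eps q)"
      if "n \<ge> 1 \<and> 0 < eps \<and> eps < 1 \<and> is_dist n q" for n eps q
      unfolding B_def by (rule someI_ex) (use ex[OF A] that in blast)
    then show "\<exists>B :: nat \<Rightarrow> real \<Rightarrow> nat pmf \<Rightarrow> nacond_alg.
       \<forall>n eps q. n \<ge> 1 \<and> 0 < eps \<and> eps < 1 \<and> is_dist n q \<longrightarrow>
         valid_alg n
           (C * (log 2 (real n / eps) *
                   real (m n (eps / 2) (log 2 (1 + 1/100) / (6 * log 2 (100 * real n / eps))))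
                 + sqrt (log 2 (real n / eps)) / eps\<^sup>2))
           (B n eps q) \<and>
         correct_tester n eps (1/3) q (B n eps q)"
      unfolding cost_def by blast
  qed
qed

end
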